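(* There exist an absolute constant $\alpha \ge 1$ and a polynomial-time algorithm which, given a finite metric space $(V,d)$ and a positive integer $k$, outputs a tree cover $\{T_1,\dots,T_k\}$ of $(V,d)$ of size $k$ such that for every $p\in[1,\infty)$, $$\Big(\sum_{i=1}^k w(T_i)^p\Big)^{1/p}\le \alpha\cdot \mathrm{OPT}_p ,$$ where $\mathrm{OPT}_p$ is the minimum of $\big(\sum_{i=1}^k w(\hat T_i)^p\big)^{1/p}$ over all tree covers $\{\hat T_1,\dots,\hat T_k\}$ of $(V,d)$ of size $k$. (That is, the All-Norm Tree Cover problem admits a polynomial-time $O(1)$-approximation.)
   Context: A finite metric space $(V,d)$ is identified with the complete graph on $V$ with edge weights $d$. A tree is a tree in this complete graph on some subset of $V$ (a single vertex is allowed); its weight is $w(T)=\sum_{uv\in E(T)} d(u,v)$. A tree cover of size $k$ is a collection of $k$ trees whose vertex sets together cover $V$; the trees need not be disjoint. *)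

theory Defs
  imports "HOL-Analysis.Abstract_Metric_Spaces" "HOL-Computational_Algebra.Polynomial"
begin

section \<open>Trees and tree covers in a finite metric space\<close>

text \<open>
  A graph is a pair of a vertex set and an edge set.  The vertices are linearly ordered, and the
  undirected edge between \<open>u < v\<close> is represented by the single pair \<open>(u, v)\<close>; hence a sum over
  the edge set counts every undirected edge once.
\<close>

type_synonym 'a ugraph = "'a set \<times> ('a \<times> 'a) set"

definition subgraph_of_complete :: "'a::linorder set \<Rightarrow> 'a ugraph \<Rightarrow> bool" where
  "subgraph_of_complete V = (\<lambda>(S, E). S \<subseteq> V \<and> E \<subseteq> {(u, v). u \<in> S \<and> v \<in> S \<and> u < v})"

definition connected_graph :: "'a ugraph \<Rightarrow> bool" where
  "connected_graph = (\<lambda>(S, E). S \<noteq> {} \<and> (\<forall>u\<in>S. \<forall>v\<in>S. (u, v) \<in> (E \<union> E\<inverse>)\<^sup>*))"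

definition is_cycle :: "('a \<times> 'a) set \<Rightarrow> 'a list \<Rightarrow> bool" where
  "is_cycle E c \<longleftrightarrow> 3 \<le> length c \<and> distinct c \<and>
     (\<forall>i<length c. (c ! i, c ! (Suc i mod length c)) \<in> E \<union> E\<inverse>)"

definition is_tree :: "'a::linorder set \<Rightarrow> 'a ugraph \<Rightarrow> bool" where
  "is_tree V T \<longleftrightarrow> subgraph_of_complete V T \<and> connected_graph T \<and> (\<nexists>c. is_cycle (snd T) c)"

definition weight :: "('a \<Rightarrow> 'a \<Rightarrow> real) \<Rightarrow> 'a ugraph \<Rightarrow> real" where
  "weight d T = (\<Sum>(u, v)\<in>snd T. d u v)"

definition tree_cover :: "'a::linorder set \<Rightarrow> nat \<Rightarrow> 'a ugraph list \<Rightarrow> bool" where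
  "tree_cover V k Ts \<longleftrightarrow> length Ts = k \<and> (\<forall>T\<in>set Ts. is_tree V T) \<and> (\<Union>T\<in>set Ts. fst T) = V"

definition lp_cost :: "real \<Rightarrow> ('a \<Rightarrow> 'a \<Rightarrow> real) \<Rightarrow> 'a ugraph list \<Rightarrow> real" where
  "lp_cost p d Ts = (\<Sum>i<length Ts. weight d (Ts ! i) powr p) powr (1 / p)"

definition OPT :: "real \<Rightarrow> 'a::linorder set \<Rightarrow> ('a \<Rightarrow> 'a \<Rightarrow> real) \<Rightarrow> nat \<Rightarrow> real" where
  "OPT p V d k = Min (lp_cost p d ` {Ts. tree_cover V k Ts})"

text \<open>The minimum ranges over a finite nonempty set, so it is attained.\<close>

lemma finite_tree_covers:
  assumes "finite V"
  shows "finite {Ts. tree_cover V k Ts}"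
proof (rule finite_subset)
  show "{Ts. tree_cover V k Ts} \<subseteq> {Ts. set Ts \<subseteq> Pow V \<times> Pow (V \<times> V) \<and> length Ts = k}"
    by (fastforce simp: tree_cover_def is_tree_def subgraph_of_complete_def)
  show "finite {Ts. set Ts \<subseteq> Pow V \<times> Pow (V \<times> V) \<and> length Ts = k}"
    by (rule finite_lists_length_eq) (use assms in auto)
qed

lemma tree_cover_exists:
  fixes V :: "'a::linorder set"
  assumes "finite V" "V \<noteq> {}" "k \<ge> 1"
  shows "\<exists>Ts. tree_cover V k Ts"
proof -
  define m where "m = Min V"
  have m: "m \<in> V" "\<And>v. v \<in> V \<Longrightarrow> m \<le> v"
    using assms by (auto simp: m_def)
  define E where "E = {m} \<times> (V - {m})"
  have star: "(m, v) \<in> (E \<union> E\<inverse>)\<^sup>*" "(v, m) \<in> (E \<union> E\<inverse>)\<^sup>*" if "v \<in> V" for v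
    using that by (cases "v = m"; auto simp: E_def)+
  have "connected_graph (V, E)"
    using assms(2) star by (auto simp: connected_graph_def intro: rtrancl_trans)
  moreover have "subgraph_of_complete V (V, E)"
    using m by (auto simp: subgraph_of_complete_def E_def order.strict_iff_order)
  moreover have "\<not> is_cycle E c" for c
  proof
    assume c: "is_cycle E c"
    then have len: "3 \<le> length c" and dist: "distinct c"
      and adj: "\<And>i. i < length c \<Longrightarrow> (c ! i, c ! (Suc i mod length c)) \<in> E \<union> E\<inverse>"
      by (auto simp: is_cycle_def)
    have c0: "c \<noteq> []"
      using len by auto
    have "(c ! 0, c ! 1) \<in> E \<union> E\<inverse>" "(c ! 1, c ! 2) \<in> E \<union> E\<inverse>"
      using adj[of 0] adj[of 1] len c0 by (simp_all add: numeral_2_eq_2)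
    moreover have "(c ! 2, c ! (3 mod length c)) \<in> E \<union> E\<inverse>"
      using adj[of 2] len by (simp add: numeral_3_eq_3)
    moreover have "c ! 0 \<noteq> c ! 1" "c ! 1 \<noteq> c ! 2" "c ! 0 \<noteq> c ! 2"
      using dist len c0 by (simp_all add: nth_eq_iff_index_eq)
    moreover have "c ! (3 mod length c) \<noteq> c ! 1"
    proof -
      have "3 mod length c \<noteq> 1" "3 mod length c < length c"
        using len by (cases "length c = 3"; simp)+
      moreover have "1 < length c"
        using len by linarith
      ultimately show ?thesis
        using dist nth_eq_iff_index_eq by metis
    qed
    ultimately show False
      by (auto simp: E_def)
  qed
  ultimately have "is_tree V (V, E)"
    by (auto simp: is_tree_def)
  then have "tree_cover V k (replicate k (V, E))"
    using assms(3) by (auto simp: tree_cover_def set_replicate_conv_if)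
  then show ?thesis ..
qed


section \<open>Model of computation\<close>

text \<open>
  Algorithms are programs of an imperative language over an additive real RAM.  There are two
  disjoint sorts of variables: one holds natural numbers (control, addressing, output), the other
  real numbers (distances).  Every variable is an array addressed by a list of naturals; a scalar is
  accessed with the empty address.  The only operations on reals are addition, subtraction and
  comparison.  There are no real constants, no multiplication, division or rounding, and no
  conversion between the sorts.  Nor is there multiplication of naturals.

  Every operation is charged one unit.  Without multiplication this is a reasonable measure:
  by the lemma \<open>exec_growth\<close> below, an execution of cost \<open>t\<close> at most multiplies the size of the
  numbers involved by \<open>2 ^ t\<close>, so that their bit lengths grow by at most \<open>t\<close>; and it never leaves
  the additive group generated by the real inputs (no new denominators arise for rational inputs).
  Thus polynomial cost entails polynomial time on a Turing machine for rational inputs, while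
  the model is meaningful for arbitrary real distances.
\<close>

type_synonym vname = string
type_synonym state = "(vname \<Rightarrow> nat list \<Rightarrow> nat) \<times> (vname \<Rightarrow> nat list \<Rightarrow> real)"

datatype iexp = N nat | I vname "iexp list" | IPlus iexp iexp | IMinus iexp iexp

datatype rexp = R vname "iexp list" | RPlus rexp rexp | RMinus rexp rexp

datatype bexp = ILess iexp iexp | RLess rexp rexp | BNot bexp | BAnd bexp bexp

datatype com =
    Skip
  | IAssign vname "iexp list" iexp
  | RAssign vname "iexp list" rexp
  | Seq com com
  | If bexp com com
  | While bexp com

primrec ival :: "state \<Rightarrow> iexp \<Rightarrow> nat" where
  "ival s (N m) = m"
| "ival s (I x es) = fst s x (map (ival s) es)"
| "ival s (IPlus a b) = ival s a + ival s b"
| "ival s (IMinus a b) = ival s a - ival s b"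

primrec rval :: "state \<Rightarrow> rexp \<Rightarrow> real" where
  "rval s (R x es) = snd s x (map (ival s) es)"
| "rval s (RPlus a b) = rval s a + rval s b"
| "rval s (RMinus a b) = rval s a - rval s b"

primrec bval :: "state \<Rightarrow> bexp \<Rightarrow> bool" where
  "bval s (ILess a b) = (ival s a < ival s b)"
| "bval s (RLess a b) = (rval s a < rval s b)"
| "bval s (BNot b) = (\<not> bval s b)"
| "bval s (BAnd b c) = (bval s b \<and> bval s c)"

text \<open>
  A literal is charged its value plus one.  As literals are fixed by the program this only affects
  constant factors, and it makes the growth bound independent of the program.
\<close>

primrec icost :: "iexp \<Rightarrow> nat" where
  "icost (N m) = Suc m"
| "icost (I x es) = Suc (sum_list (map icost es))"
| "icost (IPlus a b) = Suc (icost a + icost b)"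
| "icost (IMinus a b) = Suc (icost a + icost b)"

primrec rcost :: "rexp \<Rightarrow> nat" where
  "rcost (R x es) = Suc (sum_list (map icost es))"
| "rcost (RPlus a b) = Suc (rcost a + rcost b)"
| "rcost (RMinus a b) = Suc (rcost a + rcost b)"

primrec bcost :: "bexp \<Rightarrow> nat" where
  "bcost (ILess a b) = Suc (icost a + icost b)"
| "bcost (RLess a b) = Suc (rcost a + rcost b)"
| "bcost (BNot b) = Suc (bcost b)"
| "bcost (BAnd b c) = Suc (bcost b + bcost c)"

definition upd :: "(vname \<Rightarrow> nat list \<Rightarrow> 'v) \<Rightarrow> vname \<Rightarrow> nat list \<Rightarrow> 'v \<Rightarrow> vname \<Rightarrow> nat list \<Rightarrow> 'v" where
  "upd m x is v = m(x := (m x)(is := v))"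

text \<open>\<open>exec c s t s'\<close>: program \<open>c\<close> started in \<open>s\<close> terminates in \<open>s'\<close> at total cost \<open>t\<close>.\<close>

inductive exec :: "com \<Rightarrow> state \<Rightarrow> nat \<Rightarrow> state \<Rightarrow> bool" where
  Skip: "exec Skip s 1 s"
| IAssign: "exec (IAssign x es e) s (Suc (sum_list (map icost es) + icost e))
     (upd (fst s) x (map (ival s) es) (ival s e), snd s)"
| RAssign: "exec (RAssign x es e) s (Suc (sum_list (map icost es) + rcost e))
     (fst s, upd (snd s) x (map (ival s) es) (rval s e))"
| Seq: "exec c1 s t1 s' \<Longrightarrow> exec c2 s' t2 s'' \<Longrightarrow> exec (Seq c1 c2) s (t1 + t2) s''"
| IfTrue: "bval s b \<Longrightarrow> exec c1 s t s' \<Longrightarrow> exec (If b c1 c2) s (Suc (bcost b + t)) s'"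
| IfFalse: "\<not> bval s b \<Longrightarrow> exec c2 s t s' \<Longrightarrow> exec (If b c1 c2) s (Suc (bcost b + t)) s'"
| WhileFalse: "\<not> bval s b \<Longrightarrow> exec (While b c) s (Suc (bcost b)) s"
| WhileTrue: "bval s b \<Longrightarrow> exec c s t s' \<Longrightarrow> exec (While b c) s' t' s''
     \<Longrightarrow> exec (While b c) s (Suc (bcost b + t + t')) s''"

inductive_cases Skip_E: "exec Skip s t s'"
inductive_cases IAssign_E: "exec (IAssign x es e) s t s'"
inductive_cases RAssign_E: "exec (RAssign x es e) s t s'"
inductive_cases Seq_E: "exec (Seq c1 c2) s t s'"
inductive_cases If_E: "exec (If b c1 c2) s t s'"
inductive_cases While_E: "exec (While b c) s t s'"

lemma exec_deterministic:
  "exec c s t s' \<Longrightarrow> exec c s u s'' \<Longrightarrow> u = t \<and> s'' = s'"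
proof (induction arbitrary: u s'' rule: exec.induct)
  case (Seq c1 s t1 s' c2 t2 s3)
  then show ?case by (blast elim: Seq_E)
next
  case (WhileTrue s b c t s' t' s3)
  from WhileTrue.prems show ?case
    by (rule While_E) (use WhileTrue.hyps(1) WhileTrue.IH in blast)+
next
  case (WhileFalse s b c)
  from WhileFalse.prems show ?case
    by (rule While_E) (use WhileFalse.hyps in auto)
next
  case (IfTrue s b c1 t s' c2)
  from IfTrue.prems show ?case
    by (rule If_E) (use IfTrue.hyps(1) IfTrue.IH in blast)+
next
  case (IfFalse s b c2 t s' c1)
  from IfFalse.prems show ?case
    by (rule If_E) (use IfFalse.hyps(1) IfFalse.IH in blast)+
qed (auto elim!: Skip_E IAssign_E RAssign_E)

lemma add_le_two_power:
  fixes x y B :: "'a::linordered_idom"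
  assumes "x \<le> 2 ^ a * B" "y \<le> 2 ^ b * B" "0 \<le> B"
  shows "x + y \<le> 2 ^ Suc (a + b) * B"
proof -
  have "(2::'a) ^ a * 1 \<le> 2 ^ a * 2 ^ b" "(1::'a) * 2 ^ b \<le> 2 ^ a * 2 ^ b"
    by (intro mult_left_mono mult_right_mono; simp)+
  then have "(2::'a) ^ a + 2 ^ b \<le> 2 ^ Suc (a + b)"
    unfolding power_Suc power_add by linarith
  then have "((2::'a) ^ a + 2 ^ b) * B \<le> 2 ^ Suc (a + b) * B"
    using assms(3) by (rule mult_right_mono)
  then show ?thesis using assms by (simp add: distrib_right)
qed

lemma ival_growth:
  assumes "\<forall>x is. int (fst s x is) \<le> B" "1 \<le> B"
  shows "int (ival s e) \<le> 2 ^ icost e * B"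
proof (induction e)
  case (N m)
  have "int m \<le> 2 ^ Suc m"
    using of_nat_less_two_power[of m, where 'a = int] unfolding power_Suc by linarith
  also have "\<dots> \<le> 2 ^ Suc m * B"
    using assms(2) by simp
  finally show ?case by simp
next
  case (I x es)
  have "int (ival s (I x es)) \<le> 1 * B"
    using assms(1) by simp
  also have "\<dots> \<le> 2 ^ icost (I x es) * B"
    using assms(2) one_le_power[of "2::int" "icost (I x es)"] by (intro mult_right_mono) linarith+
  finally show ?case .
next
  case (IPlus a b)
  then show ?case
    using add_le_two_power[OF IPlus] assms(2) by simp
next
  case (IMinus a b)
  have "int (ival s (IMinus a b)) \<le> int (ival s a) + int (ival s b)"
    by simp
  also have "\<dots> \<le> 2 ^ icost (IMinus a b) * B"
    using add_le_two_power[OF IMinus] assms(2) by simp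
  finally show ?case .
qed

lemma rval_growth:
  assumes "\<forall>x is. snd s x is \<in> G \<and> \<bar>snd s x is\<bar> \<le> M"
    and "\<And>x y. x \<in> G \<Longrightarrow> y \<in> G \<Longrightarrow> x + y \<in> G" "\<And>x y. x \<in> G \<Longrightarrow> y \<in> G \<Longrightarrow> x - y \<in> G"
  shows "rval s e \<in> G \<and> \<bar>rval s e\<bar> \<le> 2 ^ rcost e * M"
proof -
  have M: "0 \<le> M"
    using assms(1) abs_ge_zero order_trans by blast
  show ?thesis
  proof (induction e)
    case (R x es)
    have "\<bar>rval s (R x es)\<bar> \<le> 1 * M"
      using assms(1) by simp
    also have "\<dots> \<le> 2 ^ rcost (R x es) * M"
      using M one_le_power[of "2::real" "rcost (R x es)"] by (intro mult_right_mono) linarith+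
    finally show ?case using assms(1) by simp
  next
    case (RPlus a b)
    have "\<bar>rval s a + rval s b\<bar> \<le> \<bar>rval s a\<bar> + \<bar>rval s b\<bar>"
      by (rule abs_triangle_ineq)
    also have "\<dots> \<le> 2 ^ rcost (RPlus a b) * M"
      using add_le_two_power[of "\<bar>rval s a\<bar>" _ M "\<bar>rval s b\<bar>"] RPlus M by simp
    finally show ?case using RPlus assms(2) by simp
  next
    case (RMinus a b)
    have "\<bar>rval s a - rval s b\<bar> \<le> \<bar>rval s a\<bar> + \<bar>rval s b\<bar>"
      by (rule abs_triangle_ineq4)
    also have "\<dots> \<le> 2 ^ rcost (RMinus a b) * M"
      using add_le_two_power[of "\<bar>rval s a\<bar>" _ M "\<bar>rval s b\<bar>"] RMinus M by simp
    finally show ?case using RMinus assms(3) by simp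
  qed
qed

lemma two_power_mono: "0 \<le> B \<Longrightarrow> a \<le> b \<Longrightarrow> 2 ^ a * B \<le> 2 ^ b * (B::'a::linordered_idom)"
  by (intro mult_right_mono power_increasing) auto

lemma exec_growth:
  assumes "exec c s t s'"
    and "\<forall>x is. int (fst s x is) \<le> B" "1 \<le> B"
    and "\<forall>x is. snd s x is \<in> G \<and> \<bar>snd s x is\<bar> \<le> M"
    and G: "\<And>x y. x \<in> G \<Longrightarrow> y \<in> G \<Longrightarrow> x + y \<in> G" "\<And>x y. x \<in> G \<Longrightarrow> y \<in> G \<Longrightarrow> x - y \<in> G"
  shows "(\<forall>x is. int (fst s' x is) \<le> 2 ^ t * B) \<and>
    (\<forall>x is. snd s' x is \<in> G \<and> \<bar>snd s' x is\<bar> \<le> 2 ^ t * M)"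
  using assms(1-4)
proof (induction arbitrary: B M rule: exec.induct)
  case hyp: (Seq c1 s t1 s' c2 t2 s'')
  note 1 = hyp.IH(1)[OF hyp.prems]
  have B: "1 \<le> 2 ^ t1 * B"
    using mult_mono[of 1 "2 ^ t1" 1 B] hyp.prems(2) by simp
  show ?case
    using hyp.IH(2)[of "2 ^ t1 * B" "2 ^ t1 * M"] 1 B by (simp add: power_add mult_ac)
next
  case hyp: (WhileTrue s b c t s' t' s'')
  note 1 = hyp.IH(1)[OF hyp.prems]
  have B: "1 \<le> 2 ^ t * B"
    using mult_mono[of 1 "2 ^ t" 1 B] hyp.prems(2) by simp
  have M: "0 \<le> M"
    using hyp.prems(3) abs_ge_zero order_trans by blast
  have 2: "(\<forall>x is. int (fst s'' x is) \<le> 2 ^ (t + t') * B) \<and>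
      (\<forall>x is. snd s'' x is \<in> G \<and> \<bar>snd s'' x is\<bar> \<le> 2 ^ (t + t') * M)"
    using hyp.IH(2)[of "2 ^ t * B" "2 ^ t * M"] 1 B by (simp add: power_add mult_ac)
  have "2 ^ (t + t') * B \<le> 2 ^ Suc (bcost b + t + t') * B"
    "2 ^ (t + t') * M \<le> 2 ^ Suc (bcost b + t + t') * M"
    using hyp.prems(2) M by (intro two_power_mono; simp)+
  with 2 show ?case by (meson order_trans)
next
  case hyp: (IfTrue s b c1 t s' c2)
  have M: "0 \<le> M"
    using hyp.prems(3) abs_ge_zero order_trans by blast
  have "2 ^ t * B \<le> 2 ^ Suc (bcost b + t) * B" "2 ^ t * M \<le> 2 ^ Suc (bcost b + t) * M"
    using hyp.prems(2) M by (intro two_power_mono; simp)+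
  with hyp.IH[OF hyp.prems] show ?case by (meson order_trans)
next
  case hyp: (IfFalse s b c2 t s' c1)
  have M: "0 \<le> M"
    using hyp.prems(3) abs_ge_zero order_trans by blast
  have "2 ^ t * B \<le> 2 ^ Suc (bcost b + t) * B" "2 ^ t * M \<le> 2 ^ Suc (bcost b + t) * M"
    using hyp.prems(2) M by (intro two_power_mono; simp)+
  with hyp.IH[OF hyp.prems] show ?case by (meson order_trans)
next
  case hyp: (Skip s)
  have M: "0 \<le> M"
    using hyp.prems(3) abs_ge_zero order_trans by blast
  have "B \<le> 2 ^ 1 * B" "M \<le> 2 ^ 1 * M"
    using hyp.prems(2) M by auto
  with hyp.prems show ?case by (meson order_trans)
next
  case hyp: (WhileFalse s b c)
  have M: "0 \<le> M"
    using hyp.prems(3) abs_ge_zero order_trans by blast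
  have "2 ^ 0 * B \<le> 2 ^ Suc (bcost b) * B" "2 ^ 0 * M \<le> 2 ^ Suc (bcost b) * M"
    using hyp.prems(2) M by (intro two_power_mono; simp)+
  with hyp.prems show ?case by (metis mult_1 order_trans power_0)
next
  case hyp: (IAssign x es e s)
  let ?t = "Suc (sum_list (map icost es) + icost e)"
  have M: "0 \<le> M"
    using hyp.prems(3) abs_ge_zero order_trans by blast
  have le: "B \<le> 2 ^ ?t * B" "2 ^ icost e * B \<le> 2 ^ ?t * B" "M \<le> 2 ^ ?t * M"
    using hyp.prems(2) M two_power_mono[of B 0 ?t] two_power_mono[of B "icost e" ?t]
      two_power_mono[of M 0 ?t] by simp_all
  have "int (ival s e) \<le> 2 ^ ?t * B"
    using ival_growth[OF hyp.prems(1,2), of e] le(2) by linarith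
  moreover have "int (fst s y js) \<le> 2 ^ ?t * B" "\<bar>snd s y js\<bar> \<le> 2 ^ ?t * M" for y js
    using hyp.prems(1,3) le order_trans by blast+
  ultimately show ?case
    using hyp.prems(3) by (simp add: upd_def del: power_Suc)
next
  case hyp: (RAssign x es e s)
  let ?t = "Suc (sum_list (map icost es) + rcost e)"
  have M: "0 \<le> M"
    using hyp.prems(3) abs_ge_zero order_trans by blast
  have le: "B \<le> 2 ^ ?t * B" "2 ^ rcost e * M \<le> 2 ^ ?t * M" "M \<le> 2 ^ ?t * M"
    using hyp.prems(2) M two_power_mono[of B 0 ?t] two_power_mono[of M "rcost e" ?t]
      two_power_mono[of M 0 ?t] by simp_all
  have "rval s e \<in> G" "\<bar>rval s e\<bar> \<le> 2 ^ ?t * M"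
    using rval_growth[OF hyp.prems(3) G, of e] le(2) by auto
  moreover have "int (fst s y js) \<le> 2 ^ ?t * B" "\<bar>snd s y js\<bar> \<le> 2 ^ ?t * M" for y js
    using hyp.prems(1,3) le order_trans by blast+
  ultimately show ?case
    using hyp.prems(3) by (simp add: upd_def del: power_Suc)
qed


section \<open>Input and output conventions\<close>

text \<open>
  The points of an input space are numbered \<open>0, \<dots>, n - 1\<close>.  The machine receives \<open>n\<close>, \<open>k\<close> and
  the distance matrix; all other cells are initially zero.  Since \<open>k\<close> trees have to be written out,
  the size of an instance is measured by \<open>n + k\<close> (polynomially equivalent to the number of matrix
  entries plus \<open>k\<close>).
\<close>

definition input_state :: "nat \<Rightarrow> nat \<Rightarrow> (nat \<Rightarrow> nat \<Rightarrow> real) \<Rightarrow> state" where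
  "input_state n k d =
    ((\<lambda>x is. if (x, is) = (''n'', []) then n else if (x, is) = (''k'', []) then k else 0),
     (\<lambda>x is. if \<exists>u<n. \<exists>v<n. (x, is) = (''d'', [u, v]) then d (is ! 0) (is ! 1) else 0))"

text \<open>
  The \<open>i\<close>-th output tree is read off from the zero-one tables \<open>V[i, v]\<close> (is \<open>v\<close> a vertex?) and
  \<open>E[i, u, v]\<close> (is the pair with \<open>u < v\<close> an edge?).
\<close>

definition output_tree :: "nat \<Rightarrow> state \<Rightarrow> nat \<Rightarrow> nat ugraph" where
  "output_tree n s i =
    ({v. v < n \<and> fst s ''V'' [i, v] = 1}, {(u, v). u < v \<and> v < n \<and> fst s ''E'' [i, u, v] = 1})"

definition output_trees :: "nat \<Rightarrow> nat \<Rightarrow> state \<Rightarrow> nat ugraph list" where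
  "output_trees n k s = map (output_tree n s) [0..<k]"

end

theory Submission
  imports Defs
begin

text \<open>
  Prim's algorithm lists the points as \<open>v\<^sub>0, v\<^sub>1, \<dots>\<close>; let \<open>e i\<close> be the length of the edge by which
  \<open>v\<^sub>i\<close> was attached to its parent.  If \<open>i < l \<le> j\<close> then \<open>e l \<le> d v\<^sub>i v\<^sub>j\<close>, so deleting the \<open>q - 1\<close>
  longest edges leaves components that are intervals of this order.  The algorithm deletes \<open>q - 1\<close>
  edges, lists every component in a tour of at most twice its weight (each point is inserted next to
  its parent), and cuts the tours into pieces of weight at most \<open>32 \<rho>\<close>.  Starting from \<open>q = k\<close>, as
  long as there are more than \<open>k\<close> pieces, \<open>\<rho>\<close> is doubled, or, if that would exceed the shortest
  deleted edge, \<open>\<rho>\<close> becomes the length of that edge and the edge is restored.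

  Let \<open>\<Phi> r\<close> be the total weight of the trees of weight at least \<open>r\<close> in an arbitrary cover by \<open>k\<close>
  trees.  A tree of weight \<open>w\<close> on a set \<open>A\<close> of indices satisfies \<open>\<Sum> e i \<le> w\<close>, summed over \<open>A\<close> without
  its minimum.  This yields two lower bounds.  First, all but \<open>k - 1\<close> of the keys \<open>e i \<ge> r\<close> are
  paid for by \<open>\<Phi> r\<close>.  Second, the components at scale \<open>r\<close> can be given weights such that a tree
  of weight less than \<open>r\<close> covers at most \<open>2 r\<close>, while the total is
  \<open>\<Sum> max (2 r) (W C + r)\<close> over all components \<open>C\<close> with spanning weight \<open>W C\<close>.  The search
  stops at a scale where the \<open>k - q\<close> additional pieces are paid for by heavy components; with the two
  bounds this makes the pieces heavier than \<open>32 r\<close> weigh at most \<open>38 \<Phi> r\<close> in total,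
  for every \<open>r > 0\<close> at once.  Integrating over \<open>r\<close> gives the factor \<open>64\<close> for every \<open>p\<close>.
\<close>


section \<open>Domination of norms\<close>

text \<open>The optimal cover may change with \<open>p\<close>, so no fixed optimum can serve as the
  reference. What works for all \<open>p\<close> is a comparison above every threshold:
  \<open>x powr p\<close> is \<open>x\<close> times an increasing function of \<open>x\<close>,
  hence a nonnegative combination of functions that equal \<open>x\<close> from some threshold on
  and vanish below it. The algorithm fixes one scale \<rho>. For \<open>r\<close> at least \<rho> no
  piece exceeds \<open>32 r\<close>, so all the work concerns \<open>r\<close> below \<rho>, where
  the term \<open>(k - q) \<rho>\<close> of the lower bounds has to be absorbed. This fixes the
  constants. Tours double weights, so failure at cut length \<open>32 \<rho>\<close> means that
  heavy components have total mass at least \<open>16 \<rho> (k + 1 - q)\<close>. Changing the scale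
  costs a factor 2 and leaves the coefficient 8, which exceeds the coefficient 4 of the same term in
  the second bound, taken at scale \<rho> itself; hence \<open>(k - q) \<rho>\<close> is at most
  \<open>2 \<Phi> r\<close>. For smaller \<open>r\<close> this term enters with total coefficient 5
  beside \<open>9 \<Phi> r\<close>, which gives 19, and 38 after the doubling by tours.\<close>

lemma threshold_weights:
  fixes f :: "real \<Rightarrow> real"
  assumes "finite V" "\<forall>v\<in>V. 0 < v"
    and mono: "\<And>x y. 0 < x \<Longrightarrow> x \<le> y \<Longrightarrow> f x \<le> f y" and nn: "\<And>x. 0 < x \<Longrightarrow> 0 \<le> f x"
  shows "\<exists>c. (\<forall>v\<in>V. 0 \<le> c v) \<and> (\<forall>x>0. (\<Sum>v\<in>{v\<in>V. v \<le> x}. c v) \<le> f x)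
    \<and> (\<forall>x\<in>V. f x = (\<Sum>v\<in>{v\<in>V. v \<le> x}. c v))"
  using assms(1,2)
proof (induction V rule: finite_linorder_max_induct)
  case empty
  then show ?case using nn by simp
next
  case (insert b A)
  then obtain c where c: "\<forall>v\<in>A. 0 \<le> c v" "\<forall>x>0. (\<Sum>v\<in>{v\<in>A. v \<le> x}. c v) \<le> f x"
    "\<forall>x\<in>A. f x = (\<Sum>v\<in>{v\<in>A. v \<le> x}. c v)"
    by auto
  \<comment> \<open>The weight of a value is the increment of \<open>f\<close> since the previous
    value; as \<open>b\<close> is the largest so far, this is \<open>f b\<close> minus all earlier
    weights.\<close>
  define c' where "c' = c(b := f b - sum c A)"
  have bA: "b \<notin> A" using insert.hyps by auto
  have b0: "0 < b" using insert.prems by auto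
  have "{v\<in>A. v \<le> b} = A" using insert.hyps by force
  then have le: "sum c A \<le> f b" using c(2) b0 by (metis)
  have less: "(\<Sum>v\<in>{v\<in>insert b A. v \<le> x}. c' v) = (\<Sum>v\<in>{v\<in>A. v \<le> x}. c v)" if "x < b" for x
    using that bA by (intro sum.cong) (auto simp: c'_def)
  have ge: "(\<Sum>v\<in>{v\<in>insert b A. v \<le> x}. c' v) = f b" if "b \<le> x" for x
  proof -
    have "{v\<in>insert b A. v \<le> x} = insert b A" using that insert.hyps by force
    moreover have "sum c' A = sum c A" using bA by (intro sum.cong) (auto simp: c'_def)
    ultimately show ?thesis using insert.hyps bA by (simp add: c'_def)
  qed
  show ?case
  proof (intro exI[of _ c'] conjI ballI allI impI)
    show "0 \<le> c' v" if "v \<in> insert b A" for v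
      using that c(1) le by (auto simp: c'_def)
    show "(\<Sum>v\<in>{v\<in>insert b A. v \<le> x}. c' v) \<le> f x" if "0 < x" for x
      using that less ge c(2) mono[of b x] b0 by (cases "x < b") auto
    show "f x = (\<Sum>v\<in>{v\<in>insert b A. v \<le> x}. c' v)" if "x \<in> insert b A" for x
    proof (cases "x = b")
      case False
      then have "x \<in> A" "x < b" using that insert.hyps by auto
      then show ?thesis using less c(3) by auto
    qed (use ge in auto)
  qed
qed

text \<open>Discrete integration over thresholds: \<open>f\<close> is replaced by a step function
  below it that jumps at the positive values of \<open>a\<close>. Both sides become sums over the
  jumps of the total above that threshold. The replacement is exact on the side of \<open>a\<close>
  and can only decrease the side of \<open>b\<close>.\<close>

lemma threshold_domination:
  fixes a :: "'i \<Rightarrow> real" and b :: "'j \<Rightarrow> real" and f :: "real \<Rightarrow> real"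
  assumes fin: "finite A" "finite B" and a: "\<And>i. i \<in> A \<Longrightarrow> 0 \<le> a i" and b: "\<And>j. j \<in> B \<Longrightarrow> 0 \<le> b j"
    and dom: "\<And>r. 0 < r \<Longrightarrow> (\<Sum>i\<in>{i\<in>A. r \<le> a i}. a i) \<le> (\<Sum>j\<in>{j\<in>B. r \<le> b j}. b j)"
    and mono: "\<And>x y. 0 < x \<Longrightarrow> x \<le> y \<Longrightarrow> f x \<le> f y" and nn: "\<And>x. 0 < x \<Longrightarrow> 0 \<le> f x"
  shows "(\<Sum>i\<in>A. a i * f (a i)) \<le> (\<Sum>j\<in>B. b j * f (b j))"
proof -
  \<comment> \<open>Zero is left out because \<open>f\<close> is controlled only on positive
    arguments; a zero value contributes nothing to either sum.\<close>
  define V where "V = a ` A - {0}"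
  have V: "finite V" "\<forall>v\<in>V. 0 < v" using fin a by (force simp: V_def)+
  obtain c where c: "\<forall>v\<in>V. 0 \<le> c v" "\<forall>x>0. (\<Sum>v\<in>{v\<in>V. v \<le> x}. c v) \<le> f x"
    "\<forall>x\<in>V. f x = (\<Sum>v\<in>{v\<in>V. v \<le> x}. c v)"
    using threshold_weights[OF V, of f] mono nn by blast
  have "(\<Sum>i\<in>A. a i * f (a i)) = (\<Sum>i\<in>A. \<Sum>v\<in>{v\<in>V. v \<le> a i}. a i * c v)"
  proof (rule sum.cong[OF refl])
    fix i assume "i \<in> A"
    show "a i * f (a i) = (\<Sum>v\<in>{v\<in>V. v \<le> a i}. a i * c v)"
    proof (cases "a i = 0")
      case False
      then have "a i \<in> V" using \<open>i \<in> A\<close> by (auto simp: V_def)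
      then show ?thesis using c(3) by (auto simp: sum_distrib_left)
    qed simp
  qed
  also have "\<dots> = (\<Sum>v\<in>V. \<Sum>i\<in>{i\<in>A. v \<le> a i}. a i * c v)"
    by (rule sum.swap_restrict) (use fin V in auto)
  also have "\<dots> = (\<Sum>v\<in>V. c v * (\<Sum>i\<in>{i\<in>A. v \<le> a i}. a i))"
    by (simp add: sum_distrib_left mult.commute)
  also have "\<dots> \<le> (\<Sum>v\<in>V. c v * (\<Sum>j\<in>{j\<in>B. v \<le> b j}. b j))"
    using c(1) V dom by (intro sum_mono mult_left_mono) auto
  also have "\<dots> = (\<Sum>v\<in>V. \<Sum>j\<in>{j\<in>B. v \<le> b j}. b j * c v)"
    by (simp add: sum_distrib_left mult.commute)
  also have "\<dots> = (\<Sum>j\<in>B. \<Sum>v\<in>{v\<in>V. v \<le> b j}. b j * c v)"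
    by (rule sum.swap_restrict) (use fin V in auto)
  also have "\<dots> = (\<Sum>j\<in>B. b j * (\<Sum>v\<in>{v\<in>V. v \<le> b j}. c v))"
    by (simp add: sum_distrib_left)
  also have "\<dots> \<le> (\<Sum>j\<in>B. b j * f (b j))"
  proof (rule sum_mono)
    fix j assume "j \<in> B"
    then show "b j * (\<Sum>v\<in>{v\<in>V. v \<le> b j}. c v) \<le> b j * f (b j)"
      using b[of j] c(2) by (cases "b j = 0") (auto intro!: mult_left_mono)
  qed
  finally show ?thesis .
qed

text \<open>This is \<open>threshold_domination\<close> for \<open>f x = x powr (p - 1)\<close>,
  which is increasing because \<open>p\<close> is at least 1.\<close>

lemma lp_norm_domination:
  fixes w :: "'i \<Rightarrow> real" and u :: "'j \<Rightarrow> real"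
  assumes fin: "finite A" "finite B" and w: "\<And>i. i \<in> A \<Longrightarrow> 0 \<le> w i" and u: "\<And>j. j \<in> B \<Longrightarrow> 0 \<le> u j"
    and pos: "0 < \<alpha>" "\<beta> \<le> 2 * \<alpha>"
    and dom: "\<And>r. 0 < r \<Longrightarrow> (\<Sum>i\<in>{i\<in>A. \<alpha> * r < w i}. w i) \<le> \<beta> * (\<Sum>j\<in>{j\<in>B. r \<le> u j}. u j)"
    and p: "1 \<le> p"
  shows "(\<Sum>i\<in>A. w i powr p) powr (1 / p) \<le> 2 * \<alpha> * (\<Sum>j\<in>B. u j powr p) powr (1 / p)"
proof -
  \<comment> \<open>The factor 2 does two jobs: \<open>r \<le> a i\<close> yields the strict bound
    \<open>\<alpha> * r < w i\<close>, and dividing by \<open>2 * \<alpha>\<close> absorbs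
    \<beta>.\<close>
  define a where "a i = w i / (2 * \<alpha>)" for i
  have pw: "x powr p = x * x powr (p - 1)" if "0 \<le> x" for x :: real
    using that by (cases "x = 0") (auto simp: powr_mult_base)
  have *: "(\<Sum>i\<in>{i\<in>A. r \<le> a i}. a i) \<le> (\<Sum>j\<in>{j\<in>B. r \<le> u j}. u j)" if "0 < r" for r
  proof -
    have "(\<Sum>i\<in>{i\<in>A. r \<le> a i}. a i) = (\<Sum>i\<in>{i\<in>A. r \<le> a i}. w i) / (2 * \<alpha>)"
      by (simp add: a_def sum_divide_distrib)
    also have "\<dots> \<le> (\<Sum>i\<in>{i\<in>A. \<alpha> * r < w i}. w i) / (2 * \<alpha>)"
    proof (intro divide_right_mono sum_mono2)
      have "\<alpha> * r < w i" if "r \<le> a i" for i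
      proof -
        have "2 * (\<alpha> * r) \<le> w i" using that pos by (simp add: a_def field_simps)
        moreover have "0 < \<alpha> * r" using \<open>0 < r\<close> pos by simp
        ultimately show ?thesis by linarith
      qed
      then show "{i\<in>A. r \<le> a i} \<subseteq> {i\<in>A. \<alpha> * r < w i}" by auto
    qed (use fin w pos in auto)
    also have "\<dots> \<le> \<beta> * (\<Sum>j\<in>{j\<in>B. r \<le> u j}. u j) / (2 * \<alpha>)"
      using dom[OF that] pos by (intro divide_right_mono) auto
    also have "\<dots> \<le> (2 * \<alpha>) * (\<Sum>j\<in>{j\<in>B. r \<le> u j}. u j) / (2 * \<alpha>)"
      using pos u by (intro divide_right_mono mult_right_mono sum_nonneg) auto
    finally show ?thesis using pos by simp
  qed
  have "(\<Sum>i\<in>A. a i * a i powr (p - 1)) \<le> (\<Sum>j\<in>B. u j * u j powr (p - 1))"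
    by (rule threshold_domination[OF fin]) (use w u pos p * in \<open>auto simp: a_def intro: powr_mono2\<close>)
  then have "(\<Sum>i\<in>A. a i powr p) \<le> (\<Sum>j\<in>B. u j powr p)"
    using w u pos by (simp add: pw a_def)
  then have "(\<Sum>i\<in>A. a i powr p) powr (1 / p) \<le> (\<Sum>j\<in>B. u j powr p) powr (1 / p)"
    using p by (intro powr_mono2) (auto intro: sum_nonneg)
  moreover have "(\<Sum>i\<in>A. w i powr p) powr (1 / p) = 2 * \<alpha> * (\<Sum>i\<in>A. a i powr p) powr (1 / p)"
  proof -
    have "(\<Sum>i\<in>A. w i powr p) = (\<Sum>i\<in>A. (2 * \<alpha>) powr p * a i powr p)"
      using w pos by (intro sum.cong) (auto simp: a_def powr_mult[symmetric])
    also have "\<dots> = (2 * \<alpha>) powr p * (\<Sum>i\<in>A. a i powr p)"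
      by (simp add: sum_distrib_left)
    finally show ?thesis
      using pos p by (simp add: powr_mult sum_nonneg powr_powr)
  qed
  ultimately show ?thesis using pos by simp
qed

section \<open>Comparing sums by level counts, and counting edges between colour classes\<close>

lemma sum_le_sum_if_card_levels_le:
  fixes f :: "'a \<Rightarrow> real" and g :: "'b \<Rightarrow> real"
  assumes "finite X" "finite Y" "\<And>x. x \<in> X \<Longrightarrow> 0 \<le> f x" "\<And>y. y \<in> Y \<Longrightarrow> 0 \<le> g y"
    and "\<And>s. 0 \<le> s \<Longrightarrow> card {x\<in>X. s < f x} \<le> card {y\<in>Y. s < g y}"
  shows "sum f X \<le> sum g Y"
  using assms
proof (induction "card X" arbitrary: X Y)
  case 0
  then show ?case by (simp add: sum_nonneg)
next
  case (Suc m)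
  have "X \<noteq> {}" using Suc by auto
  then have "\<exists>x\<in>X. \<forall>x'\<in>X. f x' \<le> f x"
    using Max_in[of "f ` X"] Max_ge[of "f ` X"] Suc.prems(1) by (metis (no_types, lifting) finite_imageI image_iff image_is_empty)
  then obtain x where x: "x \<in> X" "\<And>x'. x' \<in> X \<Longrightarrow> f x' \<le> f x" by blast
  show ?case
  proof (cases "f x = 0")
    case True
    then have "sum f X \<le> 0" using x by (intro sum_nonpos) auto
    also have "0 \<le> sum g Y" using Suc.prems by (intro sum_nonneg) auto
    finally show ?thesis .
  next
    case False
    then have fx: "0 < f x" using Suc.prems(3)[OF x(1)] by auto
    have ex: "\<exists>y\<in>Y. s < g y" if "0 \<le> s" "s < f x" for s
    proof -
      have "0 < card {x\<in>X. s < f x}" using that x Suc.prems(1) by (auto simp: card_gt_0_iff)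
      then have "0 < card {y\<in>Y. s < g y}" using Suc.prems(5)[OF that(1)] by linarith
      then show ?thesis by (auto simp: card_gt_0_iff)
    qed
    then have "Y \<noteq> {}" using fx by auto
    then have "\<exists>y\<in>Y. \<forall>y'\<in>Y. g y' \<le> g y"
      using Max_in[of "g ` Y"] Max_ge[of "g ` Y"] Suc.prems(2) by (metis (no_types, lifting) finite_imageI image_iff image_is_empty)
    then obtain y where y: "y \<in> Y" "\<And>y'. y' \<in> Y \<Longrightarrow> g y' \<le> g y" by blast
    \<comment> \<open>Otherwise the level \<open>g y\<close> would be exceeded in \<open>X\<close>
      but nowhere in \<open>Y\<close>.\<close>
    have gy: "f x \<le> g y"
    proof (rule ccontr)
      assume "\<not> f x \<le> g y"
      then obtain y' where "y' \<in> Y" "g y < g y'"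
        using ex[of "g y"] Suc.prems(4)[OF y(1)] by auto
      then show False using y(2) by force
    qed
    \<comment> \<open>The two maxima are matched and removed: for levels below \<open>f x\<close>
      both counts drop by one, and for all others the left count is 0.\<close>
    have "sum f (X - {x}) \<le> sum g (Y - {y})"
    proof (rule Suc.hyps(1))
      show "m = card (X - {x})" using Suc.hyps(2) x Suc.prems(1) by simp
      fix s :: real assume s: "0 \<le> s"
      show "card {x'\<in>X - {x}. s < f x'} \<le> card {y'\<in>Y - {y}. s < g y'}"
      proof (cases "s < f x")
        case True
        have "{x'\<in>X - {x}. s < f x'} = {x'\<in>X. s < f x'} - {x}" "{y'\<in>Y - {y}. s < g y'} = {y'\<in>Y. s < g y'} - {y}"
          by auto
        then show ?thesis
          using Suc.prems(1,2) Suc.prems(5)[OF s] x y True gy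
          by (simp add: card_Diff_singleton diff_le_mono)
      next
        case False
        then have "{x'\<in>X - {x}. s < f x'} = {}" using x(2) by force
        then show ?thesis by (simp only: card.empty zero_le)
      qed
    qed (use Suc.prems in auto)
    then show ?thesis
      using x y gy Suc.prems(1,2) by (simp add: sum_diff1)
  qed
qed

text \<open>A maximal vertex set that satisfies the bound is everything: otherwise an edge leaves
  it, and adding the far end creates a new colour only if that edge is bichromatic and thus pays for
  it.\<close>

lemma card_image_le_Suc_bichromatic_edges:
  assumes conn: "connected_graph (S, E)" and fin: "finite S" and E: "E \<subseteq> S \<times> S"
  shows "card (b ` S) \<le> Suc (card {(x, y) \<in> E. b x \<noteq> b y})"
proof -
  have finE: "finite E" using E fin finite_subset by blast
  obtain r where r: "r \<in> S" using conn by (auto simp: connected_graph_def)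
  define F where "F A = {(x, y) \<in> E. x \<in> A \<and> y \<in> A \<and> b x \<noteq> b y}" for A
  have finF: "finite (F A)" for A
    by (rule finite_subset[OF _ finE]) (auto simp: F_def)
  define P where "P A \<longleftrightarrow> r \<in> A \<and> A \<subseteq> S \<and> card (b ` A) \<le> Suc (card (F A))" for A
  have "P {r}" using r by (auto simp: P_def)
  moreover have "card A < Suc (card S)" if "P A" for A
    using that fin by (auto simp: P_def less_Suc_eq_le intro: card_mono)
  ultimately obtain A where A: "P A" and max: "\<And>B. P B \<Longrightarrow> card B \<le> card A"
    using ex_has_greatest_nat[of P "{r}" card "Suc (card S)"] by (metis less_imp_le)
  have finA: "finite A" using A fin finite_subset by (auto simp: P_def)
  have "A = S"
  proof (rule ccontr)
    assume "A \<noteq> S"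
    then obtain v where v: "v \<in> S" "v \<notin> A" using A by (auto simp: P_def)
    have "(r, v) \<in> (E \<union> E\<inverse>)\<^sup>*" using conn r v by (auto simp: connected_graph_def)
    then have "\<exists>x y. (x, y) \<in> E \<union> E\<inverse> \<and> x \<in> A \<and> y \<notin> A"
      using v(2)
    proof (induction rule: rtrancl_induct)
      case base
      then show ?case using A by (auto simp: P_def)
    qed blast
    then obtain x y where xy: "(x, y) \<in> E \<union> E\<inverse>" "x \<in> A" "y \<notin> A" by blast
    have "card (b ` insert y A) \<le> Suc (card (F (insert y A)))"
    proof (cases "b x = b y")
      case True
      then have "b y \<in> b ` A" using xy(2) by (metis image_eqI)
      then have "b ` insert y A = b ` A" by auto
      moreover have "card (F A) \<le> card (F (insert y A))"
        by (intro card_mono finF) (auto simp: F_def)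
      ultimately show ?thesis using A by (simp add: P_def)
    next
      case False
      \<comment> \<open>An edge is stored as one ordered pair, so the crossing edge lies in
        \<open>E\<close> in one of two orientations.\<close>
      define e where "e = (if (x, y) \<in> E then (x, y) else (y, x))"
      have "insert e (F A) \<subseteq> F (insert y A)" "e \<notin> F A"
        using xy False by (auto simp: e_def F_def)
      then have "Suc (card (F A)) \<le> card (F (insert y A))"
        using card_mono[OF finF, of "insert e (F A)"] finF by simp
      moreover have "card (b ` insert y A) \<le> Suc (card (b ` A))"
        using finA by (simp add: card_insert_if)
      ultimately show ?thesis using A by (simp add: P_def)
    qed
    moreover have "y \<in> S" using xy(1) E by auto
    ultimately have "P (insert y A)" using A by (simp add: P_def)
    then show False using max[of "insert y A"] finA xy(3) by simp
  qed
  moreover have "F S = {(x, y) \<in> E. b x \<noteq> b y}" using E by (auto simp: F_def)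
  ultimately show ?thesis using A by (simp add: P_def)
qed


section \<open>Lower bounds for covers of a key sequence\<close>

lemma sum_UN_le:
  fixes f :: "'a \<Rightarrow> real"
  assumes "finite J" "\<And>j. j \<in> J \<Longrightarrow> finite (B j)" "\<And>j i. j \<in> J \<Longrightarrow> i \<in> B j \<Longrightarrow> 0 \<le> f i"
  shows "sum f (\<Union>j\<in>J. B j) \<le> (\<Sum>j\<in>J. sum f (B j))"
  using assms
proof (induction J rule: finite_induct)
  case (insert x F)
  have "sum f (B x \<union> (\<Union>j\<in>F. B j)) \<le> sum f (B x) + sum f (\<Union>j\<in>F. B j)"
  proof -
    have "0 \<le> sum f (B x \<inter> (\<Union>j\<in>F. B j))" using insert.prems by (intro sum_nonneg) auto
    then show ?thesis
      using sum.union_inter[of "B x" "\<Union>j\<in>F. B j" f] insert by auto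
  qed
  then show ?case using insert by force
qed simp

text \<open>Cutting the index order in front of every element of \<open>Q\<close> leaves intervals;
  this is the first index of the interval that contains \<open>i\<close>.\<close>

definition head :: "nat set \<Rightarrow> nat \<Rightarrow> nat" where
  "head Q i = Max {q\<in>Q. q \<le> i}"

lemma head_mem:
  assumes "0 \<in> Q"
  shows "head Q i \<in> Q" "head Q i \<le> i"
proof -
  have "head Q i \<in> {q\<in>Q. q \<le> i}"
    unfolding head_def by (rule Max_in) (use assms in auto)
  then show "head Q i \<in> Q" "head Q i \<le> i" by auto
qed

lemma head_ge: "q \<in> Q \<Longrightarrow> q \<le> i \<Longrightarrow> q \<le> head Q i"
  unfolding head_def by (rule Max_ge) auto

lemma head_eqI: "q \<in> Q \<Longrightarrow> q \<le> i \<Longrightarrow> (\<And>l. l \<in> Q \<Longrightarrow> l \<le> i \<Longrightarrow> l \<le> q) \<Longrightarrow> head Q i = q"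
  unfolding head_def by (rule Max_eqI) auto

lemma head_self: "q \<in> Q \<Longrightarrow> head Q q = q"
  by (rule head_eqI) auto

text \<open>The intervals of the larger set \<open>Q\<close> refine those of
  \<open>D\<close>.\<close>

lemma head_head:
  assumes "0 \<in> D" "D \<subseteq> Q"
  shows "head D (head Q i) = head D i"
proof (rule head_eqI)
  have 0: "0 \<in> Q" using assms by auto
  show "head D i \<in> D" using head_mem[OF assms(1)] by auto
  show "head D i \<le> head Q i"
    by (rule head_ge) (use head_mem[OF assms(1)] assms(2) in auto)
  show "l \<le> head D i" if "l \<in> D" "l \<le> head Q i" for l
    using that head_mem(2)[OF 0, of i] by (intro head_ge) auto
qed

text \<open>Spanning weight of the interval that starts at \<open>q\<close>: each later index
  contributes the edge to its parent.\<close>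

definition key_mass :: "nat \<Rightarrow> (nat \<Rightarrow> real) \<Rightarrow> nat set \<Rightarrow> nat \<Rightarrow> real" where
  "key_mass n e Q q = (\<Sum>i\<in>{i\<in>{..<n} - Q. head Q i = q}. e i)"

text \<open>Keys equal to \<open>r\<close> may lie on either side, so this covers level sets as well
  as initial parts of a ranking with ties. Index 0 has no parent edge and is a head at every
  scale.\<close>

definition key_separates :: "nat \<Rightarrow> (nat \<Rightarrow> real) \<Rightarrow> nat set \<Rightarrow> real \<Rightarrow> bool" where
  "key_separates n e Q r \<longleftrightarrow> 0 \<in> Q \<and> Q \<subseteq> {..<n} \<and> (\<forall>i\<in>Q - {0}. r \<le> e i) \<and> (\<forall>i\<in>{..<n} - Q. e i \<le> r)"

text \<open>The lower bounds see a cover only through the index set \<open>A j\<close> and the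
  weight \<open>c j\<close> of each tree; the metric enters later, when \<open>prim_order\<close>
  supplies the two inequalities.\<close>

locale key_cover =
  fixes n k :: nat and e :: "nat \<Rightarrow> real" and A :: "nat \<Rightarrow> nat set" and c :: "nat \<Rightarrow> real"
  assumes n_pos: "0 < n"
    and e_nonneg: "i < n \<Longrightarrow> 0 \<le> e i"
    and A_nonempty: "j < k \<Longrightarrow> A j \<noteq> {}"
    and A_union: "(\<Union>j<k. A j) = {..<n}"
    and sum_le_cost: "j < k \<Longrightarrow> sum e (A j - {Min (A j)}) \<le> c j"
    and key_le_cost: "j < k \<Longrightarrow> a \<in> A j \<Longrightarrow> b \<in> A j \<Longrightarrow> a < l \<Longrightarrow> l \<le> b \<Longrightarrow> e l \<le> c j"
begin

definition heavy :: "real \<Rightarrow> real" where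
  "heavy r = (\<Sum>j\<in>{j\<in>{..<k}. r \<le> c j}. c j)"

abbreviation "mass \<equiv> key_mass n e"

abbreviation "separates \<equiv> key_separates n e"

text \<open>The two arguments of \<open>max\<close> give the two estimates in
  \<open>sum_omega_component\<close>: \<open>2 * r\<close> per interval, and \<open>r\<close> per
  interval plus all keys.\<close>

definition omega :: "nat set \<Rightarrow> real \<Rightarrow> nat \<Rightarrow> real" where
  "omega Q r i = (if i \<in> Q then max r (2 * r - mass Q i) else e i)"

lemma A_sub: "j < k \<Longrightarrow> A j \<subseteq> {..<n}"
  using A_union by auto

lemma A_fin: "j < k \<Longrightarrow> finite (A j)"
  using A_sub finite_subset by blast

lemma cost_nonneg: "j < k \<Longrightarrow> 0 \<le> c j"
proof -
  assume j: "j < k"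
  have "0 \<le> sum e (A j - {Min (A j)})" using A_sub[OF j] e_nonneg by (intro sum_nonneg) auto
  then show ?thesis using sum_le_cost[OF j] by linarith
qed

lemma mass_nonneg: "0 \<le> mass Q q"
  unfolding key_mass_def by (intro sum_nonneg) (use e_nonneg in auto)

lemma heavy_mono: "r \<le> s \<Longrightarrow> heavy s \<le> heavy r"
  unfolding heavy_def by (intro sum_mono2) (auto intro: cost_nonneg)

lemma heavy_nonneg: "0 \<le> heavy r"
  unfolding heavy_def by (intro sum_nonneg) (auto intro: cost_nonneg)

text \<open>A tree lighter than \<open>r\<close> meets no head beyond its first index, since
  positive heads have keys of at least \<open>r\<close>; so it stays in one interval. In a heavy
  tree every index but the first weighs at most twice its key.\<close>

lemma sum_omega_tree:
  assumes r: "0 < r" and Q: "separates Q r" and j: "j < k"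
  shows "sum (omega Q r) (A j) \<le> 2 * r + (if r \<le> c j then 4 * c j else 0)"
proof -
  define a where "a = Min (A j)"
  define B where "B = A j - {a}"
  have a: "a \<in> A j" and a_le: "\<And>b. b \<in> A j \<Longrightarrow> a \<le> b"
    unfolding a_def using A_fin[OF j] A_nonempty[OF j] by auto
  have B: "i \<in> A j" "a < i" "i < n" "0 < i" if "i \<in> B" for i
    using that a_le[of i] A_sub[OF j] by (auto simp: B_def)
  have Qs: "0 \<in> Q" "Q \<subseteq> {..<n}" "\<And>i. i \<in> Q \<Longrightarrow> 0 < i \<Longrightarrow> r \<le> e i" "\<And>i. i < n \<Longrightarrow> i \<notin> Q \<Longrightarrow> e i \<le> r"
    using Q by (auto simp: key_separates_def)
  have an: "a < n" using a A_sub[OF j] by auto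
  have split: "sum (omega Q r) (A j) = omega Q r a + sum (omega Q r) B"
    using a A_fin[OF j] by (simp add: B_def sum.remove)
  have Bc: "sum e B \<le> c j" using sum_le_cost[OF j] by (simp add: B_def a_def)
  show ?thesis
  proof (cases "r \<le> c j")
    case True
    have "omega Q r a \<le> 2 * r"
      using Qs(4)[OF an] mass_nonneg[of Q a] r by (auto simp: omega_def)
    moreover have "sum (omega Q r) B \<le> (\<Sum>i\<in>B. 2 * e i)"
    proof (rule sum_mono)
      fix i assume i: "i \<in> B"
      show "omega Q r i \<le> 2 * e i"
        using Qs(3)[of i] B[OF i] mass_nonneg[of Q i] r e_nonneg[of i] by (auto simp: omega_def)
    qed
    moreover have "(\<Sum>i\<in>B. 2 * e i) = 2 * sum e B" by (simp add: sum_distrib_left)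
    ultimately show ?thesis using split Bc True r by simp
  next
    case False
    have nQ: "l \<notin> Q" if "a < l" "l \<le> b" "b \<in> A j" for l b
      using key_le_cost[OF j a that(3,1,2)] Qs(3)[of l] that False by fastforce
    have "sum (omega Q r) B = sum e B"
      using nQ B by (intro sum.cong) (auto simp: omega_def)
    \<comment> \<open>If the tree starts at a head, the fill-up \<open>2 * r - mass\<close> is
      compensated by its keys, which are part of that mass; the alternative \<open>r\<close> meets
      keys of total less than \<open>r\<close>.\<close>
    moreover have "omega Q r a + sum e B \<le> 2 * r"
    proof (cases "a \<in> Q")
      case True
      have "B \<subseteq> {i\<in>{..<n} - Q. head Q i = a}"
      proof
        fix i assume i: "i \<in> B"
        have "head Q i = a"
          using B[OF i] True nQ[of _ i] by (intro head_eqI) (auto simp: not_less[symmetric])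
        then show "i \<in> {i\<in>{..<n} - Q. head Q i = a}"
          using B[OF i] nQ[of i i] by auto
      qed
      then have "sum e B \<le> mass Q a"
        unfolding key_mass_def by (intro sum_mono2) (auto intro: e_nonneg)
      then show ?thesis using True Bc False by (auto simp: omega_def)
    next
      case nmem: False
      then show ?thesis using Qs(4)[OF an] Bc False by (auto simp: omega_def)
    qed
    ultimately show ?thesis using split False by simp
  qed
qed

lemma omega_nonneg: "0 < r \<Longrightarrow> i < n \<Longrightarrow> 0 \<le> omega Q r i"
  using e_nonneg by (auto simp: omega_def)

lemma sum_omega_le:
  assumes r: "0 < r" and Q: "separates Q r"
  shows "sum (omega Q r) {..<n} \<le> 2 * r * k + 4 * heavy r"
proof -
  have "sum (omega Q r) (\<Union>j\<in>{..<k}. A j) \<le> (\<Sum>j\<in>{..<k}. sum (omega Q r) (A j))"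
    using A_fin A_sub omega_nonneg[OF r] by (intro sum_UN_le) (auto simp: subset_iff)
  also have "\<dots> \<le> (\<Sum>j\<in>{..<k}. 2 * r + (if r \<le> c j then 4 * c j else 0))"
    by (intro sum_mono sum_omega_tree r Q) auto
  also have "\<dots> = 2 * r * k + 4 * heavy r"
    by (simp add: sum.distrib heavy_def sum_distrib_left sum.If_cases lessThan_def Int_def conj_commute)
  finally show ?thesis using A_union by simp
qed

text \<open>With \<open>m\<close> intervals of \<open>Q\<close> in the component and total
  \<open>S\<close> of its keys outside \<open>Q\<close>, the weight is at least
  \<open>2 * r * m\<close> and at least \<open>r * m + S\<close>. For \<open>m = 1\<close> the mass
  hypothesis says \<open>2 * r \<le> S\<close> and the second bound suffices; for larger
  \<open>m\<close> the average of both does.\<close>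

lemma sum_omega_component:
  assumes r: "0 < r" and Q: "Q \<subseteq> {..<n}" and D: "0 \<in> D" "D \<subseteq> Q" and p: "p \<in> D"
  defines "C \<equiv> {i\<in>{..<n}. head D i = p}"
  shows "2 * r \<le> sum (omega Q r) C"
    and "2 * r \<le> mass D p \<Longrightarrow> sum e (C - Q) / 2 \<le> sum (omega Q r) C - 2 * r"
proof -
  define m where "m = real (card (Q \<inter> C))"
  have fin: "finite C" "finite (Q \<inter> C)" by (auto simp: C_def)
  have 0: "0 \<in> Q" using D by auto
  have pC: "p \<in> Q \<inter> C" using p Q D head_self by (auto simp: C_def)
  then have "card (Q \<inter> C) \<noteq> 0" using fin by auto
  then have m1: "1 \<le> m" by (simp add: m_def)
  have split: "sum (omega Q r) C = sum (omega Q r) (Q \<inter> C) + sum e (C - Q)"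
  proof -
    have "sum (omega Q r) C = sum (omega Q r) (C \<inter> Q) + sum (omega Q r) (C - Q)"
      by (rule sum.Int_Diff[OF fin(1)])
    moreover have "sum (omega Q r) (C - Q) = sum e (C - Q)"
      by (rule sum.cong) (auto simp: omega_def)
    ultimately show ?thesis by (simp add: Int_commute)
  qed
  have "(\<Sum>i\<in>Q \<inter> C. r) \<le> sum (omega Q r) (Q \<inter> C)"
    by (rule sum_mono) (auto simp: omega_def)
  then have 2: "r * m + sum e (C - Q) \<le> sum (omega Q r) C"
    using split by (simp add: m_def mult.commute)
  have "sum (mass Q) (Q \<inter> C) = (\<Sum>q\<in>Q \<inter> C. sum e {i\<in>C - Q. head Q i = q})"
  proof (rule sum.cong[OF refl])
    fix q assume "q \<in> Q \<inter> C"
    then have "{i\<in>{..<n} - Q. head Q i = q} = {i\<in>C - Q. head Q i = q}"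
      using head_head[OF D] by (auto simp: C_def)
    then show "mass Q q = sum e {i\<in>C - Q. head Q i = q}" by (simp add: key_mass_def)
  qed
  also have "\<dots> = sum e (C - Q)"
  proof (rule sum.group)
    show "head Q ` (C - Q) \<subseteq> Q \<inter> C"
      using head_mem[OF 0] head_head[OF D] by (auto simp: C_def intro: le_less_trans)
  qed (use fin in auto)
  finally have masses: "sum (mass Q) (Q \<inter> C) = sum e (C - Q)" .
  have "(\<Sum>i\<in>Q \<inter> C. 2 * r - mass Q i) \<le> sum (omega Q r) (Q \<inter> C)"
    by (rule sum_mono) (auto simp: omega_def)
  then have 1: "2 * r * m \<le> sum (omega Q r) C"
    using split masses by (simp add: m_def sum_subtractf mult.commute)
  show "2 * r \<le> sum (omega Q r) C"
    using 1 m1 r mult_left_mono[of 1 m "2 * r"] by linarith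
  show "sum e (C - Q) / 2 \<le> sum (omega Q r) C - 2 * r" if big: "2 * r \<le> mass D p"
  proof (cases "card (Q \<inter> C) = 1")
    case True
    then have QC: "Q \<inter> C = {p}" using pC by (metis card_1_singletonE singletonD)
    have "i \<notin> Q" if "i \<in> {i\<in>{..<n} - D. head D i = p}" for i
    proof
      assume "i \<in> Q"
      then have "i \<in> Q \<inter> C" using that by (simp add: C_def)
      then show False using QC that p by auto
    qed
    then have "{i\<in>{..<n} - D. head D i = p} = C - Q"
      using D by (auto simp: C_def)
    then have "mass D p = sum e (C - Q)" by (simp add: key_mass_def)
    then show ?thesis using 2 big True by (simp add: m_def)
  next
    case False
    then have "2 \<le> card (Q \<inter> C)" using m1 by (simp add: m_def)
    then have "2 * r \<le> r * m" using r by (simp add: m_def)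
    then show ?thesis using 1 2 r by linarith
  qed
qed

text \<open>The total weight minus \<open>2 * r\<close> for each component of \<open>D\<close> is a
  sum of nonnegative excesses, and the excess of a massive component is at least half its keys
  outside \<open>Q\<close>.\<close>

lemma small_keys_le:
  assumes r: "0 < r" and Q: "separates Q r" and D: "0 \<in> D" "D \<subseteq> Q"
  shows "(\<Sum>i\<in>{i\<in>{..<n} - Q. 2 * r \<le> mass D (head D i)}. e i)
    \<le> 4 * r * (real k - card D) + 8 * heavy r"
proof -
  have Qn: "Q \<subseteq> {..<n}" using Q by (auto simp: key_separates_def)
  have finD: "finite D" using finite_subset[of D "{..<n}"] D Qn by auto
  define C where "C p = {i\<in>{..<n}. head D i = p}" for p
  have head: "head D ` X \<subseteq> D" for X using head_mem[OF D(1)] by auto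
  let ?B = "{i\<in>{..<n} - Q. 2 * r \<le> mass D (head D i)}"
  have "sum e ?B / 2 = (\<Sum>p\<in>D. sum e {i\<in>?B. head D i = p}) / 2"
    using sum.group[OF _ finD head, of ?B e] by simp
  also have "\<dots> = (\<Sum>p\<in>D. sum e {i\<in>?B. head D i = p} / 2)"
    by (simp add: sum_divide_distrib)
  also have "\<dots> \<le> (\<Sum>p\<in>D. sum (omega Q r) (C p) - 2 * r)"
  proof (rule sum_mono)
    fix p assume p: "p \<in> D"
    note comp = sum_omega_component[OF r Qn D p, folded C_def]
    show "sum e {i\<in>?B. head D i = p} / 2 \<le> sum (omega Q r) (C p) - 2 * r"
    proof (cases "2 * r \<le> mass D p")
      case True
      then have "{i\<in>?B. head D i = p} = C p - Q" by (auto simp: C_def)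
      then show ?thesis using comp(2)[OF True] by simp
    next
      case False
      then have "{i\<in>?B. head D i = p} = {}" by auto
      then show ?thesis using comp(1) by (simp only: sum.empty)
    qed
  qed
  also have "\<dots> = sum (omega Q r) {..<n} - 2 * r * card D"
    using sum.group[OF _ finD head, of "{..<n}" "omega Q r"] by (simp add: sum_subtractf C_def)
  also have "\<dots> \<le> 2 * r * k + 4 * heavy r - 2 * r * card D"
    using sum_omega_le[OF r Q] by simp
  finally show ?thesis by (simp add: algebra_simps)
qed

text \<open>Exchange argument. Keys of at least \<open>r\<close> at indices other than the minima of
  the trees are paid for by heavy trees. Leaving out \<open>D\<close> instead of the at most
  \<open>k\<close> minima adds keys of at most \<rho> and drops keys of at least \<rho>.\<close>

lemma large_keys_le:
  assumes r: "0 < r" "r \<le> \<rho>" and D: "separates D \<rho>"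
  shows "(\<Sum>i\<in>{i\<in>{..<n} - D. r \<le> e i}. e i) \<le> heavy r + (real k - card D) * \<rho>"
proof -
  define M where "M = (\<lambda>j. Min (A j)) ` {..<k}"
  define U where "U = {i. 0 < i \<and> i < n \<and> r \<le> e i}"
  have Ds: "0 \<in> D" "D \<subseteq> {..<n}" "\<And>i. i \<in> D \<Longrightarrow> 0 < i \<Longrightarrow> \<rho> \<le> e i" "\<And>i. i < n \<Longrightarrow> i \<notin> D \<Longrightarrow> e i \<le> \<rho>"
    using D by (auto simp: key_separates_def)
  have fin: "finite U" "finite M" "finite D"
    using Ds(2) finite_subset by (auto simp: U_def M_def)
  have "card M \<le> k" using card_image_le[of "{..<k}" "\<lambda>j. Min (A j)"] by (simp add: M_def)
  have Mn: "M \<subseteq> {..<n}"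
    using A_sub A_fin A_nonempty Min_in by (fastforce simp: M_def)
  \<comment> \<open>Index 0 must be a minimum, because its key is exempt from the lower bound \<rho>
    on the keys of \<open>D\<close>.\<close>
  have M0: "0 \<in> M"
  proof -
    obtain j where j: "j < k" "0 \<in> A j" using A_union n_pos by blast
    then have "Min (A j) = 0" using A_fin[of j] by (intro Min_eqI) auto
    then show ?thesis using j by (force simp: M_def)
  qed
  have "sum e (U - M) \<le> sum e (\<Union>j\<in>{j\<in>{..<k}. r \<le> c j}. A j - {Min (A j)})"
  proof (rule sum_mono2)
    show "finite (\<Union>j\<in>{j\<in>{..<k}. r \<le> c j}. A j - {Min (A j)})" using A_fin by auto
    show "U - M \<subseteq> (\<Union>j\<in>{j\<in>{..<k}. r \<le> c j}. A j - {Min (A j)})"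
    proof
      fix i assume i: "i \<in> U - M"
      then obtain j where j: "j < k" "i \<in> A j" using A_union by (auto simp: U_def)
      have "Min (A j) \<noteq> i" using i j by (auto simp: M_def)
      moreover have "Min (A j) \<in> A j" "Min (A j) \<le> i"
        using A_fin[OF j(1)] A_nonempty[OF j(1)] j(2) by auto
      ultimately have "e i \<le> c j" using j by (intro key_le_cost[of j "Min (A j)" i i]) auto
      then show "i \<in> (\<Union>j\<in>{j\<in>{..<k}. r \<le> c j}. A j - {Min (A j)})"
        using i j \<open>Min (A j) \<noteq> i\<close> by (auto simp: U_def intro!: bexI[of _ j])
    qed
  qed (use A_sub e_nonneg in \<open>auto simp: subset_iff\<close>)
  also have "\<dots> \<le> (\<Sum>j\<in>{j\<in>{..<k}. r \<le> c j}. sum e (A j - {Min (A j)}))"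
    using A_fin A_sub e_nonneg by (intro sum_UN_le) (auto simp: subset_iff)
  also have "\<dots> \<le> heavy r"
    unfolding heavy_def by (intro sum_mono sum_le_cost) auto
  finally have UM: "sum e (U - M) \<le> heavy r" .
  have "sum e (U - D) = sum e (U - D - M) + sum e (U \<inter> M - D)"
  proof -
    have "U - D = (U - D - M) \<union> (U \<inter> M - D)" by auto
    moreover have "(U - D - M) \<inter> (U \<inter> M - D) = {}" by auto
    ultimately show ?thesis
      using sum.union_disjoint[of "U - D - M" "U \<inter> M - D" e] fin by simp
  qed
  moreover have "sum e (U - M) = sum e (U - D - M) + sum e (U \<inter> D - M)"
  proof -
    have "U - M = (U - D - M) \<union> (U \<inter> D - M)" by auto
    moreover have "(U - D - M) \<inter> (U \<inter> D - M) = {}" by auto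
    ultimately show ?thesis
      using sum.union_disjoint[of "U - D - M" "U \<inter> D - M" e] fin by simp
  qed
  moreover have "sum e (U \<inter> M - D) \<le> (\<Sum>i\<in>M - D. \<rho>)"
  proof -
    have "sum e (U \<inter> M - D) \<le> sum e (M - D)"
      using fin Mn e_nonneg by (intro sum_mono2) auto
    also have "\<dots> \<le> (\<Sum>i\<in>M - D. \<rho>)" using Mn Ds(4) by (intro sum_mono) auto
    finally show ?thesis .
  qed
  moreover have "(\<Sum>i\<in>D - M. \<rho>) \<le> sum e (U \<inter> D - M)"
  proof -
    have "i \<in> U" if "i \<in> D - M" for i
    proof -
      have "i \<noteq> 0" using that M0 by (metis DiffD2)
      then show ?thesis using that Ds(2) Ds(3)[of i] r by (auto simp: U_def)
    qed
    then have "U \<inter> D - M = D - M" by auto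
    moreover have "\<rho> \<le> e i" if "i \<in> D - M" for i
      using that M0 Ds(3)[of i] by (cases "i = 0") auto
    ultimately show ?thesis by (simp only: sum_mono)
  qed
  moreover have "real (card (M - D)) - card (D - M) \<le> real k - card D"
  proof -
    have "card M = card (M \<inter> D) + card (M - D)" "card D = card (M \<inter> D) + card (D - M)"
      using card_Int_Diff[of M D] card_Int_Diff[of D M] fin by (simp_all add: Int_commute)
    then show ?thesis using \<open>card M \<le> k\<close> by linarith
  qed
  then have "\<rho> * (real (card (M - D)) - card (D - M)) \<le> \<rho> * (real k - card D)"
    using r by (intro mult_left_mono) auto
  moreover have "{i\<in>{..<n} - D. r \<le> e i} = U - D"
    using Ds(1) by (auto simp: U_def intro: gr0I)
  ultimately show ?thesis using UM by (simp add: algebra_simps)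
qed

lemma component_keys_le:
  assumes D: "separates D \<rho>" and r: "0 < r" "r < \<rho>"
    and tight: "8 * (real k - card D) * \<rho> \<le> (\<Sum>i\<in>{i\<in>{..<n} - D. 2 * \<rho> \<le> mass D (head D i)}. e i)"
    and Dk: "card D \<le> k"
  shows "(\<Sum>i\<in>{i\<in>{..<n} - D. 2 * r \<le> mass D (head D i)}. e i) \<le> 19 * heavy r"
proof -
  have Ds: "0 \<in> D" "D \<subseteq> {..<n}" "\<And>i. i \<in> D \<Longrightarrow> 0 < i \<Longrightarrow> \<rho> \<le> e i" "\<And>i. i < n \<Longrightarrow> i \<notin> D \<Longrightarrow> e i \<le> \<rho>"
    using D by (auto simp: key_separates_def)
  define t where "t = (real k - card D) * \<rho>"
  have t0: "0 \<le> t" using Dk r by (simp add: t_def)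
  \<comment> \<open>At scale \<rho> the set \<open>D\<close> itself separates, so
    \<open>small_keys_le\<close> applies with \<open>Q = D\<close>.\<close>
  have "8 * t \<le> 4 * t + 8 * heavy \<rho>"
    using tight small_keys_le[OF _ D Ds(1) order_refl] r by (simp add: t_def algebra_simps)
  then have t: "t \<le> 2 * heavy r" using heavy_mono[of r \<rho>] r by linarith
  define Q where "Q = {i. i < n \<and> (i = 0 \<or> r \<le> e i)}"
  have Q: "separates Q r" "D \<subseteq> Q"
    using Ds r n_pos by (fastforce simp: key_separates_def Q_def)+
  let ?B = "{i\<in>{..<n} - D. 2 * r \<le> mass D (head D i)}"
  \<comment> \<open>The indices outside \<open>D\<close> are split at key \<open>r\<close>: the
    smaller keys are handled with the finer head set \<open>Q\<close>, the larger ones by the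
    exchange argument.\<close>
  have "sum e ?B \<le> sum e ({i\<in>{..<n} - Q. 2 * r \<le> mass D (head D i)} \<union> {i\<in>{..<n} - D. r \<le> e i})"
    using e_nonneg Ds(1) by (intro sum_mono2) (auto simp: Q_def intro: gr0I)
  also have "\<dots> \<le> sum e {i\<in>{..<n} - Q. 2 * r \<le> mass D (head D i)} + sum e {i\<in>{..<n} - D. r \<le> e i}"
    by (subst sum.union_inter[symmetric]) (auto intro!: sum_nonneg e_nonneg)
  also have "\<dots> \<le> (4 * r * (real k - card D) + 8 * heavy r) + (heavy r + t)"
    unfolding t_def using r
    by (intro add_mono small_keys_le Q Ds large_keys_le D) auto
  finally have "sum e ?B \<le> 4 * (r * (real k - card D)) + 9 * heavy r + t" by simp
  moreover have "r * (real k - card D) \<le> t"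
    unfolding t_def using r Dk by (subst mult.commute) (intro mult_left_mono, auto)
  ultimately show ?thesis using t by linarith
qed

end


section \<open>Trees given by parent functions\<close>

text \<open>There is no cycle because at a vertex of greatest height \<open>h\<close> on it both
  neighbours would have to be the parent.\<close>

lemma is_tree_parent_graph:
  fixes f :: "'b \<Rightarrow> 'a::linorder" and h :: "'b \<Rightarrow> nat"
  assumes f: "inj_on f Y" "f ` Y \<subseteq> V" and r: "r \<in> Y"
    and par: "\<And>y. y \<in> Y \<Longrightarrow> y \<noteq> r \<Longrightarrow> g y \<in> Y \<and> h (g y) < h y"
  defines "E \<equiv> {(u, v). u < v \<and> (\<exists>y\<in>Y - {r}. {u, v} = {f (g y), f y})}"
  shows "is_tree V (f ` Y, E)"
proof -
  have sub: "E \<subseteq> {(u, v). u \<in> f ` Y \<and> v \<in> f ` Y \<and> u < v}"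
    using par by (auto simp: E_def doubleton_eq_iff)
  have step: "(f y, f (g y)) \<in> E \<union> E\<inverse>" "(f (g y), f y) \<in> E \<union> E\<inverse>" if y: "y \<in> Y" "y \<noteq> r" for y
  proof -
    have "f y \<noteq> f (g y)" using f(1) y par[OF y] by (metis inj_onD less_irrefl)
    then show "(f y, f (g y)) \<in> E \<union> E\<inverse>" "(f (g y), f y) \<in> E \<union> E\<inverse>"
      using y by (auto simp: E_def doubleton_eq_iff not_less_iff_gr_or_eq)
  qed
  have reach: "(f y, f r) \<in> (E \<union> E\<inverse>)\<^sup>* \<and> (f r, f y) \<in> (E \<union> E\<inverse>)\<^sup>*" if "y \<in> Y" for y
    using that
  proof (induction "h y" arbitrary: y rule: less_induct)
    case less
    show ?case
    proof (cases "y = r")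
      case False
      then have "(f (g y), f r) \<in> (E \<union> E\<inverse>)\<^sup>* \<and> (f r, f (g y)) \<in> (E \<union> E\<inverse>)\<^sup>*"
        using less.hyps[of "g y"] par[OF less.prems] by auto
      then show ?thesis
        using step[OF less.prems False] by (meson converse_rtrancl_into_rtrancl rtrancl.rtrancl_into_rtrancl)
    qed simp
  qed
  have "connected_graph (f ` Y, E)"
    using r reach unfolding connected_graph_def by (auto intro: rtrancl_trans)
  moreover have "\<not> is_cycle E c" for c
  proof
    assume c: "is_cycle E c"
    define m where "m = length c"
    have len: "3 \<le> m" and dist: "distinct c"
      and adj: "\<And>i. i < m \<Longrightarrow> (c ! i, c ! (Suc i mod m)) \<in> E \<union> E\<inverse>"
      using c by (auto simp: is_cycle_def m_def)
    define b where "b i = inv_into Y f (c ! i)" for i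
    have mem: "c ! i \<in> f ` Y" if "i < m" for i
      using adj[OF that] sub by auto
    have b: "b i \<in> Y" "f (b i) = c ! i" if "i < m" for i
      using mem[OF that] by (auto simp: b_def inv_into_into f_inv_into_f)
    obtain i where i: "i < m" and imax: "\<And>j. j < m \<Longrightarrow> h (b j) \<le> h (b i)"
    proof -
      have "Max ((\<lambda>i. h (b i)) ` {..<m}) \<in> (\<lambda>i. h (b i)) ` {..<m}"
        using len by (intro Max_in) (auto simp: lessThan_empty_iff)
      then obtain i where i: "i < m" "h (b i) = Max ((\<lambda>i. h (b i)) ` {..<m})" by auto
      then have "\<forall>j<m. h (b j) \<le> h (b i)" by simp
      then show ?thesis using that i by blast
    qed
    have nb: "c ! j = f (g (b i))" if j: "j < m" and e: "(c ! i, c ! j) \<in> E \<union> E\<inverse>" for j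
    proof -
      obtain y where y: "y \<in> Y" "y \<noteq> r" "{c ! i, c ! j} = {f (g y), f y}"
        using e by (auto simp: E_def insert_commute)
      then consider "c ! i = f y" "c ! j = f (g y)" | "c ! i = f (g y)" "c ! j = f y"
        by (auto simp: doubleton_eq_iff)
      then show ?thesis
      proof cases
        case 1
        then have "b i = y" using b[OF i] y(1) inj_onD[OF f(1)] by auto
        then show ?thesis using 1 by simp
      next
        case 2
        then have "b j = y" "b i = g y"
          using b[OF i] b[OF j] y(1) par[OF y(1,2)] inj_onD[OF f(1)] by auto
        then show ?thesis using par[OF y(1,2)] imax[OF j] by auto
      qed
    qed
    define s where "s = Suc i mod m"
    \<comment> \<open>The predecessor on the cycle, written with \<open>m - 1\<close> added since
      truncated subtraction would fail at \<open>i = 0\<close>.\<close>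
    define p where "p = (i + (m - 1)) mod m"
    have s: "s < m" "p < m" using len by (auto simp: s_def p_def)
    have "Suc p mod m = i"
    proof -
      have "Suc p mod m = Suc (i + (m - 1)) mod m" by (simp add: p_def mod_Suc_eq)
      also have "Suc (i + (m - 1)) = i + m" using len by simp
      finally show ?thesis using i by simp
    qed
    then have "(c ! i, c ! p) \<in> E \<union> E\<inverse>" using adj[OF s(2)] by auto
    then have "c ! p = c ! s" using nb[OF s(2)] nb[OF s(1)] adj[OF i] by (simp add: s_def)
    then have "p = s" using dist s by (simp add: m_def nth_eq_iff_index_eq)
    moreover have "p \<noteq> s"
    proof (cases "Suc i < m")
      case True
      show ?thesis
      proof (cases "i = 0")
        case True
        then have "p = m - 1" "s = 1" using len by (auto simp: p_def s_def)
        then show ?thesis using len by simp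
      next
        case False
        then have eq: "i + (m - 1) = (i - 1) + m" using len by simp
        have "p = i - 1" unfolding p_def eq using i by simp
        then show ?thesis using True by (simp add: s_def)
      qed
    next
      case False
      then have im: "Suc i = m" using i by simp
      then have eq: "i + (m - 1) = (i - 1) + m" using len by simp
      have "p = i - 1" unfolding p_def eq using i by simp
      then show ?thesis using im len by (simp add: s_def)
    qed
    ultimately show False by simp
  qed
  ultimately show ?thesis
    using sub f(2) by (auto simp: is_tree_def subgraph_of_complete_def)
qed

text \<open>Two vertices with the same parent edge would be each other's parent, against the
  decrease of \<open>h\<close>; so edges may be summed over the vertices other than the
  root.\<close>

lemma weight_parent_graph:
  fixes f :: "'b \<Rightarrow> 'a::linorder" and h :: "'b \<Rightarrow> nat"
  assumes f: "inj_on f Y" "f ` Y \<subseteq> V" and r: "r \<in> Y"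
    and par: "\<And>y. y \<in> Y \<Longrightarrow> y \<noteq> r \<Longrightarrow> g y \<in> Y \<and> h (g y) < h y"
    and sym: "\<And>u v. u \<in> V \<Longrightarrow> v \<in> V \<Longrightarrow> d u v = d v u"
  defines "E \<equiv> {(u, v). u < v \<and> (\<exists>y\<in>Y - {r}. {u, v} = {f (g y), f y})}"
  shows "weight d (S, E) = (\<Sum>y\<in>Y - {r}. d (f (g y)) (f y))"
proof -
  define q where "q y = (min (f (g y)) (f y), max (f (g y)) (f y))" for y
  have ne: "f (g y) \<noteq> f y" if "y \<in> Y - {r}" for y
    using f(1) par[of y] that by (metis DiffE inj_onD less_irrefl singletonI)
  have "inj_on q (Y - {r})"
  proof (rule inj_onI)
    fix x y assume xy: "x \<in> Y - {r}" "y \<in> Y - {r}" "q x = q y"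
    have "{f (g x), f x} = {f (g y), f y}"
      using xy(3) by (auto simp: q_def min_def max_def split: if_splits)
    then consider "f x = f y" | "f (g x) = f y" "f x = f (g y)"
      by (auto simp: doubleton_eq_iff)
    then show "x = y"
    proof cases
      case 1
      then show ?thesis using f(1) xy by (auto dest: inj_onD)
    next
      case 2
      then have "g x = y" "x = g y" using f(1) par[of x] par[of y] xy by (auto dest: inj_onD)
      then show ?thesis using par[of x] par[of y] xy by auto
    qed
  qed
  moreover have "q ` (Y - {r}) = E"
  proof
    show "q ` (Y - {r}) \<subseteq> E"
    proof (rule image_subsetI)
      fix y assume y: "y \<in> Y - {r}"
      show "q y \<in> E"
      proof (cases "f (g y) < f y")
        case True
        then show ?thesis using y by (auto simp: E_def q_def min_def max_def)
      next
        case False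
        then have "f y < f (g y)" using ne[OF y] by auto
        then show ?thesis using y by (auto simp: E_def q_def min_def max_def)
      qed
    qed
    show "E \<subseteq> q ` (Y - {r})"
    proof (rule subrelI)
      fix u v assume "(u, v) \<in> E"
      then obtain y where y: "y \<in> Y - {r}" "u < v" "{u, v} = {f (g y), f y}" by (auto simp: E_def)
      then have "(u, v) = q y" by (auto simp: q_def doubleton_eq_iff min_def max_def)
      then show "(u, v) \<in> q ` (Y - {r})" using y(1) by simp
    qed
  qed
  ultimately have "weight d (S, E) = (\<Sum>y\<in>Y - {r}. case q y of (u, v) \<Rightarrow> d u v)"
    using sum.reindex[of q "Y - {r}" "\<lambda>(u, v). d u v"] by (simp add: weight_def o_def)
  also have "\<dots> = (\<Sum>y\<in>Y - {r}. d (f (g y)) (f y))"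
  proof (rule sum.cong[OF refl])
    fix y assume "y \<in> Y - {r}"
    then have "f y \<in> V" "f (g y) \<in> V" using f(2) par[of y] by auto
    then show "(case q y of (u, v) \<Rightarrow> d u v) = d (f (g y)) (f y)"
      using sym by (auto simp: q_def min_def max_def)
  qed
  finally show ?thesis .
qed


section \<open>Single-linkage orders\<close>

text \<open>What is kept of Prim's algorithm. \<open>cut_rule\<close> holds because the pair crosses
  the cut between the points listed before \<open>l\<close> and the rest, and \<open>e l\<close> is
  the shortest length across it.\<close>

locale prim_order =
  fixes n :: nat and d :: "nat \<Rightarrow> nat \<Rightarrow> real" and vx pa :: "nat \<Rightarrow> nat" and e :: "nat \<Rightarrow> real"
  assumes n_pos: "0 < n"
    and metric: "Metric_space {..<n} d"
    and vx: "bij_betw vx {..<n} {..<n}"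
    and pa: "0 < i \<Longrightarrow> i < n \<Longrightarrow> pa i < i \<and> e i = d (vx (pa i)) (vx i)"
    and e_0: "e 0 = 0"
    and cut_rule: "i < l \<Longrightarrow> l \<le> j \<Longrightarrow> j < n \<Longrightarrow> e l \<le> d (vx i) (vx j)"
begin

definition delta :: "nat \<Rightarrow> nat \<Rightarrow> real" where
  "delta i j = d (vx i) (vx j)"

lemma vx_less: "i < n \<Longrightarrow> vx i < n"
  using vx by (auto simp: bij_betw_def)

lemma d_nonneg: "0 \<le> d u v"
  using metric by (rule Metric_space.nonneg)

lemma d_commute: "d u v = d v u"
  using metric by (rule Metric_space.commute)

lemma delta_nonneg: "0 \<le> delta i j"
  by (simp add: delta_def d_nonneg)

lemma delta_commute: "delta i j = delta j i"
  by (simp add: delta_def d_commute)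

lemma delta_triangle: "i < n \<Longrightarrow> j < n \<Longrightarrow> l < n \<Longrightarrow> delta i l \<le> delta i j + delta j l"
  unfolding delta_def by (intro Metric_space.triangle[OF metric]) (auto simp: vx_less)

lemma e_nonneg: "i < n \<Longrightarrow> 0 \<le> e i"
  using pa[of i] e_0 d_nonneg by (cases "i = 0") auto

lemma e_pos: assumes "0 < i" "i < n" shows "0 < e i"
proof -
  have p: "pa i < i" "e i = d (vx (pa i)) (vx i)" using pa[OF assms] by auto
  then have "vx (pa i) \<noteq> vx i"
    using vx assms by (auto simp: bij_betw_def inj_on_eq_iff)
  then have "d (vx (pa i)) (vx i) \<noteq> 0"
    using Metric_space.zero[OF metric, of "vx (pa i)" "vx i"] vx_less[of i] vx_less[of "pa i"] p assms by auto
  then show ?thesis using p d_nonneg[of "vx (pa i)" "vx i"] by linarith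
qed

definition rank_of :: "nat \<Rightarrow> nat" where
  "rank_of = the_inv_into {..<n} vx"

lemma rank_of: "v < n \<Longrightarrow> rank_of v < n \<and> vx (rank_of v) = v"
  using vx the_inv_into_into[of vx "{..<n}" v "{..<n}"] f_the_inv_into_f[of vx "{..<n}" v]
  by (auto simp: rank_of_def bij_betw_def)

lemma rank_of_vx: "i < n \<Longrightarrow> rank_of (vx i) = i"
  using vx by (auto simp: rank_of_def bij_betw_def the_inv_into_f_f)


lemma key_le_edge:
  assumes u: "u < n" and v: "v < n" and l: "rank_of u < l" "l \<le> rank_of v"
  shows "e l \<le> d u v"
  using cut_rule[of "rank_of u" l "rank_of v"] rank_of[OF u] rank_of[OF v] l by auto

context
  fixes T :: "nat ugraph"
  assumes T: "is_tree {..<n} T"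
begin

lemma tree_facts:
  "fst T \<subseteq> {..<n}" "snd T \<subseteq> fst T \<times> fst T" "connected_graph (fst T, snd T)" "fst T \<noteq> {}" "finite (fst T)" "finite (snd T)"
proof -
  show 1: "fst T \<subseteq> {..<n}" "snd T \<subseteq> fst T \<times> fst T" "connected_graph (fst T, snd T)"
    using T by (auto simp: is_tree_def subgraph_of_complete_def split: prod.splits)
  show "fst T \<noteq> {}" using 1(3) by (cases T) (auto simp: connected_graph_def)
  show "finite (fst T)" using 1(1) finite_subset by blast
  then show "finite (snd T)" using 1(2) finite_subset by blast
qed

text \<open>A connected tree with points on both sides of position \<open>l\<close> has an edge
  across, to which the cut rule applies.\<close>

lemma key_le_weight:
  assumes a: "a < n" "vx a \<in> fst T" and b: "b < n" "vx b \<in> fst T" and l: "a < l" "l \<le> b"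
  shows "e l \<le> weight d T"
proof -
  define f where "f v = (l \<le> rank_of v)" for v
  have "f ` fst T = {True, False}"
    using a b l rank_of_vx[of a] rank_of_vx[of b] by (force simp: f_def)
  then have "card (f ` fst T) = 2" by (simp only: card_2_iff) blast
  then have "card {(x, y) \<in> snd T. f x \<noteq> f y} \<noteq> 0"
    using card_image_le_Suc_bichromatic_edges[OF tree_facts(3,5,2), of f] by linarith
  then obtain x y where xy: "(x, y) \<in> snd T" "f x \<noteq> f y"
    using card.empty by (metis (mono_tags, lifting) Collect_empty_eq case_prodE)
  have "x < n" "y < n" using xy tree_facts by auto
  then have "e l \<le> d x y"
    using xy(2) key_le_edge[of x y l] key_le_edge[of y x l] d_commute[of x y] by (auto simp: f_def)
  also have "\<dots> \<le> weight d T"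
    unfolding weight_def
    using member_le_sum[OF xy(1), of "\<lambda>(u, v). d u v"] tree_facts(6) d_nonneg by auto
  finally show ?thesis .
qed

text \<open>Counted at each level \<open>s\<close>: cutting \<open>A\<close> at its keys above
  \<open>s\<close> splits the points of the tree into classes, joining them takes an edge per cut,
  and edges between classes are longer than \<open>s\<close>. The minimum of \<open>A\<close> opens
  the first class and needs no edge.\<close>

lemma sum_keys_le_weight:
  defines "A \<equiv> {i\<in>{..<n}. vx i \<in> fst T}"
  shows "sum e (A - {Min A}) \<le> weight d T"
  unfolding weight_def
proof (rule sum_le_sum_if_card_levels_le)
  show "finite (A - {Min A})" by (simp add: A_def)
  show "finite (snd T)" by (rule tree_facts)
  show "0 \<le> e i" if "i \<in> A - {Min A}" for i using that e_nonneg by (auto simp: A_def)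
  show "0 \<le> (case y of (u, v) \<Rightarrow> d u v)" for y using d_nonneg by (auto split: prod.splits)
  fix s :: real assume s: "0 \<le> s"
  have finA: "finite A" by (simp add: A_def)
  have rA: "rank_of v \<in> A" if "v \<in> fst T" for v
    using rank_of[of v] that tree_facts(1) by (auto simp: A_def)
  have A_ne: "A \<noteq> {}" using rA tree_facts(4) by auto
  define Z where "Z = {i\<in>A - {Min A}. s < e i}"
  \<comment> \<open>\<open>Min A\<close> takes the role of 0, which may lie outside
    \<open>A\<close>: it makes \<open>head Q\<close> well defined on all of
    \<open>A\<close>.\<close>
  define Q where "Q = insert (Min A) Z"
  have mem: "head Q i \<in> Q" "head Q i \<le> i" if "i \<in> A" for i
  proof -
    have "head Q i \<in> {q\<in>Q. q \<le> i}"
      unfolding head_def using finA that by (intro Max_in) (auto simp: Q_def Z_def)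
    then show "head Q i \<in> Q" "head Q i \<le> i" by auto
  qed
  define f where "f v = head Q (rank_of v)" for v
  have "Q \<subseteq> f ` fst T"
  proof
    fix q assume q: "q \<in> Q"
    then have "q \<in> A" using Min_in[OF finA A_ne] by (auto simp: Q_def Z_def)
    then have "vx q \<in> fst T" "f (vx q) = q" using q by (auto simp: A_def f_def rank_of_vx head_self)
    then show "q \<in> f ` fst T" by (metis image_eqI)
  qed
  then have "card Q \<le> card (f ` fst T)" using tree_facts(5) by (intro card_mono) auto
  moreover have "card Q = Suc (card Z)" using finA by (simp add: Q_def Z_def)
  ultimately have "card Z \<le> card {(x, y) \<in> snd T. f x \<noteq> f y}"
    using card_image_le_Suc_bichromatic_edges[OF tree_facts(3,5,2), of f] by linarith
  also have "\<dots> \<le> card {y \<in> snd T. s < (case y of (u, v) \<Rightarrow> d u v)}"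
  proof (rule card_mono)
    show "finite {y \<in> snd T. s < (case y of (u, v) \<Rightarrow> d u v)}" using tree_facts(6) by auto
    have key: "s < d x y" if xy: "x \<in> fst T" "y \<in> fst T" "f x \<noteq> f y" "rank_of x \<le> rank_of y" for x y
    proof -
      have n: "x < n" "y < n" using xy tree_facts(1) by auto
      define l where "l = f y"
      have l: "l \<in> Q" "l \<le> rank_of y" using mem[OF rA[OF xy(2)]] by (auto simp: l_def f_def)
      have "rank_of x < l"
      proof (rule ccontr)
        assume "\<not> rank_of x < l"
        then have "l \<le> f x" using l(1) by (auto simp: f_def intro: head_ge)
        moreover have "f x \<le> l"
          unfolding l_def f_def using mem[OF rA[OF xy(1)]] xy(4) by (intro head_ge) auto
        ultimately show False using xy(3) by (simp add: l_def)
      qed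
      moreover have "Min A \<le> rank_of x" using finA rA[OF xy(1)] by simp
      ultimately have "l \<in> Z" using l(1) by (auto simp: Q_def)
      then have "s < e l" by (simp add: Z_def)
      also have "e l \<le> d x y" using key_le_edge[OF n \<open>rank_of x < l\<close> l(2)] .
      finally show ?thesis .
    qed
    show "{(x, y) \<in> snd T. f x \<noteq> f y} \<subseteq> {y \<in> snd T. s < (case y of (u, v) \<Rightarrow> d u v)}"
    proof clarify
      fix x y assume xy: "(x, y) \<in> snd T" "f x \<noteq> f y"
      then have m: "x \<in> fst T" "y \<in> fst T" using tree_facts(2) by auto
      show "s < d x y"
        using key[OF m xy(2)] key[OF m(2,1)] xy(2) d_commute[of x y] by (cases "rank_of x \<le> rank_of y") auto
    qed
  qed
  finally show "card {i\<in>A - {Min A}. s < e i} \<le> card {y \<in> snd T. s < (case y of (u, v) \<Rightarrow> d u v)}"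
    by (simp add: Z_def)
qed

end

lemma key_cover:
  assumes "tree_cover {..<n} k Ts"
  shows "key_cover n k e (\<lambda>j. {i\<in>{..<n}. vx i \<in> fst (Ts ! j)}) (\<lambda>j. weight d (Ts ! j))"
proof -
  have tree: "is_tree {..<n} (Ts ! j)" if "j < k" for j
    using assms that by (auto simp: tree_cover_def)
  show ?thesis
  proof
    have un: "(\<Union>j<k. fst (Ts ! j)) = {..<n}"
    proof -
      have "set Ts = (\<lambda>j. Ts ! j) ` {..<k}"
        using assms by (auto simp: tree_cover_def set_conv_nth)
      then show ?thesis using assms by (simp add: tree_cover_def)
    qed
    show "{i\<in>{..<n}. vx i \<in> fst (Ts ! j)} \<noteq> {}" if j: "j < k" for j
    proof -
      obtain v where "v \<in> fst (Ts ! j)" "v < n" using tree_facts(1,4)[OF tree[OF j]] by blast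
      then have "rank_of v \<in> {i\<in>{..<n}. vx i \<in> fst (Ts ! j)}" using rank_of[of v] by auto
      then show ?thesis by blast
    qed
    show "(\<Union>j<k. {i\<in>{..<n}. vx i \<in> fst (Ts ! j)}) = {..<n}"
    proof -
      have "\<exists>j<k. vx i \<in> fst (Ts ! j)" if "i < n" for i
        using un vx_less[OF that] by blast
      then show ?thesis by auto
    qed
    show "e l \<le> weight d (Ts ! j)"
      if "j < k" "a \<in> {i\<in>{..<n}. vx i \<in> fst (Ts ! j)}" "b \<in> {i\<in>{..<n}. vx i \<in> fst (Ts ! j)}" "a < l" "l \<le> b" for j a b l
      using that by (intro key_le_weight[OF tree, of j a b]) auto
  qed (use n_pos e_nonneg sum_keys_le_weight[OF tree] in auto)
qed

end


section \<open>Tours and their cuts\<close>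

fun insert_after :: "'a \<Rightarrow> 'a \<Rightarrow> 'a list \<Rightarrow> 'a list" where
  "insert_after q i [] = []"
| "insert_after q i (x # xs) = (if x = q then x # i # xs else x # insert_after q i xs)"

lemma set_insert_after: "q \<in> set xs \<Longrightarrow> set (insert_after q i xs) = insert i (set xs)"
  by (induction xs) auto

lemma length_insert_after: "q \<in> set xs \<Longrightarrow> length (insert_after q i xs) = Suc (length xs)"
  by (induction xs) auto

lemma distinct_insert_after:
  "distinct xs \<Longrightarrow> i \<notin> set xs \<Longrightarrow> q \<in> set xs \<Longrightarrow> distinct (insert_after q i xs)"
  by (induction xs) (auto simp: set_insert_after)

lemma hd_insert_after: "xs \<noteq> [] \<Longrightarrow> hd (insert_after q i xs) = hd xs"
  by (cases xs) auto

text \<open>A step is charged to the place where it ends, so that one list can be measured component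
  by component.\<close>

fun path_sum :: "('a \<Rightarrow> 'a \<Rightarrow> real) \<Rightarrow> ('a \<Rightarrow> bool) \<Rightarrow> 'a list \<Rightarrow> real" where
  "path_sum f P (x # y # xs) = (if P y then f x y else 0) + path_sum f P (y # xs)"
| "path_sum f P _ = 0"

lemma path_sum_conv_sum:
  "path_sum f P xs = (\<Sum>t<length xs - 1. if P (xs ! Suc t) then f (xs ! t) (xs ! Suc t) else 0)"
proof (induction f P xs rule: path_sum.induct)
  case (1 f P x y xs)
  show ?case
    using 1 sum.lessThan_Suc_shift[of "\<lambda>t. if P ((x # y # xs) ! Suc t) then f ((x # y # xs) ! t) ((x # y # xs) ! Suc t) else 0" "length xs"]
    by (simp cong: if_cong)
qed auto

text \<open>By \<open>head_pa\<close> the intervals of \<open>D\<close> are the components left when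
  the parent edges at \<open>D\<close> are deleted; \<open>X\<close> is the cut length.\<close>

locale prim_cut = prim_order +
  fixes D :: "nat set" and X :: real
  assumes D_0: "0 \<in> D" and D_sub: "D \<subseteq> {..<n}"
    and head_pa: "i < n \<Longrightarrow> i \<notin> D \<Longrightarrow> head D (pa i) = head D i"
    and X_nonneg: "0 \<le> X"
begin

text \<open>\<open>n\<close> is no index but a sentinel at the front. Every head is attached to it,
  so the tours of all components form a single list.\<close>

abbreviation "attach i \<equiv> if i \<in> D then n else pa i"

primrec tour :: "nat \<Rightarrow> nat list" where
  "tour 0 = [n]"
| "tour (Suc i) = insert_after (attach i) i (tour i)"

lemma attach: "i < n \<Longrightarrow> attach i \<in> insert n {..<i}"
  using pa[of i] D_0 by (cases "i = 0") auto

lemma set_tour: "i \<le> n \<Longrightarrow> set (tour i) = insert n {..<i}"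
proof (induction i)
  case (Suc i)
  then have *: "set (tour i) = insert n {..<i}" by simp
  have "set (tour (Suc i)) = insert i (set (tour i))"
    unfolding tour.simps by (rule set_insert_after) (use attach[of i] Suc.prems * in auto)
  then show ?case using * by (auto simp: lessThan_Suc)
qed simp

lemma attach_mem: "i < n \<Longrightarrow> attach i \<in> set (tour i)"
  using attach[of i] set_tour[of i] by simp

lemma length_tour: "i \<le> n \<Longrightarrow> length (tour i) = Suc i"
proof (induction i)
  case (Suc i)
  then show ?case using length_insert_after[OF attach_mem[of i], of i] by simp
qed simp

lemma distinct_tour: "i \<le> n \<Longrightarrow> distinct (tour i)"
proof (induction i)
  case (Suc i)
  then have "i \<notin> set (tour i)" by (simp add: set_tour)
  then show ?case using distinct_insert_after[OF _ _ attach_mem[of i], of i] Suc by simp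
qed simp

lemma hd_tour: "i \<le> n \<Longrightarrow> tour i \<noteq> [] \<and> hd (tour i) = n"
proof (induction i)
  case (Suc i)
  then show ?case using length_tour[OF Suc.prems] by (auto simp: hd_insert_after)
qed simp

text \<open>Along a list without repetitions that starts at the sentinel, this says that every
  component is one block headed by its head.\<close>

definition linked :: "nat \<Rightarrow> nat \<Rightarrow> bool" where
  "linked x y \<longleftrightarrow> y < n \<and> (y \<in> D \<or> x < n \<and> head D x = head D y)"

lemma successively_insert_after:
  assumes i: "i < n" and xs: "successively linked xs" "q \<in> set xs" "q = attach i"
  shows "successively linked (insert_after q i xs)"
  using xs(1,2)
proof (induction xs)
  case (Cons x xs)
  have qi: "linked q i"
    using xs(3) head_pa[OF i] pa[of i] D_0 i by (cases "i = 0") (auto simp: linked_def)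
  show ?case
  proof (cases "x = q")
    case True
    have iy: "linked i y" if "linked q y" for y
    proof (cases "i \<in> D")
      case False
      then show ?thesis using that head_pa[OF i False] xs(3) i by (auto simp: linked_def)
    qed (use that xs(3) in \<open>auto simp: linked_def\<close>)
    show ?thesis
      using Cons.prems qi iy True by (cases xs) auto
  next
    case False
    then have "successively linked (insert_after q i xs)"
      using Cons by (cases xs) auto
    moreover have "xs \<noteq> []" using False Cons.prems by auto
    ultimately show ?thesis
      using False Cons.prems by (cases xs) (auto split: if_splits)
  qed
qed simp

lemma successively_tour: "i \<le> n \<Longrightarrow> successively linked (tour i)"
proof (induction i)
  case (Suc i)
  then show ?case using successively_insert_after[OF _ _ attach_mem[of i] refl] by simp
qed simp

definition inside :: "nat \<Rightarrow> nat \<Rightarrow> bool" where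
  "inside p y \<longleftrightarrow> y \<notin> D \<and> head D y = p"

text \<open>By the triangle inequality, inserting a point next to its parent lengthens a tour by at most
  twice the length of the edge to the parent.\<close>

lemma path_sum_insert_after:
  assumes i: "i < n" and xs: "successively linked xs" "q \<in> set xs" "q = attach i"
  shows "path_sum delta (inside p) (insert_after q i xs)
    \<le> path_sum delta (inside p) xs + (if inside p i then 2 * e i else 0)"
  using xs(1,2)
proof (induction xs)
  case (Cons x xs)
  have qi: "q = pa i" "0 < i" "q < i" "delta q i = e i" "head D q = head D i" if "i \<notin> D"
  proof -
    show "q = pa i" using that xs(3) by simp
    show "0 < i" using that D_0 by (cases "i = 0") auto
    then show "q < i" "delta q i = e i" "head D q = head D i"
      using pa[of i] i that xs(3) head_pa by (auto simp: delta_def)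
  qed
  have ei: "0 \<le> e i" using e_nonneg i by simp
  show ?case
  proof (cases "x = q")
    case True
    show ?thesis
    proof (cases xs)
      case Nil
      then show ?thesis using True qi ei by (auto simp: inside_def)
    next
      case (Cons y ys)
      show ?thesis
      proof (cases "inside p y")
        case yin: True
        have l: "linked x y" using Cons.prems Cons by simp
        then have q: "q < n" "head D q = p" using yin True by (auto simp: linked_def inside_def)
        then have iD: "i \<notin> D" using xs(3) by auto
        have y: "y < n" using l by (simp add: linked_def)
        have "delta i y \<le> delta i q + delta q y" using i q y by (intro delta_triangle) auto
        then show ?thesis
          using Cons True yin iD qi ei q delta_commute[of i q] by (auto simp: inside_def)
      next
        case False
        then show ?thesis using Cons True qi ei by (auto simp: inside_def)
      qed
    qed
  next
    case False
    then have "q \<in> set xs" using Cons.prems by auto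
    then obtain y ys where ys: "xs = y # ys" by (cases xs) auto
    then have IH: "path_sum delta (inside p) (insert_after q i xs)
      \<le> path_sum delta (inside p) xs + (if inside p i then 2 * e i else 0)"
      using Cons.IH Cons.prems \<open>q \<in> set xs\<close> by auto
    moreover obtain zs where "insert_after q i xs = y # zs" using ys by (cases "y = q") auto
    ultimately show ?thesis using False ys by auto
  qed
qed simp

lemma sum_mass_heads:
  "(\<Sum>p\<in>{p\<in>D. P p}. key_mass n e D p) = (\<Sum>i\<in>{i\<in>{..<n} - D. P (head D i)}. e i)"
proof -
  have "(\<Sum>p\<in>{p\<in>D. P p}. key_mass n e D p)
      = (\<Sum>p\<in>{p\<in>D. P p}. sum e {i\<in>{i\<in>{..<n} - D. P (head D i)}. head D i = p})"
    unfolding key_mass_def by (intro sum.cong) auto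
  also have "\<dots> = (\<Sum>i\<in>{i\<in>{..<n} - D. P (head D i)}. e i)"
    using finite_subset[OF D_sub] head_mem[OF D_0] by (intro sum.group) auto
  finally show ?thesis .
qed

lemma path_sum_tour: "i \<le> n \<Longrightarrow> path_sum delta (inside p) (tour i) \<le> (\<Sum>j<i. if inside p j then 2 * e j else 0)"
proof (induction i)
  case (Suc i)
  then show ?case
    using path_sum_insert_after[OF _ successively_tour attach_mem refl, of i p] by simp
qed simp

section \<open>Greedy cutting of the tours\<close>

definition M :: "nat list" where
  "M = tour n"

text \<open>\<open>step 1\<close> starts at the sentinel and is no distance of the space; it never
  enters a piece, because position 1 holds a head and is a cut.\<close>

definition step :: "nat \<Rightarrow> real" where
  "step t = delta (M ! (t - 1)) (M ! t)"

lemma M_0: "M ! 0 = n"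
  using hd_tour[of n] hd_conv_nth[of "tour n"] by (simp add: M_def)

lemma length_M: "length M = Suc n"
  by (simp add: M_def length_tour)

lemma M_linked: "t < n \<Longrightarrow> linked (M ! t) (M ! Suc t)"
  using successively_tour[of n] length_M by (auto simp: M_def successively_conv_nth)

lemma M_less: "1 \<le> t \<Longrightarrow> t \<le> n \<Longrightarrow> M ! t < n"
  using M_linked[of "t - 1"] by (auto simp: linked_def)

lemma M_1: "M ! Suc 0 \<in> D"
  using M_linked[of 0] n_pos by (auto simp: linked_def M_0)

lemma bij_M: "bij_betw (\<lambda>t. M ! t) {1..n} {..<n}"
proof -
  have inj: "inj_on (\<lambda>t. M ! t) {1..n}"
    using distinct_tour[of n] length_M by (auto simp: inj_on_def M_def nth_eq_iff_index_eq)
  then have "card ((\<lambda>t. M ! t) ` {1..n}) = n" by (simp add: card_image)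
  moreover have "(\<lambda>t. M ! t) ` {1..n} \<subseteq> {..<n}" using M_less by auto
  ultimately show ?thesis using inj card_subset_eq[of "{..<n}"] by (auto simp: bij_betw_def)
qed

primrec acc :: "nat \<Rightarrow> real" where
  "acc 0 = 0"
| "acc (Suc t) = (if M ! Suc t \<in> D \<or> X < acc t + step (Suc t) then 0 else acc t + step (Suc t))"

definition cut :: "nat \<Rightarrow> bool" where
  "cut t \<longleftrightarrow> M ! t \<in> D \<or> X < acc (t - 1) + step t"

primrec num :: "nat \<Rightarrow> nat" where
  "num 0 = 0"
| "num (Suc t) = num t + (if cut (Suc t) then 1 else 0)"

lemma acc_Suc: "acc (Suc t) = (if cut (Suc t) then 0 else acc t + step (Suc t))"
  by (simp add: cut_def)

lemma step_nonneg: "0 \<le> step t"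
  by (simp add: step_def delta_nonneg)

lemma acc_nonneg: "0 \<le> acc t"
  by (induction t) (auto simp: step_nonneg)

lemma num_mono: "s \<le> t \<Longrightarrow> num s \<le> num t"
  by (induction t) (auto simp: le_Suc_eq)

lemma cut_1: "cut (Suc 0)"
  using M_1 by (simp add: cut_def)

lemma num_conv_card: "num t = card {s\<in>{1..t}. cut s}"
proof (induction t)
  case (Suc t)
  have "{s\<in>{1..Suc t}. cut s} = (if cut (Suc t) then insert (Suc t) {s\<in>{1..t}. cut s} else {s\<in>{1..t}. cut s})"
    by (auto simp: le_Suc_eq)
  then show ?case using Suc by simp
qed simp

definition piece_weight :: "nat \<Rightarrow> nat \<Rightarrow> real" where
  "piece_weight j t = (\<Sum>s\<in>{s\<in>{1..t}. \<not> cut s \<and> num s = j}. step s)"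

lemma piece_weight_Suc:
  "piece_weight j (Suc t) = piece_weight j t + (if \<not> cut (Suc t) \<and> num (Suc t) = j then step (Suc t) else 0)"
proof -
  have "{s\<in>{1..Suc t}. \<not> cut s \<and> num s = j} = (if \<not> cut (Suc t) \<and> num (Suc t) = j
      then insert (Suc t) {s\<in>{1..t}. \<not> cut s \<and> num s = j} else {s\<in>{1..t}. \<not> cut s \<and> num s = j})"
    by (auto simp: le_Suc_eq simp del: num.simps)
  then show ?thesis by (simp add: piece_weight_def del: num.simps)
qed

text \<open>The running weight \<open>acc\<close> is the weight of the open piece, and a step is
  added only if the result stays within \<open>X\<close>. Closed pieces no longer change.\<close>

lemma piece_weight_le_X: "piece_weight j t \<le> X \<and> piece_weight (num t) t = acc t"
proof (induction t arbitrary: j)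
  case 0
  then show ?case using X_nonneg by (simp add: piece_weight_def)
next
  case (Suc t)
  show ?case
  proof (cases "cut (Suc t)")
    case True
    have "{s\<in>{1..t}. \<not> cut s \<and> num s = Suc (num t)} = {}" using num_mono[of _ t] by fastforce
    then have "piece_weight (Suc (num t)) t = 0" unfolding piece_weight_def by (simp only: sum.empty)
    then show ?thesis using Suc True by (simp add: piece_weight_Suc acc_Suc del: acc.simps)
  next
    case False
    then have "acc t + step (Suc t) \<le> X" by (simp add: cut_def)
    then show ?thesis using Suc False by (auto simp: piece_weight_Suc acc_Suc simp del: acc.simps)
  qed
qed

lemma head_eq_if_num_eq:
  "1 \<le> s \<Longrightarrow> s \<le> t \<Longrightarrow> t \<le> n \<Longrightarrow> num s = num t \<Longrightarrow> head D (M ! s) = head D (M ! t)"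
proof (induction t)
  case (Suc t)
  show ?case
  proof (cases "s = Suc t")
    case False
    then have s: "s \<le> t" using Suc by simp
    then have "num s \<le> num t" by (rule num_mono)
    then have nc: "\<not> cut (Suc t)" "num s = num t" using Suc.prems(4) by (auto split: if_splits)
    then have "head D (M ! t) = head D (M ! Suc t)"
      using M_linked[of t] Suc.prems by (auto simp: linked_def cut_def)
    then show ?thesis using Suc s nc by auto
  qed simp
qed simp

abbreviation "inner_len p t \<equiv> \<Sum>s\<in>{1..t}. if inside p (M ! s) then step s else 0"

lemma inner_len_le: "inner_len p n \<le> 2 * key_mass n e D p"
proof -
  have "inner_len p n = path_sum delta (inside p) M"
    by (simp add: path_sum_conv_sum length_M step_def sum.atLeast1_atMost_eq cong: if_cong)
  also have "\<dots> \<le> (\<Sum>j<n. if inside p j then 2 * e j else 0)"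
    unfolding M_def by (rule path_sum_tour) simp
  also have "\<dots> = (\<Sum>j\<in>{j\<in>{..<n}. inside p j}. 2 * e j)"
    by (rule sum.inter_filter[symmetric]) simp
  also have "{j\<in>{..<n}. inside p j} = {i\<in>{..<n} - D. head D i = p}"
    by (auto simp: inside_def)
  finally show ?thesis by (simp add: key_mass_def sum_distrib_left)
qed

text \<open>A cut inside a component is paid for by the closed piece together with the step that was cut.\<close>

lemma cuts_le_inner_len:
  "t \<le> n \<Longrightarrow> X * card {s\<in>{1..t}. cut s \<and> inside p (M ! s)}
    + (if 1 \<le> t \<and> head D (M ! t) = p then acc t else 0) \<le> inner_len p t"
proof (induction t)
  case (Suc t)
  let ?C = "\<lambda>t. {s\<in>{1..t}. cut s \<and> inside p (M ! s)}"
  have C: "?C (Suc t) = (if cut (Suc t) \<and> inside p (M ! Suc t) then insert (Suc t) (?C t) else ?C t)"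
    by (auto simp: le_Suc_eq)
  have IH: "X * card (?C t) + (if 1 \<le> t \<and> head D (M ! t) = p then acc t else 0) \<le> inner_len p t"
    using Suc by simp
  show ?case
  proof (cases "M ! Suc t \<in> D")
    case True
    then have "cut (Suc t)" "\<not> inside p (M ! Suc t)" by (auto simp: cut_def inside_def)
    then show ?thesis using IH C acc_nonneg[of t] by (auto simp: acc_Suc simp del: acc.simps split: if_splits)
  next
    case False
    have t: "1 \<le> t" using False M_1 by (cases t) auto
    have h: "head D (M ! t) = head D (M ! Suc t)"
      using M_linked[of t] Suc.prems False by (auto simp: linked_def)
    show ?thesis
    proof (cases "head D (M ! Suc t) = p")
      case hp: True
      then have "inside p (M ! Suc t)" using False by (simp add: inside_def)
      moreover have "cut (Suc t) \<Longrightarrow> X < acc t + step (Suc t)" using False by (auto simp: cut_def)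
      ultimately show ?thesis using IH C h hp t
        by (cases "cut (Suc t)") (auto simp: acc_Suc algebra_simps simp del: acc.simps)
    next
      case hp: False
      then have "\<not> inside p (M ! Suc t)" by (simp add: inside_def)
      then show ?thesis using IH C h hp t by (auto simp del: acc.simps)
    qed
  qed
qed simp

text \<open>Besides the heads, pieces start only at cuts inside components. By
  \<open>cuts_le_inner_len\<close>, \<open>X\<close> times the number of these cuts in a component
  is at most twice its mass, so a component with twice its mass below \<open>X\<close> has
  none.\<close>

lemma many_pieces:
  "X * (real (num n) - card D) \<le> 2 * (\<Sum>i\<in>{i\<in>{..<n} - D. X \<le> 2 * key_mass n e D (head D i)}. e i)"
proof -
  let ?Z = "{s\<in>{1..n}. cut s \<and> M ! s \<notin> D}"
  have finD: "finite D" using D_sub finite_subset by blast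
  have "{s\<in>{1..n}. cut s} = {s\<in>{1..n}. M ! s \<in> D} \<union> ?Z" by (auto simp: cut_def)
  then have "num n = card ({s\<in>{1..n}. M ! s \<in> D} \<union> ?Z)" by (simp add: num_conv_card)
  also have "\<dots> = card {s\<in>{1..n}. M ! s \<in> D} + card ?Z"
    by (rule card_Un_disjoint) auto
  also have "card {s\<in>{1..n}. M ! s \<in> D} = card D"
  proof (rule bij_betw_same_card)
    have "(\<lambda>t. M ! t) ` {s\<in>{1..n}. M ! s \<in> D} = D"
    proof
      show "D \<subseteq> (\<lambda>t. M ! t) ` {s\<in>{1..n}. M ! s \<in> D}"
      proof
        fix p assume p: "p \<in> D"
        then have "p \<in> (\<lambda>t. M ! t) ` {1..n}" using bij_M D_sub by (auto simp: bij_betw_def)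
        then show "p \<in> (\<lambda>t. M ! t) ` {s\<in>{1..n}. M ! s \<in> D}" using p by auto
      qed
    qed auto
    moreover have "inj_on (\<lambda>t. M ! t) {s\<in>{1..n}. M ! s \<in> D}"
      by (rule inj_on_subset[OF bij_betw_imp_inj_on[OF bij_M]]) auto
    ultimately show "bij_betw (\<lambda>t. M ! t) {s\<in>{1..n}. M ! s \<in> D} D"
      by (simp add: bij_betw_def)
  qed
  finally have "X * (real (num n) - card D) = X * real (card ?Z)" by simp
  also have "card ?Z = (\<Sum>p\<in>D. card {s\<in>?Z. head D (M ! s) = p})"
    unfolding card_eq_sum
    by (rule sum.group[symmetric]) (use finD head_mem[OF D_0] in auto)
  also have "X * real \<dots> = (\<Sum>p\<in>D. X * card {s\<in>{1..n}. cut s \<and> inside p (M ! s)})"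
    by (simp add: sum_distrib_left inside_def conj_ac)
  also have "\<dots> \<le> (\<Sum>p\<in>D. if X \<le> 2 * key_mass n e D p then 2 * key_mass n e D p else 0)"
  proof (rule sum_mono)
    fix p assume "p \<in> D"
    define c where "c = card {s\<in>{1..n}. cut s \<and> inside p (M ! s)}"
    have "0 \<le> (if 1 \<le> n \<and> head D (M ! n) = p then acc n else 0)" by (simp add: acc_nonneg)
    then have Xc: "X * c \<le> 2 * key_mass n e D p"
      using cuts_le_inner_len[of n p] inner_len_le[of p] unfolding c_def by linarith
    show "X * c \<le> (if X \<le> 2 * key_mass n e D p then 2 * key_mass n e D p else 0)"
    proof (cases "c = 0")
      case False
      then have "X * 1 \<le> X * c" using X_nonneg by (intro mult_left_mono) auto
      then show ?thesis using Xc by auto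
    next
      case True
      have "0 \<le> key_mass n e D p" unfolding key_mass_def by (intro sum_nonneg) (auto intro: e_nonneg)
      then show ?thesis using True by simp
    qed
  qed
  also have "\<dots> = 2 * (\<Sum>p\<in>{p\<in>D. X \<le> 2 * key_mass n e D p}. key_mass n e D p)"
    using finD by (simp add: sum.inter_filter[symmetric] sum_distrib_left)
  finally show ?thesis by (simp add: sum_mass_heads)
qed

lemma piece_weight_le_inner_len:
  assumes s: "1 \<le> s" "s \<le> n"
  shows "piece_weight (num s) n \<le> inner_len (head D (M ! s)) n"
proof -
  have "inside (head D (M ! s)) (M ! t)" if "t \<in> {t\<in>{1..n}. \<not> cut t \<and> num t = num s}" for t
  proof -
    have t: "1 \<le> t" "t \<le> n" "num t = num s" "M ! t \<notin> D" using that by (auto simp: cut_def)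
    have "head D (M ! t) = head D (M ! s)"
    proof (cases "s \<le> t")
      case True
      show ?thesis by (rule head_eq_if_num_eq[symmetric]) (use True t s in auto)
    next
      case False
      show ?thesis by (rule head_eq_if_num_eq) (use False t s in auto)
    qed
    then show ?thesis using t(4) by (simp add: inside_def)
  qed
  then have "piece_weight (num s) n \<le> sum step {t\<in>{1..n}. inside (head D (M ! s)) (M ! t)}"
    unfolding piece_weight_def by (intro sum_mono2) (auto simp: step_nonneg)
  then show ?thesis by (simp add: sum.inter_filter[symmetric])
qed

text \<open>A piece stays in the tour of one component, so a piece heavier than
  \<open>2 * \<theta>\<close> lies in a component of mass above \<theta>; all pieces there together
  weigh at most that tour.\<close>

lemma sum_heavy_pieces:
  "(\<Sum>j\<in>{j\<in>{1..num n}. 2 * \<theta> < piece_weight j n}. piece_weight j n)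
    \<le> 2 * (\<Sum>i\<in>{i\<in>{..<n} - D. \<theta> \<le> key_mass n e D (head D i)}. e i)"
proof -
  have finD: "finite D" using D_sub finite_subset by blast
  let ?J = "{j\<in>{1..num n}. 2 * \<theta> < piece_weight j n}"
  let ?S = "{s\<in>{1..n}. \<not> cut s \<and> 2 * \<theta> < piece_weight (num s) n}"
  let ?H = "{p\<in>D. \<theta> \<le> key_mass n e D p}"
  have num1: "1 \<le> num s" if "1 \<le> s" for s using num_mono[OF that] cut_1 by simp
  have "(\<Sum>j\<in>?J. piece_weight j n) = (\<Sum>j\<in>?J. sum step {s\<in>?S. num s = j})"
  proof (rule sum.cong[OF refl])
    fix j assume "j \<in> ?J"
    then have "{s\<in>{1..n}. \<not> cut s \<and> num s = j} = {s\<in>?S. num s = j}" by auto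
    then show "piece_weight j n = sum step {s\<in>?S. num s = j}" unfolding piece_weight_def[of j] by simp
  qed
  also have "\<dots> = sum step ?S"
  proof (rule sum.group)
    show "num ` ?S \<subseteq> ?J"
    proof (rule image_subsetI)
      fix s assume "s \<in> ?S"
      then show "num s \<in> ?J" using num1[of s] num_mono[of s n] by simp
    qed
  qed simp_all
  also have "\<dots> \<le> sum step {s\<in>{1..n}. M ! s \<notin> D \<and> head D (M ! s) \<in> ?H}"
  proof (rule sum_mono2)
    show "?S \<subseteq> {s\<in>{1..n}. M ! s \<notin> D \<and> head D (M ! s) \<in> ?H}"
    proof
      fix s assume s: "s \<in> ?S"
      then have "2 * \<theta> < 2 * key_mass n e D (head D (M ! s))"
        using piece_weight_le_inner_len[of s] inner_len_le[of "head D (M ! s)"] by auto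
      then show "s \<in> {s\<in>{1..n}. M ! s \<notin> D \<and> head D (M ! s) \<in> ?H}"
        using s head_mem[OF D_0] by (auto simp: cut_def)
    qed
  qed (auto simp: step_nonneg)
  also have "\<dots> = (\<Sum>p\<in>?H. sum step {s\<in>{s\<in>{1..n}. M ! s \<notin> D \<and> head D (M ! s) \<in> ?H}. head D (M ! s) = p})"
    using finD by (intro sum.group[symmetric]) auto
  also have "\<dots> = (\<Sum>p\<in>?H. inner_len p n)"
  proof (rule sum.cong[OF refl])
    fix p assume "p \<in> ?H"
    then have "{s\<in>{s\<in>{1..n}. M ! s \<notin> D \<and> head D (M ! s) \<in> ?H}. head D (M ! s) = p}
        = {s\<in>{1..n}. inside p (M ! s)}"
      by (auto simp: inside_def)
    then show "sum step {s\<in>{s\<in>{1..n}. M ! s \<notin> D \<and> head D (M ! s) \<in> ?H}. head D (M ! s) = p}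
        = inner_len p n"
      using sum.inter_filter[of "{1..n}" step "\<lambda>s. inside p (M ! s)"] by simp
  qed
  also have "\<dots> \<le> (\<Sum>p\<in>?H. 2 * key_mass n e D p)"
    by (intro sum_mono inner_len_le)
  also have "\<dots> = 2 * (\<Sum>p\<in>?H. key_mass n e D p)" by (simp add: sum_distrib_left)
  finally show ?thesis by (simp add: sum_mass_heads)
qed

end


section \<open>The search for a scale\<close>

context prim_order
begin

text \<open>Ties are won by the larger index; this keeps the parent of a point in the component of the point.\<close>

definition beats :: "nat \<Rightarrow> nat \<Rightarrow> bool" where
  "beats j i \<longleftrightarrow> i \<noteq> 0 \<and> (j = 0 \<or> e i < e j \<or> e i = e j \<and> i < j)"

section \<open>Ranking the keys\<close>

definition rk :: "nat \<Rightarrow> nat" where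
  "rk i = card {j\<in>{..<n}. beats j i}"

definition rk_inv :: "nat \<Rightarrow> nat" where
  "rk_inv = the_inv_into {..<n} rk"

definition top_ranked :: "nat \<Rightarrow> nat set" where
  "top_ranked q = {i\<in>{..<n}. rk i < q}"

lemma beats_trans: "beats i j \<Longrightarrow> beats j l \<Longrightarrow> beats i l"
  by (auto simp: beats_def)

lemma rk_less:
  assumes "i < n" "j < n" "beats i j"
  shows "rk i < rk j"
  unfolding rk_def
proof (rule psubset_card_mono)
  have "{l\<in>{..<n}. beats l i} \<subseteq> {l\<in>{..<n}. beats l j}"
    using beats_trans[OF _ assms(3)] by blast
  moreover have "i \<in> {l\<in>{..<n}. beats l j} - {l\<in>{..<n}. beats l i}"
    using assms by (auto simp: beats_def)
  ultimately show "{l\<in>{..<n}. beats l i} \<subset> {l\<in>{..<n}. beats l j}" by blast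
qed simp

lemma beats_total: "i \<noteq> j \<Longrightarrow> beats i j \<or> beats j i"
  by (auto simp: beats_def)

lemma beats_iff:
  assumes "i < n" "j < n"
  shows "beats i j \<longleftrightarrow> rk i < rk j"
proof
  assume "rk i < rk j"
  then show "beats i j" using rk_less[of j i] beats_total[of i j] assms by force
qed (use rk_less[OF assms] in blast)

lemma bij_rk: "bij_betw rk {..<n} {..<n}"
proof -
  have inj: "inj_on rk {..<n}"
  proof (rule inj_onI)
    fix i j assume "i \<in> {..<n}" "j \<in> {..<n}" "rk i = rk j"
    then show "i = j" using rk_less[of i j] rk_less[of j i] beats_total[of i j] by force
  qed
  have "rk i < n" if "i < n" for i
  proof -
    have "i \<notin> {j\<in>{..<n}. beats j i}" by (auto simp: beats_def)
    then have "{j\<in>{..<n}. beats j i} \<subset> {..<n}" using that by blast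
    then have "card {j\<in>{..<n}. beats j i} < card {..<n}" by (intro psubset_card_mono) auto
    then show ?thesis by (simp add: rk_def)
  qed
  then have "rk ` {..<n} = {..<n}" using inj by (intro endo_inj_surj) auto
  then show ?thesis using inj by (simp add: bij_betw_def)
qed

lemma rk_0: "rk 0 = 0"
  by (simp add: rk_def beats_def)

lemma rk_inv: "m < n \<Longrightarrow> rk_inv m < n \<and> rk (rk_inv m) = m"
  using bij_rk the_inv_into_into[of rk "{..<n}" m "{..<n}"] f_the_inv_into_f[of rk "{..<n}" m]
  by (auto simp: rk_inv_def bij_betw_def)

lemma rk_inv_rk: "i < n \<Longrightarrow> rk_inv (rk i) = i"
  using bij_rk by (auto simp: rk_inv_def bij_betw_def the_inv_into_f_f)

lemma rk_inv_pos: "0 < m \<Longrightarrow> m < n \<Longrightarrow> 0 < rk_inv m"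
  using rk_inv[of m] rk_0 by (cases "rk_inv m = 0") auto

lemma card_top: "q \<le> n \<Longrightarrow> card (top_ranked q) = q"
proof -
  assume q: "q \<le> n"
  have "rk ` top_ranked q = {..<q}"
  proof
    show "{..<q} \<subseteq> rk ` top_ranked q"
    proof
      fix m assume "m \<in> {..<q}"
      then have "rk_inv m \<in> top_ranked q" "rk (rk_inv m) = m" using rk_inv[of m] q by (auto simp: top_ranked_def)
      then show "m \<in> rk ` top_ranked q" by (metis image_eqI)
    qed
  qed (auto simp: top_ranked_def)
  moreover have "inj_on rk (top_ranked q)"
    by (rule inj_on_subset[OF bij_betw_imp_inj_on[OF bij_rk]]) (auto simp: top_ranked_def)
  ultimately show ?thesis by (metis card_image card_lessThan)
qed

lemma key_mono: "i < n \<Longrightarrow> j < n \<Longrightarrow> 0 < i \<Longrightarrow> rk i \<le> rk j \<Longrightarrow> e j \<le> e i"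
proof -
  assume a: "i < n" "j < n" "0 < i" "rk i \<le> rk j"
  show ?thesis
  proof (cases "i = j")
    case False
    then have "rk i \<noteq> rk j" using rk_inv_rk a by metis
    then have "beats i j" using beats_iff a by simp
    then show ?thesis using a by (auto simp: beats_def)
  qed simp
qed

text \<open>The parent edge of a non-head \<open>i\<close> cannot jump over its head
  \<open>h\<close>: the cut rule would give \<open>e h \<le> e i\<close> with \<open>h < i\<close>,
  so \<open>i\<close> would beat \<open>h\<close>, if necessary by the tie rule, and would be a head
  before it.\<close>

lemma prim_cut_top:
  assumes "0 < q" "0 \<le> X"
  shows "prim_cut n d vx pa e (top_ranked q) X"
proof (unfold_locales)
  show 0: "0 \<in> top_ranked q" using assms n_pos rk_0 by (simp add: top_ranked_def)
  show "top_ranked q \<subseteq> {..<n}" by (auto simp: top_ranked_def)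
  show "head (top_ranked q) (pa i) = head (top_ranked q) i" if i: "i < n" "i \<notin> top_ranked q" for i
  proof -
    define h where "h = head (top_ranked q) i"
    have h: "h \<in> top_ranked q" "h \<le> i" using head_mem[OF 0] by (auto simp: h_def)
    have hi: "h < i" using h i by (cases "h = i") auto
    have p: "pa i < i" "e i = d (vx (pa i)) (vx i)" using pa[of i] hi i by auto
    have "h \<le> pa i"
    proof (rule ccontr)
      assume "\<not> h \<le> pa i"
      then have "e h \<le> e i" using cut_rule[of "pa i" h i] h i p by simp
      moreover have "beats h i" using beats_iff[of h i] h i by (auto simp: top_ranked_def)
      ultimately show False using \<open>\<not> h \<le> pa i\<close> hi by (auto simp: beats_def)
    qed
    then show ?thesis
      unfolding h_def[symmetric] using h p head_ge[of _ "top_ranked q" i]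
      by (intro head_eqI) (auto simp: h_def)
  qed
qed (use assms in auto)

section \<open>The invariant of the search and the final norm estimate\<close>

definition pieces :: "nat \<Rightarrow> real \<Rightarrow> nat" where
  "pieces q X = prim_cut.num n d vx pa (top_ranked q) X n"

text \<open>The last conjunct says that the \<open>k - q\<close> additional pieces are paid for by heavy components.\<close>

definition search_inv :: "nat \<Rightarrow> nat \<Rightarrow> real \<Rightarrow> bool" where
  "search_inv k q \<rho> \<longleftrightarrow> 0 < q \<and> q \<le> k \<and> q < n \<and> e (rk_inv q) \<le> \<rho> \<and> (1 < q \<longrightarrow> \<rho> \<le> e (rk_inv (q - 1)))
    \<and> 8 * (real k - q) * \<rho> \<le> (\<Sum>i\<in>{i\<in>{..<n} - top_ranked q. 2 * \<rho> \<le> key_mass n e (top_ranked q) (head (top_ranked q) i)}. e i)"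

lemma search_inv_pos: "search_inv k q \<rho> \<Longrightarrow> 0 < \<rho>"
  using e_pos[of "rk_inv q"] rk_inv[of q] rk_inv_pos[of q] by (auto simp: search_inv_def)

lemma search_inv_separates:
  assumes "search_inv k q \<rho>"
  shows "key_separates n e (top_ranked q) \<rho>"
proof -
  have s: "0 < q" "q < n" "e (rk_inv q) \<le> \<rho>" "1 < q \<Longrightarrow> \<rho> \<le> e (rk_inv (q - 1))"
    using assms by (auto simp: search_inv_def)
  have "\<rho> \<le> e i" if "i \<in> top_ranked q - {0}" for i
  proof -
    have i: "i < n" "0 < i" "rk i < q" using that by (auto simp: top_ranked_def)
    then have "rk i \<noteq> 0" using rk_inv_rk rk_0 n_pos by (metis less_irrefl)
    then have "1 < q" using i by simp
    moreover have "e (rk_inv (q - 1)) \<le> e i" using i s rk_inv[of "q - 1"] by (intro key_mono) auto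
    ultimately show ?thesis using s by simp
  qed
  moreover have "e i \<le> \<rho>" if "i \<in> {..<n} - top_ranked q" for i
  proof -
    have "e i \<le> e (rk_inv q)" using that rk_inv[of q] rk_inv_pos[of q] s by (intro key_mono) (auto simp: top_ranked_def)
    then show ?thesis using s by simp
  qed
  ultimately show ?thesis
    using n_pos rk_0 s by (auto simp: key_separates_def top_ranked_def)
qed

lemma search_inv_init:
  assumes "0 < k" "k < n"
  shows "search_inv k k (e (rk_inv k))"
  using assms rk_inv[of k] rk_inv[of "k - 1"] rk_inv_pos[of "k - 1"] e_nonneg
  by (auto simp: search_inv_def intro!: sum_nonneg key_mono)

text \<open>This is \<open>many_pieces\<close> for the cut length \<open>32 * \<rho>\<close>. More
  than \<open>k\<close> pieces means at least \<open>k + 1\<close>; the extra 1 is used up when an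
  edge is restored.\<close>

lemma infeasible:
  assumes inv: "search_inv k q \<rho>" and m: "k < pieces q (32 * \<rho>)"
  shows "16 * \<rho> * (real k + 1 - q)
    \<le> (\<Sum>i\<in>{i\<in>{..<n} - top_ranked q. 16 * \<rho> \<le> key_mass n e (top_ranked q) (head (top_ranked q) i)}. e i)"
proof -
  have q: "0 < q" "q < n" using inv by (auto simp: search_inv_def)
  interpret prim_cut n d vx pa e "top_ranked q" "32 * \<rho>"
    using search_inv_pos[OF inv] q by (intro prim_cut_top) auto
  have "32 * \<rho> * (real k + 1 - q) \<le> 32 * \<rho> * (real (num n) - card (top_ranked q))"
    using m search_inv_pos[OF inv] q by (intro mult_left_mono) (auto simp: pieces_def card_top)
  also note many_pieces
  finally show ?thesis by simp
qed

lemma search_inv_double: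
  assumes inv: "search_inv k q \<rho>" and m: "k < pieces q (32 * \<rho>)"
    and le: "1 < q \<Longrightarrow> 2 * \<rho> \<le> e (rk_inv (q - 1))"
  shows "search_inv k q (2 * \<rho>)"
proof -
  have s: "0 < q" "q \<le> k" "q < n" "e (rk_inv q) \<le> \<rho>" using inv by (auto simp: search_inv_def)
  have pos: "0 < \<rho>" by (rule search_inv_pos[OF inv])
  have "8 * (real k - q) * (2 * \<rho>) \<le> 16 * \<rho> * (real k + 1 - q)" using pos by (simp add: algebra_simps)
  also note infeasible[OF inv m]
  also have "sum e {i\<in>{..<n} - top_ranked q. 16 * \<rho> \<le> key_mass n e (top_ranked q) (head (top_ranked q) i)}
      \<le> sum e {i\<in>{..<n} - top_ranked q. 2 * (2 * \<rho>) \<le> key_mass n e (top_ranked q) (head (top_ranked q) i)}"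
    using pos by (intro sum_mono2) (auto intro: e_nonneg)
  finally show ?thesis using s le pos by (simp add: search_inv_def)
qed

lemma search_inv_merge:
  assumes inv: "search_inv k q \<rho>" and m: "k < pieces q (32 * \<rho>)"
    and q: "1 < q" and le: "e (rk_inv (q - 1)) < 2 * \<rho>"
  shows "search_inv k (q - 1) (e (rk_inv (q - 1)))"
proof -
  define \<sigma> where "\<sigma> = e (rk_inv (q - 1))"
  have s: "0 < q" "q \<le> k" "q < n" "e (rk_inv q) \<le> \<rho>" using inv by (auto simp: search_inv_def)
  have pos: "0 < \<rho>" by (rule search_inv_pos[OF inv])
  have 0: "0 \<in> top_ranked (q - 1)" using q n_pos rk_0 by (simp add: top_ranked_def)
  have sub: "top_ranked (q - 1) \<subseteq> top_ranked q" by (auto simp: top_ranked_def)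
  \<comment> \<open>Restoring an edge raises \<open>k - q\<close> to \<open>k + 1 - q\<close>, while
    the new scale stays below \<open>2 * \<rho>\<close>; the bound of \<open>infeasible\<close>
    covers exactly this.\<close>
  have "8 * (real k - real (q - 1)) * \<sigma> \<le> 8 * (real k + 1 - q) * (2 * \<rho>)"
    using le s q e_nonneg rk_inv[of "q - 1"] by (intro mult_mono) (auto simp: \<sigma>_def of_nat_diff)
  also have "\<dots> = 16 * \<rho> * (real k + 1 - q)" by simp
  also note infeasible[OF inv m]
  also have "sum e {i\<in>{..<n} - top_ranked q. 16 * \<rho> \<le> key_mass n e (top_ranked q) (head (top_ranked q) i)}
      \<le> sum e {i\<in>{..<n} - top_ranked (q - 1). 2 * \<sigma> \<le> key_mass n e (top_ranked (q - 1)) (head (top_ranked (q - 1)) i)}"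
  proof (rule sum_mono2)
    \<comment> \<open>With fewer heads components only grow, so heavy ones stay heavy.\<close>
    have "key_mass n e (top_ranked q) (head (top_ranked q) i) \<le> key_mass n e (top_ranked (q - 1)) (head (top_ranked (q - 1)) i)" for i
      unfolding key_mass_def
    proof (rule sum_mono2)
      have "head (top_ranked (q - 1)) j = head (top_ranked (q - 1)) i" if "head (top_ranked q) j = head (top_ranked q) i" for j
        using that head_head[OF 0 sub, of i] head_head[OF 0 sub, of j] by simp
      then show "{j\<in>{..<n} - top_ranked q. head (top_ranked q) j = head (top_ranked q) i}
          \<subseteq> {j\<in>{..<n} - top_ranked (q - 1). head (top_ranked (q - 1)) j = head (top_ranked (q - 1)) i}"
        using sub by blast
    qed (auto intro: e_nonneg)
    then have "2 * \<sigma> \<le> key_mass n e (top_ranked (q - 1)) (head (top_ranked (q - 1)) i)"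
      if "16 * \<rho> \<le> key_mass n e (top_ranked q) (head (top_ranked q) i)" for i
      using that le pos order_trans[of "16 * \<rho>" "key_mass n e (top_ranked q) (head (top_ranked q) i)"] unfolding \<sigma>_def
      by (smt (verit))
    then show "{i\<in>{..<n} - top_ranked q. 16 * \<rho> \<le> key_mass n e (top_ranked q) (head (top_ranked q) i)}
        \<subseteq> {i\<in>{..<n} - top_ranked (q - 1). 2 * \<sigma> \<le> key_mass n e (top_ranked (q - 1)) (head (top_ranked (q - 1)) i)}"
      using sub by blast
  qed (auto intro: e_nonneg)
  finally show ?thesis
    unfolding search_inv_def \<sigma>_def[symmetric]
    using s q rk_inv[of "q - 1"] rk_inv[of "q - 1 - 1"] rk_inv_pos[of "q - 1 - 1"]
    by (auto simp: \<sigma>_def intro!: key_mono)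
qed

text \<open>All remaining keys are at most \<open>e (rk_inv q)\<close>, so a failed scale satisfies
  \<open>16 * \<rho> \<le> n * e (rk_inv q)\<close>. Doubling starts from that very key and
  therefore stops soon.\<close>

lemma doubling_bound:
  assumes inv: "search_inv k q \<rho>" and m: "k < pieces q (32 * \<rho>)" and a: "\<rho> = 2 ^ a * e (rk_inv q)"
  shows "a < n"
proof -
  have s: "0 < q" "q \<le> k" "q < n" using inv by (auto simp: search_inv_def)
  have en: "0 < e (rk_inv q)" using e_pos rk_inv[of q] rk_inv_pos[of q] s by auto
  have pos: "0 < \<rho>" by (rule search_inv_pos[OF inv])
  have "16 * \<rho> * 1 \<le> 16 * \<rho> * (real k + 1 - q)"
    using s pos by (intro mult_left_mono) auto
  also note infeasible[OF inv m]
  also have "sum e {i\<in>{..<n} - top_ranked q. 16 * \<rho> \<le> key_mass n e (top_ranked q) (head (top_ranked q) i)} \<le> sum e ({..<n} - top_ranked q)"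
    by (intro sum_mono2) (auto intro: e_nonneg)
  also have "\<dots> \<le> (\<Sum>i\<in>{..<n} - top_ranked q. e (rk_inv q))"
    using rk_inv[of q] rk_inv_pos[of q] s by (intro sum_mono key_mono) (auto simp: top_ranked_def)
  also have "\<dots> \<le> n * e (rk_inv q)"
    using en card_mono[of "{..<n}" "{..<n} - top_ranked q"] by simp
  finally have "16 * 2 ^ a * e (rk_inv q) \<le> n * e (rk_inv q)" using a by simp
  then have "16 * 2 ^ a \<le> real n" using en by simp
  moreover have "real a < 2 ^ a" by (rule of_nat_less_two_power)
  ultimately have "real a < real n" by linarith
  then show ?thesis by simp
qed

lemma approximation:
  assumes inv: "search_inv k q \<rho>" and m: "pieces q (32 * \<rho>) \<le> k"
    and Ts: "tree_cover {..<n} k Ts" and p: "1 \<le> p"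
  shows "(\<Sum>j\<in>{1..pieces q (32 * \<rho>)}. prim_cut.piece_weight n d vx pa (top_ranked q) (32 * \<rho>) j n powr p) powr (1 / p)
    \<le> 64 * lp_cost p d Ts"
proof -
  have s: "0 < q" "q \<le> k" "q < n" using inv by (auto simp: search_inv_def)
  have pos: "0 < \<rho>" by (rule search_inv_pos[OF inv])
  interpret prim_cut n d vx pa e "top_ranked q" "32 * \<rho>"
    using pos s by (intro prim_cut_top) auto
  interpret key_cover n k e "\<lambda>j. {i\<in>{..<n}. vx i \<in> fst (Ts ! j)}" "\<lambda>j. weight d (Ts ! j)"
    by (rule key_cover[OF Ts])
  have len: "length Ts = k" using Ts by (simp add: tree_cover_def)
  have "(\<Sum>j\<in>{1..num n}. piece_weight j n powr p) powr (1 / p)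
    \<le> 2 * 32 * (\<Sum>j\<in>{..<k}. weight d (Ts ! j) powr p) powr (1 / p)"
  proof (rule lp_norm_domination)
    show "0 \<le> piece_weight j n" for j
      unfolding piece_weight_def by (intro sum_nonneg) (simp add: step_nonneg)
    show "0 \<le> weight d (Ts ! j)" if "j \<in> {..<k}" for j using that cost_nonneg by simp
    fix r :: real assume r: "0 < r"
    show "(\<Sum>j\<in>{j\<in>{1..num n}. 32 * r < piece_weight j n}. piece_weight j n)
      \<le> 38 * (\<Sum>j\<in>{j\<in>{..<k}. r \<le> weight d (Ts ! j)}. weight d (Ts ! j))"
    proof (cases "r < \<rho>")
      case True
      have "(\<Sum>j\<in>{j\<in>{1..num n}. 2 * (16 * r) < piece_weight j n}. piece_weight j n)
          \<le> 2 * (\<Sum>i\<in>{i\<in>{..<n} - top_ranked q. 16 * r \<le> key_mass n e (top_ranked q) (head (top_ranked q) i)}. e i)"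
        by (rule sum_heavy_pieces)
      \<comment> \<open>The mass threshold is relaxed to the value \<open>2 * r\<close> at which the
        lower bound is available.\<close>
      also have "\<dots> \<le> 2 * (\<Sum>i\<in>{i\<in>{..<n} - top_ranked q. 2 * r \<le> key_mass n e (top_ranked q) (head (top_ranked q) i)}. e i)"
        using r by (intro mult_left_mono sum_mono2) (auto intro: e_nonneg)
      also have "(\<Sum>i\<in>{i\<in>{..<n} - top_ranked q. 2 * r \<le> key_mass n e (top_ranked q) (head (top_ranked q) i)}. e i) \<le> 19 * heavy r"
        using inv s True r search_inv_separates[OF inv]
        by (intro component_keys_le[of "top_ranked q" \<rho>]) (auto simp: card_top search_inv_def)
      finally show ?thesis by (simp add: heavy_def)
    next
      case False
      have "piece_weight j n \<le> 32 * r" for j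
        using False piece_weight_le_X[of j n] by linarith
      then have "{j\<in>{1..num n}. 32 * r < piece_weight j n} = {}" by (auto simp: not_less)
      then show ?thesis using heavy_nonneg[of r] by (simp only: sum.empty heavy_def)
    qed
  qed (use p in auto)
  then show ?thesis by (simp add: lp_cost_def len pieces_def)
qed

end


section \<open>Program logic\<close>

text \<open>A cost bound read off the syntax: every loop is granted \<open>Suc z * Suc z\<close>
  rounds, so the bound is polynomial for any program and only iteration counts remain to be proved.
  The square serves the search loop. Branches are added because a maximum of polynomials need not be
  a polynomial.\<close>

primrec wc :: "nat \<Rightarrow> com \<Rightarrow> nat" where
  "wc z Skip = 1"
| "wc z (IAssign x es e) = Suc (sum_list (map icost es) + icost e)"
| "wc z (RAssign x es e) = Suc (sum_list (map icost es) + rcost e)"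
| "wc z (Seq c1 c2) = wc z c1 + wc z c2"
| "wc z (If b c1 c2) = Suc (bcost b + (wc z c1 + wc z c2))"
| "wc z (While b c) = (Suc z * Suc z) * (Suc (bcost b) + wc z c) + Suc (bcost b)"

lemma wc_polynomial: "\<exists>q. \<forall>z. wc z c = poly q z"
proof (induction c)
  case (Seq c1 c2)
  then obtain q1 q2 where "\<forall>z. wc z c1 = poly q1 z" "\<forall>z. wc z c2 = poly q2 z" by blast
  then show ?case by (intro exI[of _ "q1 + q2"]) simp
next
  case (If b c1 c2)
  then obtain q1 q2 where "\<forall>z. wc z c1 = poly q1 z" "\<forall>z. wc z c2 = poly q2 z" by blast
  then show ?case by (intro exI[of _ "[:Suc (bcost b):] + q1 + q2"]) simp
next
  case (While b c)
  then obtain q where "\<forall>z. wc z c = poly q z" by blast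
  then show ?case
    by (intro exI[of _ "[:1, 1:] * [:1, 1:] * ([:Suc (bcost b):] + q) + [:Suc (bcost b):]"]) (simp add: algebra_simps)
next
  case Skip
  show ?case by (intro exI[of _ "[:1:]"]) simp
next
  case (IAssign x es e)
  show ?case by (intro exI[of _ "[:Suc (sum_list (map icost es) + icost e):]"]) simp
next
  case (RAssign x es e)
  show ?case by (intro exI[of _ "[:Suc (sum_list (map icost es) + rcost e):]"]) simp
qed

primrec iwrites :: "com \<Rightarrow> vname set" where
  "iwrites Skip = {}"
| "iwrites (IAssign x es e) = {x}"
| "iwrites (RAssign x es e) = {}"
| "iwrites (Seq c1 c2) = iwrites c1 \<union> iwrites c2"
| "iwrites (If b c1 c2) = iwrites c1 \<union> iwrites c2"
| "iwrites (While b c) = iwrites c"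

primrec rwrites :: "com \<Rightarrow> vname set" where
  "rwrites Skip = {}"
| "rwrites (IAssign x es e) = {}"
| "rwrites (RAssign x es e) = {x}"
| "rwrites (Seq c1 c2) = rwrites c1 \<union> rwrites c2"
| "rwrites (If b c1 c2) = rwrites c1 \<union> rwrites c2"
| "rwrites (While b c) = rwrites c"

text \<open>Frame condition; with the syntactic write sets it spares invariants any mention of
  untouched variables.\<close>

definition same :: "vname set \<Rightarrow> vname set \<Rightarrow> state \<Rightarrow> state \<Rightarrow> bool" where
  "same A B s s' \<longleftrightarrow> (\<forall>x. x \<notin> A \<longrightarrow> fst s' x = fst s x) \<and> (\<forall>x. x \<notin> B \<longrightarrow> snd s' x = snd s x)"

lemma same_trans: "same A B s s' \<Longrightarrow> same A B s' s'' \<Longrightarrow> same A B s s''"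
  by (simp add: same_def)

lemma same_mono: "same A B s s' \<Longrightarrow> A \<subseteq> A' \<Longrightarrow> B \<subseteq> B' \<Longrightarrow> same A' B' s s'"
  by (auto simp: same_def)

lemma same_fst: "same A B s s' \<Longrightarrow> x \<notin> A \<Longrightarrow> fst s' x = fst s x"
  by (simp add: same_def)

lemma same_snd: "same A B s s' \<Longrightarrow> x \<notin> B \<Longrightarrow> snd s' x = snd s x"
  by (simp add: same_def)

lemma exec_same: "exec c s t s' \<Longrightarrow> same (iwrites c) (rwrites c) s s'"
  by (induction rule: exec.induct) (auto simp: same_def upd_def)

definition ok :: "nat \<Rightarrow> com \<Rightarrow> state \<Rightarrow> (state \<Rightarrow> bool) \<Rightarrow> bool" where
  "ok z c s P \<longleftrightarrow> (\<exists>t s'. exec c s t s' \<and> t \<le> wc z c \<and> P s')"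

lemma ok_mono: "ok z c s P \<Longrightarrow> (\<And>s'. P s' \<Longrightarrow> same (iwrites c) (rwrites c) s s' \<Longrightarrow> Q s') \<Longrightarrow> ok z c s Q"
  unfolding ok_def using exec_same by blast

lemma ok_Skip: "P s \<Longrightarrow> ok z Skip s P"
  unfolding ok_def by (metis exec.Skip order_refl wc.simps(1))

lemma ok_IAssign: "P (upd (fst s) x (map (ival s) es) (ival s e), snd s) \<Longrightarrow> ok z (IAssign x es e) s P"
  unfolding ok_def by (metis exec.IAssign order_refl wc.simps(2))

lemma ok_RAssign: "P (fst s, upd (snd s) x (map (ival s) es) (rval s e)) \<Longrightarrow> ok z (RAssign x es e) s P"
  unfolding ok_def by (metis exec.RAssign order_refl wc.simps(3))

lemma ok_Seq: "ok z c1 s (\<lambda>s'. ok z c2 s' P) \<Longrightarrow> ok z (Seq c1 c2) s P"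
  unfolding ok_def wc.simps by (meson add_mono exec.Seq)

lemma ok_If: "(bval s b \<Longrightarrow> ok z c1 s P) \<Longrightarrow> (\<not> bval s b \<Longrightarrow> ok z c2 s P) \<Longrightarrow> ok z (If b c1 c2) s P"
  unfolding ok_def wc.simps
  by (cases "bval s b") (fastforce intro: exec.IfTrue exec.IfFalse)+

text \<open>The invariant is indexed by the number of completed rounds, so a bound on the index
  bounds the cost.\<close>

lemma ok_While:
  assumes init: "P 0 s"
    and step: "\<And>j s. P j s \<Longrightarrow> bval s b \<Longrightarrow> j < Suc z * Suc z \<and> ok z c s (P (Suc j))"
  shows "ok z (While b c) s (\<lambda>s'. \<not> bval s' b \<and> (\<exists>j. P j s'))"
proof -
  have "\<exists>t s'. exec (While b c) s t s' \<and> t \<le> m * (Suc (bcost b) + wc z c) + Suc (bcost b)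
      \<and> \<not> bval s' b \<and> (\<exists>j. P j s')"
    if "P j s" "m = Suc z * Suc z - j" for m j s
    using that
  proof (induction m arbitrary: j s)
    case 0
    then have "\<not> bval s b" using step[of j s] by auto
    then show ?case using exec.WhileFalse[of s b c] 0 by fastforce
  next
    case (Suc m)
    show ?case
    proof (cases "bval s b")
      case True
      then obtain t s' where t: "exec c s t s'" "t \<le> wc z c" "P (Suc j) s'"
        using step[OF Suc.prems(1)] by (auto simp: ok_def)
      moreover have "m = Suc z * Suc z - Suc j" using Suc.prems(2) by simp
      ultimately obtain t' s'' where t': "exec (While b c) s' t' s''"
        "t' \<le> m * (Suc (bcost b) + wc z c) + Suc (bcost b)" "\<not> bval s'' b" "\<exists>j. P j s''"
        using Suc.IH[of "Suc j" s'] by blast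
      have "exec (While b c) s (Suc (bcost b + t + t')) s''"
        by (rule exec.WhileTrue[OF True t(1) t'(1)])
      moreover have "Suc (bcost b + t + t') \<le> Suc m * (Suc (bcost b) + wc z c) + Suc (bcost b)"
        using t(2) t'(2) by simp
      ultimately show ?thesis using t'(3,4) by blast
    next
      case False
      then show ?thesis using exec.WhileFalse[of s b c] Suc.prems by fastforce
    qed
  qed
  from this[OF init refl] show ?thesis unfolding ok_def by simp
qed

definition For :: "vname \<Rightarrow> iexp \<Rightarrow> com \<Rightarrow> com" where
  "For i b c = Seq (IAssign i [] (N 0)) (While (ILess (I i []) b) (Seq c (IAssign i [] (IPlus (I i []) (N 1)))))"

lemma iwrites_For [simp]: "iwrites (For i b c) = insert i (iwrites c)"
  by (auto simp: For_def)

lemma rwrites_For [simp]: "rwrites (For i b c) = rwrites c"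
  by (auto simp: For_def)

text \<open>The frame relation to the start state is available throughout, so an invariant describes
  only what the body changes; \<open>indep\<close> lets the counter advance without reproving
  it.\<close>

lemma ok_For:
  assumes m: "m \<le> Suc z * Suc z" and i: "i \<notin> iwrites c"
    and init: "P 0 s\<^sub>0"
    and indep: "\<And>j s v. P j s \<Longrightarrow> P j (upd (fst s) i [] v, snd s)"
    and bound: "\<And>s. same (insert i (iwrites c)) (rwrites c) s\<^sub>0 s \<Longrightarrow> ival s b = m"
    and step: "\<And>j s. j < m \<Longrightarrow> P j s \<Longrightarrow> fst s i [] = j \<Longrightarrow>
      same (insert i (iwrites c)) (rwrites c) s\<^sub>0 s \<Longrightarrow> ok z c s (P (Suc j))"
    and post: "\<And>s. P m s \<Longrightarrow> same (insert i (iwrites c)) (rwrites c) s\<^sub>0 s \<Longrightarrow> Q s"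
  shows "ok z (For i b c) s\<^sub>0 Q"
proof -
  let ?F = "same (insert i (iwrites c)) (rwrites c) s\<^sub>0"
  let ?P = "\<lambda>j s. j \<le> m \<and> P j s \<and> fst s i [] = j \<and> ?F s"
  let ?s1 = "(upd (fst s\<^sub>0) i [] 0, snd s\<^sub>0)"
  have upd_same: "same (insert i A) B s (upd (fst s) i js v, snd s)" for A B s js v
    by (simp add: same_def upd_def)
  have "ok z (While (ILess (I i []) b) (Seq c (IAssign i [] (IPlus (I i []) (N 1))))) ?s1
      (\<lambda>s'. \<not> bval s' (ILess (I i []) b) \<and> (\<exists>j. ?P j s'))"
  proof (rule ok_While)
    show "?P 0 ?s1" using indep[OF init] upd_same by (simp add: upd_def)
    fix j s assume P: "?P j s" and b: "bval s (ILess (I i []) b)"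
    then have jm: "j < m" using bound by simp
    have "ok z c s (\<lambda>s'. P (Suc j) s' \<and> same (iwrites c) (rwrites c) s s')"
      by (rule ok_mono[OF step]) (use P jm in auto)
    then have "ok z (Seq c (IAssign i [] (IPlus (I i []) (N 1)))) s (?P (Suc j))"
    proof (intro ok_Seq, elim ok_mono, intro ok_IAssign)
      fix s' assume s': "P (Suc j) s' \<and> same (iwrites c) (rwrites c) s s'"
      then have "fst s' i [] = j" using i P by (simp add: same_def)
      moreover have "?F s'" using P s' by (auto intro: same_trans same_mono)
      then have "?F (upd (fst s') i [] (Suc j), snd s')" using upd_same same_trans by blast
      ultimately show "?P (Suc j) (upd (fst s') i (map (ival s') []) (ival s' (IPlus (I i []) (N 1))), snd s')"
        using s' jm indep by (simp add: upd_def)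
    qed
    then show "j < Suc z * Suc z \<and> ok z (Seq c (IAssign i [] (IPlus (I i []) (N 1)))) s (?P (Suc j))"
      using jm m by simp
  qed
  then have "ok z (While (ILess (I i []) b) (Seq c (IAssign i [] (IPlus (I i []) (N 1))))) ?s1 Q"
  proof (rule ok_mono)
    fix s assume "\<not> bval s (ILess (I i []) b) \<and> (\<exists>j. ?P j s)"
    then obtain j where j: "\<not> bval s (ILess (I i []) b)" "?P j s" by blast
    then have "j = m" using bound by simp
    then show "Q s" using j post by simp
  qed
  then show ?thesis unfolding For_def by (intro ok_Seq ok_IAssign) simp
qed


section \<open>Computing a single-linkage order\<close>

abbreviation "BOr a b \<equiv> BNot (BAnd (BNot a) (BNot b))"

text \<open>The flag \<open>a\<close> records whether a candidate has been seen, as no real constant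
  could serve as an infinite initial minimum.\<close>

definition scan_body :: com where
  "scan_body = If (BAnd (ILess (I ''tr'' [I ''v'' []]) (N 1))
      (BOr (ILess (I ''a'' []) (N 1)) (RLess (R ''d'' [I ''vx'' [I ''j'' []], I ''v'' []]) (R ''m'' []))))
    (Seq (RAssign ''m'' [] (R ''d'' [I ''vx'' [I ''j'' []], I ''v'' []]))
    (Seq (IAssign ''p'' [] (I ''j'' [])) (Seq (IAssign ''w'' [] (I ''v'' [])) (IAssign ''a'' [] (N 1)))))
    Skip"

definition scan :: com where
  "scan = For ''j'' (I ''i'' []) (For ''v'' (I ''n'' []) scan_body)"

definition prim_step :: com where
  "prim_step = Seq (IAssign ''a'' [] (N 0)) (Seq scan
    (Seq (IAssign ''tr'' [I ''w'' []] (N 1)) (Seq (IAssign ''vx'' [I ''i'' []] (I ''w'' []))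
    (Seq (IAssign ''pa'' [I ''i'' []] (I ''p'' [])) (RAssign ''e'' [I ''i'' []] (R ''m'' []))))))"

definition prim :: com where
  "prim = For ''i'' (I ''n'' []) prim_step"

lemma writes_scan_body [simp]: "iwrites scan_body = {''p'', ''w'', ''a''}" "rwrites scan_body = {''m''}"
  by (auto simp: scan_body_def)

lemma writes_scan [simp]: "iwrites scan = {''p'', ''w'', ''a'', ''v'', ''j''}" "rwrites scan = {''m''}"
  by (auto simp: scan_def)

lemma writes_prim_step [simp]:
  "iwrites prim_step = {''p'', ''w'', ''a'', ''v'', ''j'', ''tr'', ''vx'', ''pa''}" "rwrites prim_step = {''m'', ''e''}"
  by (auto simp: prim_step_def)

lemma writes_prim [simp]:
  "iwrites prim = {''p'', ''w'', ''a'', ''v'', ''j'', ''tr'', ''vx'', ''pa'', ''i''}" "rwrites prim = {''m'', ''e''}"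
  by (auto simp: prim_def)

definition best :: "state \<Rightarrow> (nat \<times> nat) set \<Rightarrow> state \<Rightarrow> bool" where
  "best s\<^sub>0 S s \<longleftrightarrow>
    (fst s ''a'' [] = 0 \<and> (\<forall>(j, v)\<in>S. fst s\<^sub>0 ''tr'' [v] \<noteq> 0)
      \<and> fst s ''p'' [] = fst s\<^sub>0 ''p'' [] \<and> fst s ''w'' [] = fst s\<^sub>0 ''w'' [] \<and> snd s ''m'' [] = snd s\<^sub>0 ''m'' []) \<or>
    (fst s ''a'' [] = 1 \<and> (fst s ''p'' [], fst s ''w'' []) \<in> S \<and> fst s\<^sub>0 ''tr'' [fst s ''w'' []] = 0
      \<and> snd s ''m'' [] = snd s\<^sub>0 ''d'' [fst s\<^sub>0 ''vx'' [fst s ''p'' []], fst s ''w'' []]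
      \<and> (\<forall>(j, v)\<in>S. fst s\<^sub>0 ''tr'' [v] = 0 \<longrightarrow> snd s ''m'' [] \<le> snd s\<^sub>0 ''d'' [fst s\<^sub>0 ''vx'' [j], v]))"

lemma ok_scan_body:
  assumes "best s\<^sub>0 S s" "fst s ''tr'' = fst s\<^sub>0 ''tr''" "fst s ''vx'' = fst s\<^sub>0 ''vx''" "snd s ''d'' = snd s\<^sub>0 ''d''"
    "fst s ''j'' [] = j" "fst s ''v'' [] = v"
  shows "ok z scan_body s (best s\<^sub>0 (insert (j, v) S))"
  unfolding scan_body_def
proof (intro ok_If ok_Seq ok_IAssign ok_RAssign ok_Skip)
qed (use assms in \<open>(fastforce simp: best_def upd_def)+\<close>)

lemma ok_scan:
  assumes i: "fst s\<^sub>0 ''i'' [] = i" and n: "fst s\<^sub>0 ''n'' [] = n" and a: "fst s\<^sub>0 ''a'' [] = 0" and z: "i \<le> z" "n \<le> z"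
  shows "ok z scan s\<^sub>0 (best s\<^sub>0 ({..<i} \<times> {..<n}))"
  unfolding scan_def
proof (rule ok_For[where m = i and P = "\<lambda>j. best s\<^sub>0 ({..<j} \<times> {..<n})"])
  fix j s assume j: "j < i" and P: "best s\<^sub>0 ({..<j} \<times> {..<n}) s" "fst s ''j'' [] = j"
    and F: "same (insert ''j'' (iwrites (For ''v'' (I ''n'' []) scan_body))) (rwrites (For ''v'' (I ''n'' []) scan_body)) s\<^sub>0 s"
  show "ok z (For ''v'' (I ''n'' []) scan_body) s (best s\<^sub>0 ({..<Suc j} \<times> {..<n}))"
  proof (rule ok_For[where m = n and P = "\<lambda>v. best s\<^sub>0 ({..<j} \<times> {..<n} \<union> {j} \<times> {..<v})"])
    fix v s' assume v: "v < n" and P': "best s\<^sub>0 ({..<j} \<times> {..<n} \<union> {j} \<times> {..<v}) s'" "fst s' ''v'' [] = v"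
      and F': "same (insert ''v'' (iwrites scan_body)) (rwrites scan_body) s s'"
    have *: "{..<j} \<times> {..<n} \<union> {j} \<times> {..<Suc v} = insert (j, v) ({..<j} \<times> {..<n} \<union> {j} \<times> {..<v})"
      by (auto simp: less_Suc_eq)
    show "ok z scan_body s' (best s\<^sub>0 ({..<j} \<times> {..<n} \<union> {j} \<times> {..<Suc v}))"
      unfolding * by (rule ok_scan_body[OF P'(1)]) (use F F' P P' in \<open>auto simp: same_def\<close>)
  next
    fix s' assume "best s\<^sub>0 ({..<j} \<times> {..<n} \<union> {j} \<times> {..<n}) s'"
    moreover have "{..<j} \<times> {..<n} \<union> {j} \<times> {..<n} = {..<Suc j} \<times> {..<n}" by (auto simp: less_Suc_eq)
    ultimately show "best s\<^sub>0 ({..<Suc j} \<times> {..<n}) s'" by simp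
  qed (use P n z F in \<open>auto simp: same_def best_def upd_def\<close>)
qed (use a i z in \<open>auto simp: same_def best_def upd_def\<close>)

text \<open>The minimality of each past key over its cut is recorded and later becomes
  \<open>cut_rule\<close>. The clause for \<open>i = 0\<close> covers the first round, whose scan
  meets no pair and leaves the zero cells in place: point 0 is listed first, with key 0.\<close>

definition prim_inv :: "nat \<Rightarrow> (nat \<Rightarrow> nat \<Rightarrow> real) \<Rightarrow> nat \<Rightarrow> state \<Rightarrow> bool" where
  "prim_inv n d i s \<longleftrightarrow> inj_on (\<lambda>l. fst s ''vx'' [l]) {..<i} \<and> (\<forall>l<i. fst s ''vx'' [l] < n)
    \<and> (\<forall>v. fst s ''tr'' [v] = (if v \<in> (\<lambda>l. fst s ''vx'' [l]) ` {..<i} then 1 else 0))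
    \<and> (\<forall>l<i. 0 < l \<longrightarrow> fst s ''pa'' [l] < l \<and> snd s ''e'' [l] = d (fst s ''vx'' [fst s ''pa'' [l]]) (fst s ''vx'' [l]))
    \<and> (\<forall>l j v. j < l \<and> l < i \<and> v < n \<and> v \<notin> (\<lambda>l. fst s ''vx'' [l]) ` {..<l} \<longrightarrow> snd s ''e'' [l] \<le> d (fst s ''vx'' [j]) v)
    \<and> (i = 0 \<longrightarrow> fst s ''w'' [] = 0 \<and> fst s ''p'' [] = 0 \<and> snd s ''m'' [] = 0)
    \<and> (0 < i \<longrightarrow> snd s ''e'' [0] = 0)"

lemma ok_prim_step:
  assumes inv: "prim_inv n d i s" and i: "fst s ''i'' [] = i" "i < n" and n: "fst s ''n'' [] = n"
    and d: "\<And>u v. u < n \<Longrightarrow> v < n \<Longrightarrow> snd s ''d'' [u, v] = d u v" and z: "n \<le> z"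
  shows "ok z prim_step s (prim_inv n d (Suc i))"
  unfolding prim_step_def
proof (intro ok_Seq ok_IAssign)
  let ?s = "(upd (fst s) ''a'' (map (ival s) []) (ival s (N 0)), snd s)"
  let ?V = "(\<lambda>l. fst s ''vx'' [l])"
  show "ok z scan ?s (\<lambda>s'. ok z (Seq (IAssign ''tr'' [I ''w'' []] (N 1)) (Seq (IAssign ''vx'' [I ''i'' []] (I ''w'' []))
    (Seq (IAssign ''pa'' [I ''i'' []] (I ''p'' [])) (RAssign ''e'' [I ''i'' []] (R ''m'' []))))) s' (prim_inv n d (Suc i)))"
  proof (rule ok_mono[OF ok_scan[of ?s i n z]])
    fix s' assume best: "best ?s ({..<i} \<times> {..<n}) s'" and F: "same (iwrites scan) (rwrites scan) ?s s'"
    have fr: "fst s' ''vx'' = fst s ''vx''" "fst s' ''tr'' = fst s ''tr''" "fst s' ''pa'' = fst s ''pa''"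
      "snd s' ''e'' = snd s ''e''" "fst s' ''i'' [] = i"
      using F i by (auto simp: same_def upd_def)
    define w where "w = fst s' ''w'' []"
    define p where "p = fst s' ''p'' []"
    define m where "m = snd s' ''m'' []"
    have tr: "fst s ''tr'' [v] = (if v \<in> ?V ` {..<i} then 1 else 0)" for v
      using inv by (simp add: prim_inv_def)
    have V: "inj_on ?V {..<i}" "\<And>l. l < i \<Longrightarrow> ?V l < n"
      using inv by (auto simp: prim_inv_def)
    have w: "w < n" "w \<notin> ?V ` {..<i}"
      and pm: "0 < i \<Longrightarrow> p < i \<and> m = d (?V p) w \<and> (\<forall>j<i. \<forall>v<n. v \<notin> ?V ` {..<i} \<longrightarrow> m \<le> d (?V j) v)"
      and m0: "i = 0 \<Longrightarrow> m = 0"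
    proof -
      have "w < n \<and> w \<notin> ?V ` {..<i} \<and>
        (0 < i \<longrightarrow> p < i \<and> m = d (?V p) w \<and> (\<forall>j<i. \<forall>v<n. v \<notin> ?V ` {..<i} \<longrightarrow> m \<le> d (?V j) v)) \<and> (i = 0 \<longrightarrow> m = 0)"
      proof (cases "i = 0")
        case True
        then show ?thesis using best inv i by (auto simp: best_def prim_inv_def w_def m_def upd_def)
      next
        case False
        \<comment> \<open>Fewer than \<open>n\<close> points are listed, so an unlisted one exists
          and the scan must have set its flag.\<close>
        have "card (?V ` {..<i}) < card {..<n}" using V(1) i by (simp add: card_image)
        then have "\<not> {..<n} \<subseteq> ?V ` {..<i}" using card_mono[of "?V ` {..<i}" "{..<n}"] by auto
        then obtain v where v: "v < n" "v \<notin> ?V ` {..<i}" by auto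
        then have "(0, v) \<in> {..<i} \<times> {..<n}" "fst s ''tr'' [v] = 0" using False tr[of v] by auto
        moreover have "fst ?s ''tr'' [v] = fst s ''tr'' [v]" by (simp add: upd_def)
        ultimately have "fst s' ''a'' [] = 1" using best unfolding best_def by force
        then have b: "p < i" "w < n" "fst s ''tr'' [w] = 0" "m = snd s ''d'' [?V p, w]"
          "\<And>j v. j < i \<Longrightarrow> v < n \<Longrightarrow> fst s ''tr'' [v] = 0 \<Longrightarrow> m \<le> snd s ''d'' [?V j, v]"
          using best by (auto simp: best_def upd_def w_def p_def m_def)
        then show ?thesis using d V(2) tr False by (auto split: if_splits)
      qed
      then show "w < n" "w \<notin> ?V ` {..<i}"
        "0 < i \<Longrightarrow> p < i \<and> m = d (?V p) w \<and> (\<forall>j<i. \<forall>v<n. v \<notin> ?V ` {..<i} \<longrightarrow> m \<le> d (?V j) v)" "i = 0 \<Longrightarrow> m = 0"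
        by blast+
    qed
    show "ok z (Seq (IAssign ''tr'' [I ''w'' []] (N 1)) (Seq (IAssign ''vx'' [I ''i'' []] (I ''w'' []))
      (Seq (IAssign ''pa'' [I ''i'' []] (I ''p'' [])) (RAssign ''e'' [I ''i'' []] (R ''m'' []))))) s' (prim_inv n d (Suc i))"
    proof (intro ok_Seq ok_IAssign ok_RAssign, goal_cases)
      case 1
      let ?t = "((fst s')(''tr'' := (fst s' ''tr'')([w] := 1), ''vx'' := (fst s' ''vx'')([i] := w), ''pa'' := (fst s' ''pa'')([i] := p)),
        (snd s')(''e'' := (snd s' ''e'')([i] := m)))"
      have V': "(\<lambda>l. fst ?t ''vx'' [l]) = ?V(i := w)" by (auto simp: fr)
      have im: "(?V(i := w)) ` {..<l} = ?V ` {..<l}" if "l \<le> i" for l using that by auto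
      have imS: "(?V(i := w)) ` {..<Suc i} = insert w (?V ` {..<i})" by (auto simp: lessThan_Suc)
      have "prim_inv n d (Suc i) ?t"
        unfolding prim_inv_def V'
      proof (intro conjI allI impI)
        show "inj_on (?V(i := w)) {..<Suc i}"
          using V(1) w(2) by (auto simp: inj_on_def less_Suc_eq)
        show "fst ?t ''tr'' [v] = (if v \<in> (?V(i := w)) ` {..<Suc i} then 1 else 0)" for v
          unfolding imS using tr by (simp add: fr)
        show "fst ?t ''vx'' [l] < n" if "l < Suc i" for l using that V(2) w by (auto simp: fr less_Suc_eq)
        show "fst ?t ''pa'' [l] < l" if "l < Suc i" "0 < l" for l
          using that inv pm by (auto simp: fr less_Suc_eq prim_inv_def)
        show "snd ?t ''e'' [l] = d (fst ?t ''vx'' [fst ?t ''pa'' [l]]) (fst ?t ''vx'' [l])" if "l < Suc i" "0 < l" for l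
        proof (cases "l = i")
          case True
          then show ?thesis using pm that by (simp add: fr)
        next
          case False
          then have "l < i" "fst s ''pa'' [l] < l" using that inv by (auto simp: prim_inv_def)
          then show ?thesis using that inv by (auto simp: fr prim_inv_def)
        qed
        show "snd ?t ''e'' [l] \<le> d (fst ?t ''vx'' [j]) v" if "j < l \<and> l < Suc i \<and> v < n \<and> v \<notin> (?V(i := w)) ` {..<l}" for l j v
        proof (cases "l = i")
          case True
          then show ?thesis using pm that im[of l] by (auto simp: fr)
        next
          case False
          then have l: "j < l" "l < i" "v < n" "v \<notin> ?V ` {..<l}" using that im[of l] by auto
          then have "snd s ''e'' [l] \<le> d (?V j) v" using inv unfolding prim_inv_def by blast
          then show ?thesis using l by (simp add: fr)
        qed
        show "snd ?t ''e'' [0] = 0" using inv m0 by (auto simp: fr prim_inv_def)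
      qed auto
      then show ?case by (simp add: upd_def fr w_def p_def m_def fun_upd_twist)
    qed
  qed (use i n z in \<open>auto simp: upd_def\<close>)
qed

lemma ok_prim:
  assumes "prim_inv n d 0 s" and n: "fst s ''n'' [] = n"
    and d: "\<And>u v. u < n \<Longrightarrow> v < n \<Longrightarrow> snd s ''d'' [u, v] = d u v" and z: "n \<le> z"
  shows "ok z prim s (prim_inv n d n)"
  unfolding prim_def
proof (rule ok_For[where m = n and P = "prim_inv n d"])
  show "ok z prim_step s' (prim_inv n d (Suc i))"
    if "i < n" "prim_inv n d i s'" "fst s' ''i'' [] = i" "same (insert ''i'' (iwrites prim_step)) (rwrites prim_step) s s'" for i s'
    using that n d z by (intro ok_prim_step) (auto simp: same_def)
qed (use assms in \<open>auto simp: prim_inv_def upd_def same_def\<close>)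

lemma prim_order_if_prim_inv:
  assumes inv: "prim_inv n d n s" and n: "0 < n" and d: "Metric_space {..<n} d"
  shows "prim_order n d (\<lambda>l. fst s ''vx'' [l]) (\<lambda>l. fst s ''pa'' [l]) (\<lambda>l. snd s ''e'' [l])"
proof (rule prim_order.intro)
  let ?V = "\<lambda>l. fst s ''vx'' [l]"
  have V: "inj_on ?V {..<n}" "\<And>l. l < n \<Longrightarrow> ?V l < n"
    using inv by (auto simp: prim_inv_def)
  have "?V ` {..<n} = {..<n}" by (rule endo_inj_surj) (use V in auto)
  then show "bij_betw ?V {..<n} {..<n}" using V(1) by (simp add: bij_betw_def)
  show "snd s ''e'' [l] \<le> d (?V i) (?V j)" if "i < l" "l \<le> j" "j < n" for i l j
  proof -
    \<comment> \<open>By injectivity a point with index at least \<open>l\<close> is unlisted when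
      \<open>l\<close> is chosen, so the recorded minimality applies to it.\<close>
    have "?V j \<noteq> ?V m" if "m < l" for m
      using inj_onD[OF V(1), of j m] \<open>m < l\<close> \<open>l \<le> j\<close> \<open>j < n\<close> by auto
    then have "?V j \<notin> ?V ` {..<l}" by auto
    then show ?thesis using inv that V(2)[of j] by (auto simp: prim_inv_def)
  qed
qed (use assms in \<open>auto simp: prim_inv_def\<close>)


section \<open>Computing ranks, tours and cuts\<close>

definition rank_body :: com where
  "rank_body = If (BAnd (ILess (N 0) (I ''i'' [])) (BOr (ILess (I ''j'' []) (N 1))
      (BOr (RLess (R ''e'' [I ''i'' []]) (R ''e'' [I ''j'' []]))
        (BAnd (BNot (RLess (R ''e'' [I ''j'' []]) (R ''e'' [I ''i'' []]))) (ILess (I ''i'' []) (I ''j'' []))))))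
    (IAssign ''rk'' [I ''i'' []] (IPlus (I ''rk'' [I ''i'' []]) (N 1))) Skip"

definition rank :: com where
  "rank = For ''i'' (I ''n'' []) (Seq (For ''j'' (I ''n'' []) rank_body)
    (IAssign ''so'' [I ''rk'' [I ''i'' []]] (I ''i'' [])))"

lemma writes_rank_body [simp]: "iwrites rank_body = {''rk''}" "rwrites rank_body = {}"
  by (auto simp: rank_body_def)

lemma writes_rank [simp]: "iwrites rank = {''rk'', ''so'', ''i'', ''j''}" "rwrites rank = {}"
  by (auto simp: rank_def)

definition link :: com where
  "link = For ''i'' (I ''n'' [])
    (Seq (If (ILess (I ''rk'' [I ''i'' []]) (I ''N'' [])) (IAssign ''q'' [] (I ''n'' [])) (IAssign ''q'' [] (I ''pa'' [I ''i'' []])))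
    (Seq (IAssign ''nx'' [I ''i'' []] (I ''nx'' [I ''q'' []])) (IAssign ''nx'' [I ''q'' []] (I ''i'' []))))"

lemma writes_link [simp]: "iwrites link = {''i'', ''q'', ''nx''}" "rwrites link = {}"
  by (auto simp: link_def)

definition step_length :: rexp where
  "step_length = RPlus (R ''acc'' []) (R ''d'' [I ''vx'' [I ''x'' []], I ''vx'' [I ''y'' []]])"

text \<open>The real variable \<open>z\<close> is never assigned; it supplies the constant zero.\<close>

definition walk_body :: com where
  "walk_body = Seq (IAssign ''y'' [] (I ''nx'' [I ''x'' []]))
    (Seq (If (BOr (ILess (I ''rk'' [I ''y'' []]) (I ''N'' [])) (RLess (R ''X'' []) step_length))
      (Seq (RAssign ''acc'' [] (R ''z'' [])) (Seq (IAssign ''c'' [] (IPlus (I ''c'' []) (N 1))) (IAssign ''ct'' [I ''y'' []] (N 1))))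
      (Seq (RAssign ''acc'' [] step_length) (IAssign ''ct'' [I ''y'' []] (N 0))))
    (Seq (IAssign ''pc'' [I ''y'' []] (IMinus (I ''c'' []) (N 1)))
    (Seq (IAssign ''pv'' [I ''y'' []] (I ''x'' [])) (IAssign ''x'' [] (I ''y'' [])))))"

definition walk :: com where
  "walk = Seq (IAssign ''x'' [] (I ''n'' [])) (Seq (IAssign ''c'' [] (N 0)) (Seq (RAssign ''acc'' [] (R ''z'' []))
    (For ''t'' (I ''n'' []) walk_body)))"

definition build :: com where
  "build = Seq link walk"

lemma writes_walk_body [simp]:
  "iwrites walk_body = {''x'', ''y'', ''c'', ''ct'', ''pc'', ''pv''}" "rwrites walk_body = {''acc''}"
  by (auto simp: walk_body_def)

lemma writes_build [simp]:
  "iwrites build = {''i'', ''q'', ''nx'', ''x'', ''y'', ''c'', ''t'', ''ct'', ''pc'', ''pv''}" "rwrites build = {''acc''}"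
  by (auto simp: build_def walk_def)

context prim_order
begin

text \<open>The last conjunct matters for \<open>n \<le> k\<close>: the search then starts with
  \<open>n\<close> heads and looks up \<open>so[n]\<close>, which yields index 0 with key 0 and
  hence cut length 0.\<close>

lemma ok_rank:
  assumes n: "fst s ''n'' [] = n" and e: "\<And>l. l < n \<Longrightarrow> snd s ''e'' [l] = e l"
    and init: "\<And>l. fst s ''rk'' [l] = 0" "\<And>l. fst s ''so'' [l] = 0" and z: "n \<le> z"
  shows "ok z rank s (\<lambda>s'. (\<forall>l<n. fst s' ''rk'' [l] = rk l \<and> fst s' ''so'' [rk l] = l) \<and> (\<forall>l\<ge>n. fst s' ''so'' [l] = 0))"
  unfolding rank_def
proof (rule ok_For[where m = n and P = "\<lambda>i s. (\<forall>l<i. fst s ''rk'' [l] = rk l \<and> fst s ''so'' [rk l] = l)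
    \<and> (\<forall>l\<ge>i. fst s ''rk'' [l] = 0) \<and> (\<forall>l\<ge>n. fst s ''so'' [l] = 0)"])
  fix i s1 assume i: "i < n" "fst s1 ''i'' [] = i"
    and P: "(\<forall>l<i. fst s1 ''rk'' [l] = rk l \<and> fst s1 ''so'' [rk l] = l)
      \<and> (\<forall>l\<ge>i. fst s1 ''rk'' [l] = 0) \<and> (\<forall>l\<ge>n. fst s1 ''so'' [l] = 0)"
    and F: "same (insert ''i'' (iwrites (Seq (For ''j'' (I ''n'' []) rank_body) (IAssign ''so'' [I ''rk'' [I ''i'' []]] (I ''i'' [])))))
      (rwrites (Seq (For ''j'' (I ''n'' []) rank_body) (IAssign ''so'' [I ''rk'' [I ''i'' []]] (I ''i'' [])))) s s1"
  show "ok z (Seq (For ''j'' (I ''n'' []) rank_body) (IAssign ''so'' [I ''rk'' [I ''i'' []]] (I ''i'' []))) s1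
    (\<lambda>s. (\<forall>l<Suc i. fst s ''rk'' [l] = rk l \<and> fst s ''so'' [rk l] = l)
    \<and> (\<forall>l\<ge>Suc i. fst s ''rk'' [l] = 0) \<and> (\<forall>l\<ge>n. fst s ''so'' [l] = 0))"
  proof (rule ok_Seq, rule ok_For[where m = n and P = "\<lambda>j s. fst s ''rk'' [i] = card {l\<in>{..<j}. beats l i}
      \<and> (\<forall>l. l \<noteq> i \<longrightarrow> fst s ''rk'' [l] = fst s1 ''rk'' [l])"])
    fix j s2 assume j: "j < n" "fst s2 ''j'' [] = j"
      and P2: "fst s2 ''rk'' [i] = card {l\<in>{..<j}. beats l i} \<and> (\<forall>l. l \<noteq> i \<longrightarrow> fst s2 ''rk'' [l] = fst s1 ''rk'' [l])"
      and F2: "same (insert ''j'' (iwrites rank_body)) (rwrites rank_body) s1 s2"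
    have v: "fst s2 ''i'' [] = i" "snd s2 ''e'' [i] = e i" "snd s2 ''e'' [j] = e j"
      using F F2 i j e by (auto simp: same_def)
    have "{l\<in>{..<Suc j}. beats l i} = (if beats j i then insert j {l\<in>{..<j}. beats l i} else {l\<in>{..<j}. beats l i})"
      by (auto simp: less_Suc_eq)
    then have c: "card {l\<in>{..<Suc j}. beats l i} = card {l\<in>{..<j}. beats l i} + (if beats j i then 1 else 0)"
      by simp
    show "ok z rank_body s2 (\<lambda>s. fst s ''rk'' [i] = card {l\<in>{..<Suc j}. beats l i}
      \<and> (\<forall>l. l \<noteq> i \<longrightarrow> fst s ''rk'' [l] = fst s1 ''rk'' [l]))"
      unfolding rank_body_def c
      by (intro ok_If ok_IAssign ok_Skip) (use P2 v j in \<open>auto simp: upd_def beats_def\<close>)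
  next
    fix s2 assume P2: "fst s2 ''rk'' [i] = card {l\<in>{..<n}. beats l i} \<and> (\<forall>l. l \<noteq> i \<longrightarrow> fst s2 ''rk'' [l] = fst s1 ''rk'' [l])"
      and F2: "same (insert ''j'' (iwrites rank_body)) (rwrites rank_body) s1 s2"
    have v: "fst s2 ''i'' [] = i" "fst s2 ''rk'' [i] = rk i" "fst s2 ''so'' = fst s1 ''so''"
      using F2 i P2 by (auto simp: same_def rk_def)
    have ne: False if "l < i" "rk l = rk i" for l using rk_inv_rk[of i] rk_inv_rk[of l] that i by simp
    moreover have "rk i < n" using bij_rk i by (auto simp: bij_betw_def)
    ultimately show "ok z (IAssign ''so'' [I ''rk'' [I ''i'' []]] (I ''i'' [])) s2
      (\<lambda>s. (\<forall>l<Suc i. fst s ''rk'' [l] = rk l \<and> fst s ''so'' [rk l] = l)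
      \<and> (\<forall>l\<ge>Suc i. fst s ''rk'' [l] = 0) \<and> (\<forall>l\<ge>n. fst s ''so'' [l] = 0))"
      using P conjunct2[OF P2] v by (intro ok_IAssign) (auto simp: upd_def less_Suc_eq dest: ne)
  qed (use n z P F in \<open>auto simp: same_def upd_def\<close>)
qed (use n z init in \<open>auto simp: same_def upd_def\<close>)

end

lemma successively_links_insert_after:
  assumes "successively (\<lambda>x y. f x = y) xs" "distinct xs" "q \<in> set xs" "i \<notin> set xs"
    and g: "g q = i" "g i = f q" "\<And>x. x \<noteq> q \<Longrightarrow> x \<noteq> i \<Longrightarrow> g x = f x"
  shows "successively (\<lambda>x y. g x = y) (insert_after q i xs)"
  using assms(1-4)
proof (induction xs)
  case (Cons x xs)
  show ?case
  proof (cases "x = q")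
    case True
    have "successively (\<lambda>x y. g x = y) xs"
    proof (rule successively_mono[where P = "\<lambda>x y. f x = y"])
      show "successively (\<lambda>x y. f x = y) xs" using Cons.prems by (auto simp: successively_Cons)
      show "g a = b" if "f a = b" "a \<in> set xs" for a b
      proof -
        have "a \<noteq> q" "a \<noteq> i" using that Cons.prems True by auto
        then show ?thesis using g(3) that by simp
      qed
    qed
    then show ?thesis using Cons.prems True g by (auto simp: successively_Cons)
  next
    case False
    then have "successively (\<lambda>x y. g x = y) (insert_after q i xs)"
      using Cons by (auto simp: successively_Cons)
    moreover have "xs \<noteq> []" "g x = f x" using False Cons.prems g(3)[of x] by auto
    ultimately show ?thesis
      using False Cons.prems by (auto simp: successively_Cons hd_insert_after)
  qed
qed simp

context prim_cut
begin

text \<open>Nothing is claimed about the pointer of the last entry. It may be left over from an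
  earlier build, but the walk takes exactly \<open>n\<close> steps and never follows it.\<close>

lemma ok_link:
  assumes n: "fst s ''n'' [] = n" and pa: "\<And>l. l < n \<Longrightarrow> fst s ''pa'' [l] = pa l"
    and D: "\<And>l. l < n \<Longrightarrow> fst s ''rk'' [l] < fst s ''N'' [] \<longleftrightarrow> l \<in> D" and z: "n \<le> z"
  shows "ok z link s (\<lambda>s. successively (\<lambda>x y. fst s ''nx'' [x] = y) M)"
  unfolding link_def
proof (rule ok_For[where m = n and P = "\<lambda>i s. successively (\<lambda>x y. fst s ''nx'' [x] = y) (tour i)"])
  let ?c = "Seq (If (ILess (I ''rk'' [I ''i'' []]) (I ''N'' [])) (IAssign ''q'' [] (I ''n'' [])) (IAssign ''q'' [] (I ''pa'' [I ''i'' []])))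
    (Seq (IAssign ''nx'' [I ''i'' []] (I ''nx'' [I ''q'' []])) (IAssign ''nx'' [I ''q'' []] (I ''i'' [])))"
  fix i s1 assume i: "i < n" "fst s1 ''i'' [] = i" and P: "successively (\<lambda>x y. fst s1 ''nx'' [x] = y) (tour i)"
    and F: "same (insert ''i'' (iwrites ?c)) (rwrites ?c) s s1"
  have v: "fst s1 ''n'' [] = n" "fst s1 ''pa'' [i] = pa i" "fst s1 ''rk'' [i] < fst s1 ''N'' [] \<longleftrightarrow> i \<in> D"
    using F n pa[OF i(1)] D[OF i(1)] by (auto simp: same_def)
  have a: "attach i \<in> set (tour i)" "i \<notin> set (tour i)" using attach_mem[OF i(1)] set_tour[of i] i by auto
  then have ne: "attach i \<noteq> i" by metis
  let ?f = "\<lambda>x. fst s1 ''nx'' [x]"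
  have Q: "successively (\<lambda>x y. (?f(i := ?f (attach i), attach i := i)) x = y) (tour (Suc i))"
    unfolding tour.simps
    by (rule successively_links_insert_after[OF P distinct_tour a]) (use i ne in auto)
  have *: "ok z (Seq (IAssign ''nx'' [I ''i'' []] (I ''nx'' [I ''q'' []])) (IAssign ''nx'' [I ''q'' []] (I ''i'' [])))
      (upd (fst s1) ''q'' [] (attach i), snd s1) (\<lambda>s. successively (\<lambda>x y. fst s ''nx'' [x] = y) (tour (Suc i)))"
    using Q ne i
    by (intro ok_Seq ok_IAssign) (simp add: upd_def fun_upd_def cong: if_cong del: tour.simps)
  show "ok z ?c s1 (\<lambda>s. successively (\<lambda>x y. fst s ''nx'' [x] = y) (tour (Suc i)))"
    by (intro ok_Seq[of _ "If _ _ _"] ok_If ok_IAssign) (use * v i in \<open>auto simp del: tour.simps\<close>)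
qed (use n z in \<open>auto simp: same_def upd_def M_def\<close>)

text \<open>\<open>pc\<close> numbers the pieces from 0, as the output does, whereas
  \<open>num\<close> counts from 1.\<close>

definition built :: "nat \<Rightarrow> state \<Rightarrow> bool" where
  "built t s \<longleftrightarrow> fst s ''c'' [] = num t \<and> (\<forall>i. 1 \<le> i \<and> i \<le> t \<longrightarrow>
    fst s ''ct'' [M ! i] = (if cut i then 1 else 0) \<and> fst s ''pc'' [M ! i] = num i - 1 \<and> fst s ''pv'' [M ! i] = M ! (i - 1))"

lemma M_inj: "i \<le> n \<Longrightarrow> j \<le> n \<Longrightarrow> M ! i = M ! j \<longleftrightarrow> i = j"
  using distinct_tour[of n] length_M by (simp add: nth_eq_iff_index_eq M_def)

lemma built_SucI:
  assumes b: "built t s" and t: "t < n" and c: "fst s' ''c'' [] = num (Suc t)"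
    and ct: "fst s' ''ct'' = (fst s ''ct'')([M ! Suc t] := if cut (Suc t) then 1 else 0)"
    and pc: "fst s' ''pc'' = (fst s ''pc'')([M ! Suc t] := num (Suc t) - 1)"
    and pv: "fst s' ''pv'' = (fst s ''pv'')([M ! Suc t] := M ! t)"
  shows "built (Suc t) s'"
  unfolding built_def
proof (intro conjI allI impI)
  fix i assume i: "1 \<le> i \<and> i \<le> Suc t"
  have "fst s' ''ct'' [M ! i] = (if cut i then 1 else 0) \<and> fst s' ''pc'' [M ! i] = num i - 1 \<and> fst s' ''pv'' [M ! i] = M ! (i - 1)"
  proof (cases "i = Suc t")
    case True
    then show ?thesis by (simp add: ct pc pv)
  next
    case False
    then have "M ! i \<noteq> M ! Suc t" using M_inj[of i "Suc t"] i t by simp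
    then show ?thesis using b i False by (simp add: ct pc pv built_def)
  qed
  then show "fst s' ''ct'' [M ! i] = (if cut i then 1 else 0)" "fst s' ''pc'' [M ! i] = num i - 1"
    "fst s' ''pv'' [M ! i] = M ! (i - 1)" by blast+
qed (rule c)

lemma ok_walk_body:
  assumes t: "t < n" and x: "fst s ''x'' [] = M ! t" and nx: "fst s ''nx'' [M ! t] = M ! Suc t"
    and built: "built t s" and acc: "snd s ''acc'' [] = acc t"
    and vx: "\<And>l. l < n \<Longrightarrow> fst s ''vx'' [l] = vx l"
    and D: "\<And>l. l < n \<Longrightarrow> fst s ''rk'' [l] < fst s ''N'' [] \<longleftrightarrow> l \<in> D"
    and d: "\<And>u v. u < n \<Longrightarrow> v < n \<Longrightarrow> snd s ''d'' [u, v] = d u v"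
    and X: "snd s ''X'' [] = X" and zero: "snd s ''z'' [] = 0"
  shows "ok z walk_body s (\<lambda>s. fst s ''x'' [] = M ! Suc t \<and> built (Suc t) s \<and> snd s ''acc'' [] = acc (Suc t))"
proof -
  define x' y' where "x' = M ! t" and "y' = M ! Suc t"
  have y: "y' < n" using M_less[of "Suc t"] t by (simp add: y'_def)
  \<comment> \<open>If \<open>y'\<close> is a head, its predecessor may be the sentinel, for which
    the cells hold no distance; the position is then cut whatever the comparison yields.\<close>
  have st: "snd s ''d'' [fst s ''vx'' [x'], vx y'] = step (Suc t)" if "y' \<notin> D"
  proof -
    have "0 < t" using that M_1 by (cases t) (auto simp: y'_def)
    then have "x' < n" using M_less[of t] t by (simp add: x'_def)
    then show ?thesis using vx d y vx_less by (simp add: step_def delta_def x'_def y'_def)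
  qed
  have cutc: "cut (Suc t) \<longleftrightarrow> y' \<in> D \<or> X < acc t + step (Suc t)" by (simp add: cut_def y'_def)
  have B: "fst s ''c'' [] = num t" using built by (simp add: built_def)
  note facts = x[folded x'_def] nx[folded x'_def y'_def] acc X zero B vx[OF y] D[OF y]
  show ?thesis
  proof (cases "y' \<in> D")
    case True
    then have c: "cut (Suc t)" by (simp add: cutc)
    show ?thesis
      unfolding walk_body_def
      by (intro ok_Seq ok_If ok_IAssign ok_RAssign conjI built_SucI[OF built t])
        (use facts True c in \<open>auto simp: upd_def y'_def[symmetric] x'_def[symmetric] acc_Suc simp del: acc.simps\<close>)
  next
    case False
    note st' = st[OF False]
    show ?thesis
    proof (cases "cut (Suc t)")
      case True
      then have "X < acc t + step (Suc t)" using False cutc by simp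
      then show ?thesis
        unfolding walk_body_def
        by (intro ok_Seq ok_If ok_IAssign ok_RAssign conjI built_SucI[OF built t])
          (use facts True False st' in \<open>auto simp: upd_def y'_def[symmetric] x'_def[symmetric] acc_Suc step_length_def simp del: acc.simps\<close>)
    next
      case nc: False
      then have "\<not> X < acc t + step (Suc t)" using False cutc by simp
      then show ?thesis
        unfolding walk_body_def
        by (intro ok_Seq ok_If ok_IAssign ok_RAssign conjI built_SucI[OF built t])
          (use facts nc False st' in \<open>auto simp: upd_def y'_def[symmetric] x'_def[symmetric] acc_Suc step_length_def simp del: acc.simps\<close>)
    qed
  qed
qed

lemma ok_walk:
  assumes n: "fst s ''n'' [] = n" and vx: "\<And>l. l < n \<Longrightarrow> fst s ''vx'' [l] = vx l"
    and D: "\<And>l. l < n \<Longrightarrow> fst s ''rk'' [l] < fst s ''N'' [] \<longleftrightarrow> l \<in> D" and z: "n \<le> z"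
    and d: "\<And>u v. u < n \<Longrightarrow> v < n \<Longrightarrow> snd s ''d'' [u, v] = d u v"
    and X: "snd s ''X'' [] = X" and zero: "snd s ''z'' [] = 0"
    and L: "successively (\<lambda>x y. fst s ''nx'' [x] = y) M"
  shows "ok z walk s (built n)"
proof -
  have nx: "fst s ''nx'' [M ! t] = M ! Suc t" if "t < n" for t
    using L that length_M by (auto simp: successively_conv_nth)
  have "ok z (For ''t'' (I ''n'' []) walk_body) s1 (built n)"
    if s1: "fst s1 ''x'' [] = n" "fst s1 ''c'' [] = 0" "snd s1 ''acc'' [] = 0" "same {''x'', ''c''} {''acc''} s s1" for s1
  proof (rule ok_For[where m = n and P = "\<lambda>t s. fst s ''x'' [] = M ! t \<and> built t s \<and> snd s ''acc'' [] = acc t"])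
    fix t s2 assume t: "t < n" and P: "fst s2 ''x'' [] = M ! t \<and> built t s2 \<and> snd s2 ''acc'' [] = acc t"
      and F: "same (insert ''t'' (iwrites walk_body)) (rwrites walk_body) s1 s2"
    show "ok z walk_body s2 (\<lambda>s. fst s ''x'' [] = M ! Suc t \<and> built (Suc t) s \<and> snd s ''acc'' [] = acc (Suc t))"
      using P t F s1(4) nx vx D d X zero by (intro ok_walk_body) (auto simp: same_def)
  next
    show "ival s2 (I ''n'' []) = n" if "same (insert ''t'' (iwrites walk_body)) (rwrites walk_body) s1 s2" for s2
      using that s1(4) n by (simp add: same_def)
  qed (use z s1 M_0 in \<open>auto simp: built_def upd_def\<close>)
  then show ?thesis
    unfolding walk_def by (intro ok_Seq ok_IAssign ok_RAssign) (use n zero in \<open>auto simp: upd_def same_def\<close>)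
qed

lemma ok_build:
  assumes n: "fst s ''n'' [] = n" and pa: "\<And>l. l < n \<Longrightarrow> fst s ''pa'' [l] = pa l" and vx: "\<And>l. l < n \<Longrightarrow> fst s ''vx'' [l] = vx l"
    and D: "\<And>l. l < n \<Longrightarrow> fst s ''rk'' [l] < fst s ''N'' [] \<longleftrightarrow> l \<in> D" and z: "n \<le> z"
    and d: "\<And>u v. u < n \<Longrightarrow> v < n \<Longrightarrow> snd s ''d'' [u, v] = d u v"
    and X: "snd s ''X'' [] = X" and zero: "snd s ''z'' [] = 0"
  shows "ok z build s (built n)"
  unfolding build_def
proof (rule ok_Seq, rule ok_mono[OF ok_link[OF n pa D z]], assumption, assumption)
  fix s1 assume "successively (\<lambda>x y. fst s1 ''nx'' [x] = y) M" "same (iwrites link) (rwrites link) s s1"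
  then show "ok z walk s1 (built n)"
    using n vx D z d X zero by (intro ok_walk) (auto simp: same_def)
qed

end


section \<open>Searching\<close>

definition doubled :: "rexp \<Rightarrow> rexp" where
  "doubled r = RPlus r r"

text \<open>Five doublings replace the factor 32, since the machine cannot multiply; it stores
  \<open>32 * \<rho>\<close> instead of \<rho>.\<close>

definition scaled :: "iexp \<Rightarrow> rexp" where
  "scaled i = doubled (doubled (doubled (doubled (doubled (R ''e'' [I ''so'' [i]])))))"

lemma rval_scaled [simp]: "rval s (scaled i) = 32 * snd s ''e'' [fst s ''so'' [ival s i]]"
  by (simp add: scaled_def doubled_def)

definition search_step :: com where
  "search_step = Seq (RAssign ''X'' [] (RPlus (R ''X'' []) (R ''X'' [])))
    (Seq (If (BAnd (ILess (N 1) (I ''N'' [])) (RLess (scaled (IMinus (I ''N'' []) (N 1))) (R ''X'' [])))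
      (Seq (IAssign ''N'' [] (IMinus (I ''N'' []) (N 1))) (RAssign ''X'' [] (scaled (I ''N'' [])))) Skip)
    build)"

definition search :: com where
  "search = Seq (If (ILess (I ''k'' []) (I ''n'' [])) (IAssign ''N'' [] (I ''k'' [])) (IAssign ''N'' [] (I ''n'' [])))
    (Seq (RAssign ''X'' [] (scaled (I ''N'' []))) (Seq build (While (ILess (I ''k'' []) (I ''c'' [])) search_step)))"

lemma writes_search [simp]:
  "iwrites search = {''i'', ''q'', ''nx'', ''x'', ''y'', ''c'', ''t'', ''ct'', ''pc'', ''pv'', ''N''}"
  "rwrites search = {''acc'', ''X''}"
  by (auto simp: search_def search_step_def)

context prim_order
begin

definition loaded :: "state \<Rightarrow> bool" where
  "loaded s \<longleftrightarrow> fst s ''n'' [] = n \<and> (\<forall>l<n. fst s ''vx'' [l] = vx l \<and> fst s ''pa'' [l] = pa l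
      \<and> fst s ''rk'' [l] = rk l \<and> fst s ''so'' [rk l] = l) \<and> (\<forall>l\<ge>n. fst s ''so'' [l] = 0)
    \<and> (\<forall>l<n. snd s ''e'' [l] = e l) \<and> (\<forall>u<n. \<forall>v<n. snd s ''d'' [u, v] = d u v) \<and> snd s ''z'' [] = 0"

lemma loaded_same:
  assumes "loaded s" "same A B s s'" "A \<inter> {''n'', ''vx'', ''pa'', ''rk'', ''so''} = {}" "B \<inter> {''e'', ''d'', ''z''} = {}"
  shows "loaded s'"
proof -
  have "fst s' x = fst s x" if "x \<in> {''n'', ''vx'', ''pa'', ''rk'', ''so''}" for x
    using assms(2,3) that unfolding same_def by blast
  moreover have "snd s' x = snd s x" if "x \<in> {''e'', ''d'', ''z''}" for x
    using assms(2,4) that unfolding same_def by blast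
  ultimately show ?thesis using assms(1) by (simp add: loaded_def)
qed

lemma loaded_rk_inv: "loaded s \<Longrightarrow> m < n \<Longrightarrow> fst s ''so'' [m] = rk_inv m"
  using rk_inv[of m] by (auto simp: loaded_def dest!: spec[of _ "rk_inv m"])

definition is_built :: "nat \<Rightarrow> real \<Rightarrow> state \<Rightarrow> bool" where
  "is_built q x s \<longleftrightarrow> prim_cut.built n d vx pa (top_ranked q) x n s"

lemma is_built_pieces:
  assumes "is_built q x s" "0 < q" "0 \<le> x"
  shows "fst s ''c'' [] = pieces q x"
proof -
  interpret prim_cut n d vx pa e "top_ranked q" x by (rule prim_cut_top[OF assms(2,3)])
  show ?thesis using assms(1) by (simp add: is_built_def built_def pieces_def)
qed

lemma pieces_le: "0 < q \<Longrightarrow> 0 \<le> x \<Longrightarrow> pieces q x \<le> n"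
proof -
  assume "0 < q" "0 \<le> x"
  then interpret prim_cut n d vx pa e "top_ranked q" x by (rule prim_cut_top)
  have "num n \<le> card {1..n}" unfolding num_conv_card by (intro card_mono) auto
  then show ?thesis by (simp add: pieces_def)
qed

definition located :: "nat \<Rightarrow> nat \<Rightarrow> real \<Rightarrow> state \<Rightarrow> bool" where
  "located k q x s \<longleftrightarrow> loaded s \<and> fst s ''k'' [] = k \<and> fst s ''N'' [] = q \<and> snd s ''X'' [] = x"

lemma ok_build_located:
  assumes "located k q x s" "0 < q" "0 \<le> x" "n \<le> z"
  shows "ok z build s (\<lambda>s. located k q x s \<and> is_built q x s)"
proof -
  interpret prim_cut n d vx pa e "top_ranked q" x by (rule prim_cut_top[OF assms(2,3)])
  have "ok z build s (built n)"
    using assms by (intro ok_build) (auto simp: located_def loaded_def top_ranked_def)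
  then show ?thesis
  proof (rule ok_mono)
    fix s' assume b: "built n s'" and F: "same (iwrites build) (rwrites build) s s'"
    have "loaded s'" using loaded_same[OF _ F] assms(1) by (simp add: located_def)
    then show "located k q x s' \<and> is_built q x s'"
      using b F assms(1) by (auto simp: located_def is_built_def same_def)
  qed
qed

text \<open>Round count: \<open>k - q\<close> and the number \<open>a\<close> of doublings since the
  last restored edge act as digits in base \<open>n + 1\<close>. With \<open>n \<le> k\<close> no
  count is kept, because at most \<open>n\<close> pieces arise and the loop is not entered.\<close>

definition progress :: "nat \<Rightarrow> nat \<Rightarrow> nat \<Rightarrow> real \<Rightarrow> bool" where
  "progress k j q x \<longleftrightarrow> n \<le> k \<and> q = n \<and> x = 0 \<or>
    (\<exists>a. search_inv k q (2 ^ a * e (rk_inv q)) \<and> x = 32 * (2 ^ a * e (rk_inv q)) \<and> j \<le> (k - q) * Suc n + a)"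

lemma progress_pos: "progress k j q x \<Longrightarrow> 0 < q \<and> 0 \<le> x"
  using n_pos e_nonneg rk_inv by (auto simp: progress_def search_inv_def)

lemma ok_search_step:
  assumes s: "located k q x s" "is_built q x s" and pr: "progress k j q x" and b: "k < fst s ''c'' []" and z: "n \<le> z"
  shows "j < k * Suc n"
    and "ok z search_step s (\<lambda>s. \<exists>q x. located k q x s \<and> is_built q x s \<and> progress k (Suc j) q x)"
proof -
  have c: "k < pieces q x" using is_built_pieces[OF s(2)] progress_pos[OF pr] b by simp
  have "pieces q x \<le> n" using pieces_le progress_pos[OF pr] by blast
  then have "k < n" using c by simp
  then obtain a where a: "search_inv k q (2 ^ a * e (rk_inv q))" "x = 32 * (2 ^ a * e (rk_inv q))" "j \<le> (k - q) * Suc n + a"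
    using pr by (auto simp: progress_def)
  define \<rho> where "\<rho> = 2 ^ a * e (rk_inv q)"
  have q: "0 < q" "q \<le> k" "q < n" using a(1) by (auto simp: search_inv_def)
  have inv: "search_inv k q \<rho>" and x: "x = 32 * \<rho>" using a by (simp_all add: \<rho>_def)
  have an: "a < n" using doubling_bound[OF inv] c x by (simp add: \<rho>_def)
  \<comment> \<open>As \<open>q\<close> stays positive, the leading digit \<open>k - q\<close> is
    below \<open>k\<close>, which leaves room for the last digit.\<close>
  have kq: "(k - q) * Suc n + Suc n \<le> k * Suc n"
  proof -
    have "Suc (k - q) * Suc n \<le> k * Suc n" using q by (intro mult_le_mono1) simp
    then show ?thesis by simp
  qed
  show "j < k * Suc n" using a(3) an kq by simp
  have pos: "0 < \<rho>" by (rule search_inv_pos[OF inv])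
  have ld: "loaded s" "fst s ''k'' [] = k" "fst s ''N'' [] = q" "snd s ''X'' [] = 32 * \<rho>"
    using s(1) x by (auto simp: located_def)
  have len: "snd s ''e'' [fst s ''so'' [m]] = e (rk_inv m)" if "m < n" for m
    using loaded_rk_inv[OF ld(1) that] rk_inv[OF that] ld(1) by (simp add: loaded_def)
  have lo: "loaded (fst s, upd (snd s) ''X'' [] v)" "loaded (upd (fst s) ''N'' [] m, upd (snd s) ''X'' [] v)" for v m
    by (rule loaded_same[OF ld(1), where A = "{''N''}" and B = "{''X''}"]; simp add: same_def upd_def)+
  show "ok z search_step s (\<lambda>s. \<exists>q x. located k q x s \<and> is_built q x s \<and> progress k (Suc j) q x)"
  proof (cases "1 < q \<and> e (rk_inv (q - 1)) < 2 * \<rho>")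
    case True
    \<comment> \<open>The count of doublings restarts at 0, because the new scale is the key of the
      restored edge.\<close>
    then have inv': "search_inv k (q - 1) (2 ^ 0 * e (rk_inv (q - 1)))" using search_inv_merge[OF inv] c x by simp
    have "j \<le> (k - q) * Suc n + n" using a(3) an by simp
    moreover have "k - (q - 1) = Suc (k - q)" using q True by simp
    ultimately have "Suc j \<le> (k - (q - 1)) * Suc n + 0" by simp
    then have pr': "progress k (Suc j) (q - 1) (32 * (2 ^ 0 * e (rk_inv (q - 1))))"
      unfolding progress_def using inv' by blast
    let ?s = "(upd (fst s) ''N'' [] (q - 1), upd (snd s) ''X'' [] (32 * (2 ^ 0 * e (rk_inv (q - 1)))))"
    have loc: "located k (q - 1) (32 * (2 ^ 0 * e (rk_inv (q - 1)))) ?s"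
      using lo ld by (simp add: located_def upd_def)
    have "ok z build ?s (\<lambda>s. located k (q - 1) (32 * (2 ^ 0 * e (rk_inv (q - 1)))) s \<and> is_built (q - 1) (32 * (2 ^ 0 * e (rk_inv (q - 1)))) s)"
      using ok_build_located[OF loc] progress_pos[OF pr'] z by blast
    then have *: "ok z build ?s (\<lambda>s. \<exists>q x. located k q x s \<and> is_built q x s \<and> progress k (Suc j) q x)"
      by (rule ok_mono) (use pr' in blast)
    have "(upd (snd s) ''X'' [] v)(''X'' := ((upd (snd s) ''X'' [] v) ''X'')([] := w)) = upd (snd s) ''X'' [] w" for v w
      by (simp add: upd_def)
    then show ?thesis
      unfolding search_step_def
      by (intro ok_Seq ok_If ok_RAssign ok_IAssign ok_Skip)
        (use * ld len[of "q - 1"] q True in \<open>auto simp: upd_def\<close>)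
  next
    case False
    then have inv': "search_inv k q (2 ^ Suc a * e (rk_inv q))"
      using search_inv_double[OF inv] c x by (auto simp: \<rho>_def mult.assoc)
    then have pr': "progress k (Suc j) q (64 * \<rho>)"
      unfolding progress_def using a(3) by (intro disjI2 exI[of _ "Suc a"]) (simp add: \<rho>_def)
    let ?s = "(fst s, upd (snd s) ''X'' [] (64 * \<rho>))"
    have loc: "located k q (64 * \<rho>) ?s"
      using lo ld by (simp add: located_def upd_def)
    have "ok z build ?s (\<lambda>s. located k q (64 * \<rho>) s \<and> is_built q (64 * \<rho>) s)"
      using ok_build_located[OF loc] progress_pos[OF pr'] z by blast
    then have *: "ok z build ?s (\<lambda>s. \<exists>q x. located k q x s \<and> is_built q x s \<and> progress k (Suc j) q x)"
      by (rule ok_mono) (use pr' in blast)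
    show ?thesis
      unfolding search_step_def
      by (intro ok_Seq ok_If ok_RAssign ok_IAssign ok_Skip)
        (use * ld len[of "q - 1"] q False in \<open>auto simp: upd_def\<close>)
  qed
qed

lemma ok_search:
  assumes ld: "loaded s" "fst s ''k'' [] = k" and k: "0 < k" and z: "n \<le> z" "k \<le> z"
  shows "ok z search s (\<lambda>s. \<exists>q \<rho>. loaded s \<and> fst s ''k'' [] = k \<and> is_built q (32 * \<rho>) s
    \<and> 0 < q \<and> 0 \<le> \<rho> \<and> pieces q (32 * \<rho>) \<le> k \<and> (search_inv k q \<rho> \<or> n \<le> k \<and> q = n))"
proof -
  define q where "q = min k n"
  define x where "x = (if k < n then 32 * e (rk_inv k) else 0)"
  have pr: "progress k 0 q x"
  proof (cases "k < n")
    case True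
    then show ?thesis
      unfolding progress_def using search_inv_init[OF k] by (intro disjI2 exI[of _ 0]) (simp add: q_def x_def)
  qed (simp add: progress_def q_def x_def)
  let ?s = "(upd (fst s) ''N'' [] q, upd (snd s) ''X'' [] x)"
  have lo: "loaded ?s"
    by (rule loaded_same[OF ld(1), where A = "{''N''}" and B = "{''X''}"]) (auto simp: same_def upd_def)
  then have loc: "located k q x ?s" using ld by (simp add: located_def upd_def)
  have xx: "32 * snd s ''e'' [fst s ''so'' [q]] = x"
    using ld(1) loaded_rk_inv[OF ld(1), of k] rk_inv[of k] n_pos e_0 by (auto simp: q_def x_def loaded_def)
  let ?Q = "\<lambda>s. \<exists>q \<rho>. loaded s \<and> fst s ''k'' [] = k \<and> is_built q (32 * \<rho>) s
    \<and> 0 < q \<and> 0 \<le> \<rho> \<and> pieces q (32 * \<rho>) \<le> k \<and> (search_inv k q \<rho> \<or> n \<le> k \<and> q = n)"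
  have W: "ok z (While (ILess (I ''k'' []) (I ''c'' [])) search_step) s1 ?Q"
    if s1: "located k q x s1 \<and> is_built q x s1" for s1
  proof (rule ok_mono[OF ok_While[where P = "\<lambda>j s. \<exists>q x. located k q x s \<and> is_built q x s \<and> progress k j q x"]])
    show "\<exists>q x. located k q x s1 \<and> is_built q x s1 \<and> progress k 0 q x" using s1 pr by blast
    fix j s2 assume "\<exists>q x. located k q x s2 \<and> is_built q x s2 \<and> progress k j q x" "bval s2 (ILess (I ''k'' []) (I ''c'' []))"
    then obtain q x where P: "located k q x s2" "is_built q x s2" "progress k j q x" and "k < fst s2 ''c'' []"
      by (auto simp: located_def)
    note st = ok_search_step[OF this z(1)]
    have "k * Suc n \<le> Suc z * Suc z" using z by (intro mult_le_mono) auto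
    then show "j < Suc z * Suc z \<and> ok z search_step s2 (\<lambda>s. \<exists>q x. located k q x s \<and> is_built q x s \<and> progress k (Suc j) q x)"
      using st by (auto intro: less_le_trans)
  next
    fix s2 assume "\<not> bval s2 (ILess (I ''k'' []) (I ''c'' [])) \<and> (\<exists>j q x. located k q x s2 \<and> is_built q x s2 \<and> progress k j q x)"
    then obtain j q x where P: "located k q x s2" "is_built q x s2" "progress k j q x" "fst s2 ''c'' [] \<le> k"
      by (auto simp: located_def not_less)
    then have "pieces q (32 * (x / 32)) \<le> k" "is_built q (32 * (x / 32)) s2" "0 < q" "0 \<le> x / 32"
      using is_built_pieces[OF P(2)] progress_pos[OF P(3)] by auto
    moreover have "search_inv k q (x / 32) \<or> n \<le> k \<and> q = n" using P(3) by (auto simp: progress_def)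
    ultimately show "?Q s2"
      using P(1) unfolding located_def by (intro exI[of _ q] exI[of _ "x / 32"]) blast
  qed
  have "ok z build ?s (\<lambda>s. located k q x s \<and> is_built q x s)"
    using ok_build_located[OF loc] progress_pos[OF pr] z by blast
  then have "ok z (Seq build (While (ILess (I ''k'' []) (I ''c'' [])) search_step)) ?s ?Q"
    by (intro ok_Seq) (elim ok_mono, rule W)
  then have B: "ok z (Seq build (While (ILess (I ''k'' []) (I ''c'' [])) search_step)) t ?Q" if "t = ?s" for t
    using that by simp
  have nn: "fst s ''n'' [] = n" using ld(1) by (simp add: loaded_def)
  show ?thesis
    unfolding search_def
    by (intro ok_Seq[of _ "If _ _ _"] ok_Seq[of _ "RAssign _ _ _"] ok_If ok_IAssign ok_RAssign B)
      (use ld(2) nn xx in \<open>auto simp: upd_def q_def\<close>)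
qed

end


section \<open>Writing the cover\<close>

definition write_edge :: com where
  "write_edge = Seq (IAssign ''u'' [] (I ''vx'' [I ''pv'' [I ''i'' []]])) (Seq (IAssign ''w'' [] (I ''vx'' [I ''i'' []]))
    (If (ILess (I ''u'' []) (I ''w'' []))
      (IAssign ''E'' [I ''pc'' [I ''i'' []], I ''u'' [], I ''w'' []] (N 1))
      (IAssign ''E'' [I ''pc'' [I ''i'' []], I ''w'' [], I ''u'' []] (N 1))))"

definition emit_body :: com where
  "emit_body = Seq (IAssign ''V'' [I ''pc'' [I ''i'' []], I ''vx'' [I ''i'' []]] (N 1))
    (If (ILess (I ''ct'' [I ''i'' []]) (N 1)) write_edge Skip)"

text \<open>Missing trees are copies of the single vertex 0, which cost nothing.\<close>

definition pad_body :: com where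
  "pad_body = If (ILess (I ''i'' []) (I ''c'' [])) Skip (IAssign ''V'' [I ''i'' [], N 0] (N 1))"

definition emit :: com where
  "emit = Seq (For ''i'' (I ''n'' []) emit_body) (For ''i'' (I ''k'' []) pad_body)"

lemma writes_emit_body [simp]: "iwrites emit_body = {''V'', ''E'', ''u'', ''w''}" "rwrites emit_body = {}"
  by (auto simp: emit_body_def write_edge_def)

lemma writes_pad_body [simp]: "iwrites pad_body = {''V''}" "rwrites pad_body = {}"
  by (auto simp: pad_body_def)

definition written :: "state \<Rightarrow> nat \<Rightarrow> state \<Rightarrow> bool" where
  "written s\<^sub>0 i s \<longleftrightarrow>
    (\<forall>j v. fst s ''V'' [j, v] = (if \<exists>y<i. fst s\<^sub>0 ''pc'' [y] = j \<and> fst s\<^sub>0 ''vx'' [y] = v then 1 else 0)) \<and>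
    (\<forall>j u v. u < v \<longrightarrow> fst s ''E'' [j, u, v] = (if \<exists>y<i. fst s\<^sub>0 ''ct'' [y] = 0 \<and> fst s\<^sub>0 ''pc'' [y] = j
      \<and> {u, v} = {fst s\<^sub>0 ''vx'' [fst s\<^sub>0 ''pv'' [y]], fst s\<^sub>0 ''vx'' [y]} then 1 else 0))"

lemma ex_less_Suc: "(\<exists>y<Suc i. P y) \<longleftrightarrow> P i \<or> (\<exists>y<i. P y)"
  by (auto simp: less_Suc_eq)

lemma ok_emit_body:
  assumes w: "written s\<^sub>0 i s" and i: "fst s ''i'' [] = i"
    and eq: "\<And>x. x \<in> {''pc'', ''vx'', ''ct'', ''pv''} \<Longrightarrow> fst s x = fst s\<^sub>0 x"
  shows "ok z emit_body s (written s\<^sub>0 (Suc i))"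
proof -
  define j a b where "j = fst s\<^sub>0 ''pc'' [i]" and "a = fst s\<^sub>0 ''vx'' [fst s\<^sub>0 ''pv'' [i]]" and "b = fst s\<^sub>0 ''vx'' [i]"
  have eqs: "fst s ''pc'' [i] = j" "fst s ''vx'' [fst s ''pv'' [i]] = a" "fst s ''vx'' [i] = b" "fst s ''ct'' [i] = fst s\<^sub>0 ''ct'' [i]"
    by (simp_all add: eq j_def a_def b_def)
  have V: "fst s ''V'' [j', v] = (if \<exists>y<i. fst s\<^sub>0 ''pc'' [y] = j' \<and> fst s\<^sub>0 ''vx'' [y] = v then 1 else 0)" for j' v
    using w by (simp add: written_def)
  have E: "fst s ''E'' [j', u, v] = (if \<exists>y<i. fst s\<^sub>0 ''ct'' [y] = 0 \<and> fst s\<^sub>0 ''pc'' [y] = j'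
      \<and> {u, v} = {fst s\<^sub>0 ''vx'' [fst s\<^sub>0 ''pv'' [y]], fst s\<^sub>0 ''vx'' [y]} then 1 else 0)" if "u < v" for j' u v
    using w that by (simp add: written_def)
  have if_disj: "(if P then 1 else if Q then 1 else 0) = (if P \<or> Q then 1 else (0::nat))" for P Q
    by simp
  have goal: "written s\<^sub>0 (Suc i) s'"
    if V': "fst s' ''V'' = (fst s ''V'')([j, b] := 1)"
      and E': "\<And>j' u v. u < v \<Longrightarrow> fst s' ''E'' [j', u, v] =
        (if fst s\<^sub>0 ''ct'' [i] = 0 \<and> j = j' \<and> {u, v} = {a, b} then 1 else fst s ''E'' [j', u, v])" for s'
    unfolding written_def ex_less_Suc
  proof (intro conjI allI impI)
    show "fst s' ''V'' [j', v] = (if fst s\<^sub>0 ''pc'' [i] = j' \<and> fst s\<^sub>0 ''vx'' [i] = v \<or>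
        (\<exists>y<i. fst s\<^sub>0 ''pc'' [y] = j' \<and> fst s\<^sub>0 ''vx'' [y] = v) then 1 else 0)" for j' v
      unfolding V' using V[of j' v] by (auto simp: j_def b_def)
    show "fst s' ''E'' [j', u, v] = (if (fst s\<^sub>0 ''ct'' [i] = 0 \<and> fst s\<^sub>0 ''pc'' [i] = j'
        \<and> {u, v} = {fst s\<^sub>0 ''vx'' [fst s\<^sub>0 ''pv'' [i]], fst s\<^sub>0 ''vx'' [i]}) \<or>
        (\<exists>y<i. fst s\<^sub>0 ''ct'' [y] = 0 \<and> fst s\<^sub>0 ''pc'' [y] = j'
        \<and> {u, v} = {fst s\<^sub>0 ''vx'' [fst s\<^sub>0 ''pv'' [y]], fst s\<^sub>0 ''vx'' [y]}) then 1 else 0)" if "u < v" for j' u v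
      unfolding E'[OF that] E[OF that] j_def a_def b_def if_disj ..
  qed
  show ?thesis
    unfolding emit_body_def write_edge_def
    by (intro ok_Seq ok_If ok_IAssign ok_Skip goal)
      (use i eqs in \<open>auto simp: upd_def doubleton_eq_iff\<close>)
qed

lemma ok_emit:
  assumes n: "fst s ''n'' [] = n" and k: "fst s ''k'' [] = k" and c: "fst s ''c'' [] = c"
    and init: "\<And>l. fst s ''V'' l = 0" "\<And>l. fst s ''E'' l = 0" and z: "n \<le> z" "k \<le> z"
  shows "ok z emit s (\<lambda>s'. (\<forall>j v. fst s' ''V'' [j, v] = (if (c \<le> j \<and> j < k \<and> v = 0) \<or>
      (\<exists>y<n. fst s ''pc'' [y] = j \<and> fst s ''vx'' [y] = v) then 1 else 0)) \<and>
    (\<forall>j u v. u < v \<longrightarrow> fst s' ''E'' [j, u, v] = (if \<exists>y<n. fst s ''ct'' [y] = 0 \<and> fst s ''pc'' [y] = j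
      \<and> {u, v} = {fst s ''vx'' [fst s ''pv'' [y]], fst s ''vx'' [y]} then 1 else 0)))"
  unfolding emit_def
proof (rule ok_Seq, rule ok_For[where m = n and P = "written s"])
  fix i s1 assume i: "i < n" "written s i s1" "fst s1 ''i'' [] = i"
    and F: "same (insert ''i'' (iwrites emit_body)) (rwrites emit_body) s s1"
  have "fst s1 x = fst s x" if "x \<in> {''pc'', ''vx'', ''ct'', ''pv''}" for x
    by (rule same_fst[OF F]) (use that in auto)
  then show "ok z emit_body s1 (written s (Suc i))" using i by (intro ok_emit_body) auto
next
  fix s1 assume w: "written s n s1" and F1: "same (insert ''i'' (iwrites emit_body)) (rwrites emit_body) s s1"
  let ?V = "\<lambda>i s'. \<forall>j v. fst s' ''V'' [j, v] = (if (c \<le> j \<and> j < i \<and> v = 0) \<or>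
      (\<exists>y<n. fst s ''pc'' [y] = j \<and> fst s ''vx'' [y] = v) then 1 else 0)"
  show "ok z (For ''i'' (I ''k'' []) pad_body) s1 (\<lambda>s'. ?V k s' \<and>
    (\<forall>j u v. u < v \<longrightarrow> fst s' ''E'' [j, u, v] = (if \<exists>y<n. fst s ''ct'' [y] = 0 \<and> fst s ''pc'' [y] = j
      \<and> {u, v} = {fst s ''vx'' [fst s ''pv'' [y]], fst s ''vx'' [y]} then 1 else 0)))"
  proof (rule ok_For[where m = k and P = ?V])
    fix i s2 assume i: "i < k" "?V i s2" "fst s2 ''i'' [] = i"
      and F: "same (insert ''i'' (iwrites pad_body)) (rwrites pad_body) s1 s2"
    have c2: "fst s2 ''c'' [] = c" using F F1 c by (simp add: same_def)
    show "ok z pad_body s2 (?V (Suc i))"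
      unfolding pad_body_def
      by (intro ok_If ok_IAssign ok_Skip) (use i c2 in \<open>auto simp: upd_def less_Suc_eq\<close>)
  next
    fix s2 assume "?V k s2" and F: "same (insert ''i'' (iwrites pad_body)) (rwrites pad_body) s1 s2"
    moreover have "fst s2 ''E'' = fst s1 ''E''" using F by (simp add: same_def)
    ultimately show "?V k s2 \<and> (\<forall>j u v. u < v \<longrightarrow> fst s2 ''E'' [j, u, v] = (if \<exists>y<n. fst s ''ct'' [y] = 0 \<and> fst s ''pc'' [y] = j
      \<and> {u, v} = {fst s ''vx'' [fst s ''pv'' [y]], fst s ''vx'' [y]} then 1 else 0))"
      using w by (simp add: written_def)
  next
    show "?V 0 s1" using w by (simp add: written_def)
  qed (use k z F1 in \<open>auto simp: same_def upd_def\<close>)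
qed (use n z init in \<open>auto simp: same_def upd_def written_def\<close>)

section \<open>The pieces as trees\<close>

lemma is_tree_singleton: "0 < n \<Longrightarrow> is_tree {..<n} ({0::nat}, {})"
  by (auto simp: is_tree_def subgraph_of_complete_def connected_graph_def is_cycle_def intro!: exI[of _ 0])

context prim_cut
begin

definition point :: "nat \<Rightarrow> nat" where
  "point t = vx (M ! t)"

definition members :: "nat \<Rightarrow> nat set" where
  "members j = {t\<in>{1..n}. num t = Suc j}"

definition piece :: "nat \<Rightarrow> nat ugraph" where
  "piece j = (point ` members j, {(u, v). u < v \<and> (\<exists>t\<in>members j. \<not> cut t \<and> {u, v} = {point (t - 1), point t})})"

lemma num_pos: "1 \<le> t \<Longrightarrow> 1 \<le> num t"
  using num_mono[of 1 t] cut_1 by simp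

lemma ex_cut:
  assumes "j < num n"
  shows "\<exists>r\<in>members j. cut r"
proof -
  \<comment> \<open>The first position where \<open>num\<close> reaches \<open>Suc j\<close>; since
    \<open>num\<close> grows by one and only at cuts, it is a cut of this piece.\<close>
  define r where "r = (LEAST t. Suc j \<le> num t)"
  have r: "Suc j \<le> num r" unfolding r_def by (rule LeastI[of _ n]) (use assms in simp)
  have min: "\<not> Suc j \<le> num t" if "t < r" for t using that not_less_Least unfolding r_def by blast
  have "r \<noteq> 0" using r by (cases r) auto
  then obtain r' where r': "r = Suc r'" by (cases r) auto
  have "r \<le> n" unfolding r_def by (rule Least_le) (use assms in simp)
  moreover have "cut r" "num r = Suc j" using r min[of r'] r' by (auto split: if_splits)
  ultimately show ?thesis using r' by (auto simp: members_def)
qed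

text \<open>A later cut would have raised \<open>num\<close> and opened another piece.\<close>

lemma cut_unique:
  assumes "r \<in> members j" "t \<in> members j" "cut r" "cut t"
  shows "r = t"
proof -
  have False if rt: "r < t" "r \<in> members j" "t \<in> members j" "cut t" for r t
  proof -
    obtain t' where t': "t = Suc t'" using rt(1) by (cases t) auto
    then have "num r \<le> num t'" using rt(1) by (intro num_mono) simp
    then show False using rt t' by (auto simp: members_def)
  qed
  then show ?thesis using assms by (metis linorder_neqE_nat)
qed

lemma pred_member:
  assumes t: "t \<in> members j" "\<not> cut t"
  shows "t - 1 \<in> members j" "t - 1 < t"
proof -
  obtain t' where t': "t = Suc t'" using t by (cases t) (auto simp: members_def)
  then have "1 \<le> t'" using t cut_1 by (cases t') auto
  then show "t - 1 \<in> members j" "t - 1 < t" using t t' by (auto simp: members_def)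
qed

text \<open>A piece is a path along the tour: its only cut is the root, and \<open>t - 1\<close> is
  the parent of \<open>t\<close>.\<close>

lemma piece_tree:
  assumes j: "j < num n"
  shows "is_tree {..<n} (piece j)" and "weight d (piece j) = piece_weight (Suc j) n"
proof -
  obtain r where r: "r \<in> members j" "cut r" using ex_cut[OF j] by blast
  have inj: "inj_on point (members j)"
  proof (rule inj_onI)
    fix t t' assume t: "t \<in> members j" "t' \<in> members j" "point t = point t'"
    then have "M ! t = M ! t'"
      using inj_onD[OF bij_betw_imp_inj_on[OF vx], of "M ! t" "M ! t'"] M_less by (simp add: point_def members_def)
    then show "t = t'" using t M_inj[of t t'] by (simp add: members_def)
  qed
  have sub: "point ` members j \<subseteq> {..<n}"
    using M_less vx_less by (auto simp: point_def members_def)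
  have nc: "\<not> cut t" if "t \<in> members j" "t \<noteq> r" for t using cut_unique[OF that(1) r(1)] r(2) that(2) by blast
  have par: "t - 1 \<in> members j \<and> t - 1 < t" if "t \<in> members j" "t \<noteq> r" for t
    using pred_member that nc by blast
  have edges: "{(u, v). u < v \<and> (\<exists>t\<in>members j. \<not> cut t \<and> {u, v} = {point (t - 1), point t})}
      = {(u, v). u < v \<and> (\<exists>t\<in>members j - {r}. {u, v} = {point (t - 1), point t})}"
    using nc r by blast
  show "is_tree {..<n} (piece j)"
    unfolding piece_def edges by (rule is_tree_parent_graph[where h = id]) (use inj sub r par in auto)
  have "weight d (piece j) = (\<Sum>t\<in>members j - {r}. d (point (t - 1)) (point t))"
    unfolding piece_def edges
    by (rule weight_parent_graph[where h = id and V = "{..<n}"]) (use inj sub r par d_commute in auto)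
  also have "\<dots> = (\<Sum>t\<in>{s\<in>{1..n}. \<not> cut s \<and> num s = Suc j}. step t)"
    using nc r by (intro sum.cong) (auto simp: members_def step_def delta_def point_def)
  finally show "weight d (piece j) = piece_weight (Suc j) n" by (simp add: piece_weight_def)
qed

lemma Union_pieces: "(\<Union>j<num n. fst (piece j)) = {..<n}"
proof
  show "{..<n} \<subseteq> (\<Union>j<num n. fst (piece j))"
  proof
    fix v assume "v \<in> {..<n}"
    then have v: "rank_of v < n" "vx (rank_of v) = v" using rank_of[of v] by auto
    then obtain t where t: "t \<in> {1..n}" "M ! t = rank_of v" using bij_M by (metis bij_betw_def imageE lessThan_iff)
    then have "t \<in> members (num t - 1)" "point t = v" "num t - 1 < num n"
      using num_pos[of t] num_mono[of t n] v by (auto simp: members_def point_def)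
    then show "v \<in> (\<Union>j<num n. fst (piece j))" by (auto simp: piece_def)
  qed
  show "(\<Union>j<num n. fst (piece j)) \<subseteq> {..<n}"
    using M_less vx_less by (auto simp: piece_def point_def members_def)
qed

lemma output_tree_eq:
  assumes b: "built n s" and vx: "\<And>l. l < n \<Longrightarrow> fst s ''vx'' [l] = vx l" and j: "j < k"
    and V: "\<And>v. fst s' ''V'' [j, v] = (if (num n \<le> j \<and> j < k \<and> v = 0) \<or>
      (\<exists>y<n. fst s ''pc'' [y] = j \<and> fst s ''vx'' [y] = v) then 1 else 0)"
    and E: "\<And>u v. u < v \<Longrightarrow> fst s' ''E'' [j, u, v] = (if \<exists>y<n. fst s ''ct'' [y] = 0 \<and> fst s ''pc'' [y] = j
      \<and> {u, v} = {fst s ''vx'' [fst s ''pv'' [y]], fst s ''vx'' [y]} then 1 else 0)"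
  shows "output_tree n s' j = (if j < num n then piece j else ({0}, {}))"
proof -
  \<comment> \<open>The machine tables are indexed by positions in Prim's order, the pieces by
    positions in the tour; \<open>bij_M\<close> translates.\<close>
  have ex: "(\<exists>y<n. P y) \<longleftrightarrow> (\<exists>t\<in>{1..n}. P (M ! t))" for P
  proof -
    have "(\<exists>y<n. P y) \<longleftrightarrow> (\<exists>y\<in>(\<lambda>t. M ! t) ` {1..n}. P y)" using bij_M by (auto simp: bij_betw_def)
    then show ?thesis by simp
  qed
  have pc: "fst s ''pc'' [M ! t] = j \<longleftrightarrow> t \<in> members j" if "t \<in> {1..n}" for t
    using b that num_pos[of t] by (auto simp: built_def members_def)
  have vxM: "fst s ''vx'' [M ! t] = point t" if "t \<in> {1..n}" for t
    using vx M_less[of t] that by (simp add: point_def)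
  have sub: "members j \<subseteq> {1..n}" by (auto simp: members_def)
  have V': "(\<exists>y<n. fst s ''pc'' [y] = j \<and> fst s ''vx'' [y] = v) \<longleftrightarrow> v \<in> point ` members j" for v
    unfolding ex using pc vxM sub by (auto simp: image_iff)
  have E': "(\<exists>y<n. fst s ''ct'' [y] = 0 \<and> fst s ''pc'' [y] = j
      \<and> {u, v} = {fst s ''vx'' [fst s ''pv'' [y]], fst s ''vx'' [y]})
      \<longleftrightarrow> (\<exists>t\<in>members j. \<not> cut t \<and> {u, v} = {point (t - 1), point t})" for u v
  proof -
    have "(fst s ''ct'' [M ! t] = 0 \<and> fst s ''pc'' [M ! t] = j
      \<and> {u, v} = {fst s ''vx'' [fst s ''pv'' [M ! t]], fst s ''vx'' [M ! t]})
      \<longleftrightarrow> t \<in> members j \<and> \<not> cut t \<and> {u, v} = {point (t - 1), point t}" if t: "t \<in> {1..n}" for t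
    \<comment> \<open>Only at an uncut position is the predecessor surely a genuine index; otherwise
      the flag \<open>ct\<close> or the piece number already decides.\<close>
    proof (cases "t \<in> members j \<and> \<not> cut t")
      case True
      then have "t - 1 \<in> {1..n}" using pred_member(1)[of t j] sub by blast
      then show ?thesis using True t b vxM[of t] vxM[of "t - 1"] pc[OF t] by (simp add: built_def)
    next
      case False
      then show ?thesis using t b pc[OF t] by (auto simp: built_def)
    qed
    then show ?thesis unfolding ex using sub by blast
  qed
  have none: "members j = {}" if "\<not> j < num n"
    using that num_mono[of _ n] by (fastforce simp: members_def)
  have pn: "point t < n" if "t \<in> members j" for t
    using that M_less vx_less by (auto simp: point_def members_def)
  have "{v. v < n \<and> fst s' ''V'' [j, v] = 1} = (if j < num n then point ` members j else {0})"
    unfolding V V' using pn none n_pos j by auto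
  moreover have "{(u, v). u < v \<and> v < n \<and> fst s' ''E'' [j, u, v] = 1}
      = {(u, v). u < v \<and> (\<exists>t\<in>members j. \<not> cut t \<and> {u, v} = {point (t - 1), point t})}"
  proof -
    have "v < n" if "t \<in> members j" "\<not> cut t" "{u, v} = {point (t - 1), point t}" for t u v
      using that pn pred_member(1)[OF that(1,2)] by (auto simp: doubleton_eq_iff)
    moreover have "fst s' ''E'' [j, u, v] = 1 \<longleftrightarrow> (\<exists>t\<in>members j. \<not> cut t \<and> {u, v} = {point (t - 1), point t})"
      if "u < v" for u v
      unfolding E[OF that] E' by simp
    ultimately show ?thesis by blast
  qed
  ultimately show ?thesis using none by (auto simp: output_tree_def piece_def)
qed

end

lemma le_OPT:
  fixes V :: "'a::linorder set"
  assumes "finite V" "V \<noteq> {}" "k \<ge> 1" and le: "\<And>Ts. tree_cover V k Ts \<Longrightarrow> x \<le> lp_cost p d Ts"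
  shows "x \<le> OPT p V d k"
proof -
  have "OPT p V d k \<in> lp_cost p d ` {Ts. tree_cover V k Ts}"
    unfolding OPT_def using assms(1-3) tree_cover_exists by (intro Min_in finite_imageI finite_tree_covers) auto
  then show ?thesis using le by auto
qed

section \<open>The complete algorithm and its guarantee\<close>

definition algorithm :: com where
  "algorithm = Seq prim (Seq rank (Seq search emit))"

context prim_order
begin

lemma emitted_cover:
  assumes b: "is_built q (32 * \<rho>) s" "0 < q" "0 \<le> \<rho>" and m: "pieces q (32 * \<rho>) \<le> k"
    and inv: "search_inv k q \<rho> \<or> n \<le> k \<and> q = n" and k: "0 < k"
    and vx: "\<And>l. l < n \<Longrightarrow> fst s ''vx'' [l] = vx l"
    and V: "\<forall>j v. fst s' ''V'' [j, v] = (if (pieces q (32 * \<rho>) \<le> j \<and> j < k \<and> v = 0) \<or>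
      (\<exists>y<n. fst s ''pc'' [y] = j \<and> fst s ''vx'' [y] = v) then 1 else 0)"
    and E: "\<forall>j u v. u < v \<longrightarrow> fst s' ''E'' [j, u, v] = (if \<exists>y<n. fst s ''ct'' [y] = 0 \<and> fst s ''pc'' [y] = j
      \<and> {u, v} = {fst s ''vx'' [fst s ''pv'' [y]], fst s ''vx'' [y]} then 1 else 0)"
  shows "tree_cover {..<n} k (output_trees n k s')"
    and "1 \<le> p \<Longrightarrow> lp_cost p d (output_trees n k s') \<le> 64 * OPT p {..<n} d k"
proof -
  interpret prim_cut n d vx pa e "top_ranked q" "32 * \<rho>" by (rule prim_cut_top) (use b in auto)
  have m': "num n \<le> k" "pieces q (32 * \<rho>) = num n" using m by (simp_all add: pieces_def)
  define T where "T j = (if j < num n then piece j else ({0::nat}, {}))" for j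
  have "output_tree n s' j = T j" if "j < k" for j
    unfolding T_def
    by (rule output_tree_eq[OF _ vx that]) (use b(1) V E m'(2) in \<open>auto simp: is_built_def\<close>)
  then have out: "output_trees n k s' = map T [0..<k]" by (simp add: output_trees_def)
  have tree: "is_tree {..<n} (T j)" for j
    using piece_tree(1) is_tree_singleton[OF n_pos] by (simp add: T_def)
  have "(\<Union>j<k. fst (T j)) = {..<n}"
  proof
    show "(\<Union>j<k. fst (T j)) \<subseteq> {..<n}"
      using tree_facts(1)[OF tree] by blast
    have "(\<Union>j<num n. fst (piece j)) \<subseteq> (\<Union>j<k. fst (T j))"
      using m' by (fastforce simp: T_def)
    then show "{..<n} \<subseteq> (\<Union>j<k. fst (T j))" by (simp add: Union_pieces)
  qed
  then show "tree_cover {..<n} k (output_trees n k s')"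
    using tree by (auto simp: tree_cover_def out lessThan_atLeast0)
  assume p: "1 \<le> p"
  \<comment> \<open>Padding trees have no edges and \<open>0 powr p\<close> is 0, so they drop
    out.\<close>
  have "(\<Sum>i<k. weight d (T i) powr p) = (\<Sum>i<num n. weight d (T i) powr p)"
    using m' by (intro sum.mono_neutral_right) (auto simp: T_def weight_def)
  also have "\<dots> = (\<Sum>i<num n. piece_weight (Suc i) n powr p)"
    by (intro sum.cong) (auto simp: T_def piece_tree(2))
  also have "\<dots> = (\<Sum>j\<in>{1..num n}. piece_weight j n powr p)"
    by (simp add: sum.atLeast1_atMost_eq)
  finally have cost: "lp_cost p d (output_trees n k s') = (\<Sum>j\<in>{1..num n}. piece_weight j n powr p) powr (1 / p)"
    by (simp add: lp_cost_def out)
  have "lp_cost p d (output_trees n k s') / 64 \<le> OPT p {..<n} d k"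
  proof (rule le_OPT)
    show "finite {..<n}" "{..<n} \<noteq> {}" "1 \<le> k" using n_pos k by (auto simp: lessThan_empty_iff)
    fix Ts assume Ts: "tree_cover {..<n} k Ts"
    show "lp_cost p d (output_trees n k s') / 64 \<le> lp_cost p d Ts"
    proof (cases "search_inv k q \<rho>")
      case True
      then show ?thesis using approximation[OF True m Ts p] m' by (simp add: cost)
    next
      case False
      \<comment> \<open>With \<open>n\<close> heads every point is a piece by itself, and the cost
        is 0.\<close>
      then have "n \<le> q" using inv by simp
      have "cut t" if "1 \<le> t" "t \<le> n" for t
      proof -
        have "rk (M ! t) < n" using bij_betwE[OF bij_rk] M_less[OF that] by blast
        then have "M ! t \<in> top_ranked q" using M_less[OF that] \<open>n \<le> q\<close> by (simp add: top_ranked_def)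
        then show ?thesis by (simp add: cut_def)
      qed
      then have "piece_weight j n = 0" for j
        unfolding piece_weight_def by (intro sum.neutral) auto
      then have "lp_cost p d (output_trees n k s') = 0" by (simp add: cost)
      moreover have "0 \<le> lp_cost p d Ts" by (simp add: lp_cost_def)
      ultimately show ?thesis by simp
    qed
  qed
  then show "lp_cost p d (output_trees n k s') \<le> 64 * OPT p {..<n} d k" by simp
qed

end

lemma ok_algorithm:
  assumes n: "1 \<le> n" and k: "1 \<le> k" and d: "Metric_space {..<n} d"
  shows "ok (n + k) algorithm (input_state n k d) (\<lambda>s. tree_cover {..<n} k (output_trees n k s) \<and>
    (\<forall>p\<ge>1. lp_cost p d (output_trees n k s) \<le> 64 * OPT p {..<n} d k))"
  unfolding algorithm_def
proof (rule ok_Seq, rule ok_mono[OF ok_prim[of n d "input_state n k d"]])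
  let ?s = "input_state n k d"
  have D: "snd ?s ''d'' [u, v] = d u v" if "u < n" "v < n" for u v
    using that by (simp add: input_state_def)
  show "prim_inv n d 0 ?s" "fst ?s ''n'' [] = n" "\<And>u v. u < n \<Longrightarrow> v < n \<Longrightarrow> snd ?s ''d'' [u, v] = d u v" "n \<le> n + k"
    using D by (auto simp: prim_inv_def input_state_def)
  fix s1 assume inv: "prim_inv n d n s1" and F1: "same (iwrites prim) (rwrites prim) ?s s1"
  define vx where "vx = (\<lambda>l. fst s1 ''vx'' [l])"
  define pa where "pa = (\<lambda>l. fst s1 ''pa'' [l])"
  define e where "e = (\<lambda>l. snd s1 ''e'' [l])"
  interpret prim_order n d vx pa e
    unfolding vx_def pa_def e_def by (rule prim_order_if_prim_inv[OF inv _ d]) (use n in simp)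
  have zero: "fst s1 x l = 0" if "x \<in> {''rk'', ''so'', ''V'', ''E''}" for x l
  proof -
    have "fst s1 x = fst ?s x" by (rule same_fst[OF F1]) (use that in auto)
    then show ?thesis using that by (auto simp: input_state_def)
  qed
  have in1: "fst s1 ''n'' [] = n" "fst s1 ''k'' [] = k" "snd s1 ''z'' [] = 0"
    "\<And>u v. u < n \<Longrightarrow> v < n \<Longrightarrow> snd s1 ''d'' [u, v] = d u v"
    using F1 D by (auto simp: same_def input_state_def)
  show "ok (n + k) (Seq rank (Seq search emit)) s1 (\<lambda>s. tree_cover {..<n} k (output_trees n k s) \<and>
    (\<forall>p\<ge>1. lp_cost p d (output_trees n k s) \<le> 64 * OPT p {..<n} d k))"
  proof (rule ok_Seq, rule ok_mono[OF ok_rank])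
    fix s2 assume R: "(\<forall>l<n. fst s2 ''rk'' [l] = rk l \<and> fst s2 ''so'' [rk l] = l) \<and> (\<forall>l\<ge>n. fst s2 ''so'' [l] = 0)"
      and F2: "same (iwrites rank) (rwrites rank) s1 s2"
    have ld: "loaded s2"
    proof -
      have "fst s2 x = fst s1 x" if "x \<in> {''n'', ''vx'', ''pa''}" for x
        by (rule same_fst[OF F2]) (use that in auto)
      moreover have "snd s2 x = snd s1 x" for x
        by (rule same_snd[OF F2]) simp
      ultimately have "fst s2 ''n'' [] = n" "snd s2 ''z'' [] = 0" "\<And>l. fst s2 ''vx'' [l] = vx l"
        "\<And>l. fst s2 ''pa'' [l] = pa l" "\<And>l. snd s2 ''e'' [l] = e l"
        "\<And>u v. u < n \<Longrightarrow> v < n \<Longrightarrow> snd s2 ''d'' [u, v] = d u v"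
        using in1 by (simp_all add: vx_def pa_def e_def)
      then show ?thesis using R by (simp add: loaded_def)
    qed
    have k2: "fst s2 ''k'' [] = k" using F2 in1 by (simp add: same_def)
    show "ok (n + k) (Seq search emit) s2 (\<lambda>s. tree_cover {..<n} k (output_trees n k s) \<and>
      (\<forall>p\<ge>1. lp_cost p d (output_trees n k s) \<le> 64 * OPT p {..<n} d k))"
    proof (rule ok_Seq, rule ok_mono[OF ok_search[OF ld k2]])
      fix s3 assume "\<exists>q \<rho>. loaded s3 \<and> fst s3 ''k'' [] = k \<and> is_built q (32 * \<rho>) s3
        \<and> 0 < q \<and> 0 \<le> \<rho> \<and> pieces q (32 * \<rho>) \<le> k \<and> (search_inv k q \<rho> \<or> n \<le> k \<and> q = n)"
        and F3: "same (iwrites search) (rwrites search) s2 s3"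
      then obtain q \<rho> where s3: "loaded s3" "fst s3 ''k'' [] = k" "is_built q (32 * \<rho>) s3"
        "0 < q" "0 \<le> \<rho>" "pieces q (32 * \<rho>) \<le> k" "search_inv k q \<rho> \<or> n \<le> k \<and> q = n" by blast
      have "fst s3 x = fst s1 x" if "x \<in> {''V'', ''E''}" for x
        using that same_fst[OF F2, of x] same_fst[OF F3, of x] by auto
      then have VE: "fst s3 ''V'' l = 0" "fst s3 ''E'' l = 0" for l using zero by auto
      have c: "fst s3 ''c'' [] = pieces q (32 * \<rho>)" by (rule is_built_pieces) (use s3 in auto)
      have vx3: "fst s3 ''vx'' [l] = vx l" if "l < n" for l using s3(1) that by (simp add: loaded_def)
      show "ok (n + k) emit s3 (\<lambda>s. tree_cover {..<n} k (output_trees n k s) \<and>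
        (\<forall>p\<ge>1. lp_cost p d (output_trees n k s) \<le> 64 * OPT p {..<n} d k))"
      proof (rule ok_mono[OF ok_emit[OF _ s3(2) c VE]])
        show "fst s3 ''n'' [] = n" using s3(1) by (simp add: loaded_def)
        fix s4 :: state
        assume "(\<forall>j v. fst s4 ''V'' [j, v] = (if (pieces q (32 * \<rho>) \<le> j \<and> j < k \<and> v = 0) \<or>
            (\<exists>y<n. fst s3 ''pc'' [y] = j \<and> fst s3 ''vx'' [y] = v) then 1 else 0)) \<and>
          (\<forall>j u v. u < v \<longrightarrow> fst s4 ''E'' [j, u, v] = (if \<exists>y<n. fst s3 ''ct'' [y] = 0 \<and> fst s3 ''pc'' [y] = j
            \<and> {u, v} = {fst s3 ''vx'' [fst s3 ''pv'' [y]], fst s3 ''vx'' [y]} then 1 else 0))"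
        then show "tree_cover {..<n} k (output_trees n k s4) \<and>
          (\<forall>p\<ge>1. lp_cost p d (output_trees n k s4) \<le> 64 * OPT p {..<n} d k)"
          using emitted_cover[OF s3(3-7) _ vx3] k by auto
      qed auto
    qed (use k in auto)
  qed (use in1 zero in \<open>auto simp: e_def\<close>)
qed

theorem theorem1:
  shows "\<exists>\<alpha>::real. \<alpha> \<ge> 1 \<and> (\<exists>(c::com) (q::nat poly).
    \<forall>(n::nat) (k::nat) (d::nat \<Rightarrow> nat \<Rightarrow> real).
      n \<ge> 1 \<longrightarrow> k \<ge> 1 \<longrightarrow> Metric_space {..<n} d \<longrightarrow>
      (\<exists>t s. exec c (input_state n k d) t s \<and> t \<le> poly q (n + k) \<and>
         tree_cover {..<n} k (output_trees n k s) \<and>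
         (\<forall>p::real. p \<ge> 1 \<longrightarrow> lp_cost p d (output_trees n k s) \<le> \<alpha> * OPT p {..<n} d k)))"
proof -
  \<comment> \<open>The program is fixed, so its syntactic cost bound is one polynomial, to be taken
    at \<open>z = n + k\<close>.\<close>
  obtain q where q: "\<forall>z. wc z algorithm = poly q z" using wc_polynomial by blast
  show ?thesis
  proof (intro exI[of _ "64::real"] exI[of _ algorithm] exI[of _ q] conjI allI impI)
    show "(1::real) \<le> 64" by simp
    fix n k :: nat and d :: "nat \<Rightarrow> nat \<Rightarrow> real"
    assume "n \<ge> 1" "k \<ge> 1" "Metric_space {..<n} d"
    then show "\<exists>t s. exec algorithm (input_state n k d) t s \<and> t \<le> poly q (n + k) \<and>
         tree_cover {..<n} k (output_trees n k s) \<and>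
         (\<forall>p::real. p \<ge> 1 \<longrightarrow> lp_cost p d (output_trees n k s) \<le> 64 * OPT p {..<n} d k)"
      using ok_algorithm[of n k d] q by (auto simp: ok_def)
  qed
qed

end
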